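(* Let $E=\mathbb{C}^d$, $F=\mathbb{C}^r$, $p\in\mathbb{R}^d\subset E$, let $K_0\subset E$ be a compact absolutely convex neighbourhood of $0$ and $K:=p+K_0$. Let $f:K\to F$ be an analytic map. Let $m,n\in\mathbb{Z}_{\ge0}$ with $m\le n$. Let $\mu$ be a Borel probability measure on $K_0$ with $\mathrm{supp}(\mu)\subset K_0$. Let $z_0^1,\dots,z_0^N\in\mathrm{supp}(\mu)$, $\widehat\mu_N:=N^{-1}\sum_{i=1}^N\delta_{z_0^i}$ and $Z_N:=(p+z_0^1,\dots,p+z_0^N)\in K^N$. Assume that $\mathbf{D}_n(\mu)$ is invertible and that there exists $\gamma\in(0,1)$ such that $$\big\|\mathbf{I}-\mathbf{D}_n(\mu)^{-1/2}\mathbf{D}_n(\widehat\mu_N)\mathbf{D}_n(\mu)^{-1/2}\big\|_{\rm op}\le1-\gamma.$$ Define $\widehat{f}_{m,n,Z_N}=(\widehat{f}_{m,n,Z_N,1},\dots,\widehat{f}_{m,n,Z_N,r}):E\to F$ by $$\widehat{f}_{m,n,Z_N,i}(z):=\mathbf{u}_{p,m}(z)\,\widehat{\mathbf{C}}_{m,n,Z_N}^*\big(\partial_{w_i}\mathbf{v}_{f(p),m}(0)\big)^*,\qquad i=1,\dots,r.$$ Then, for any compact subset $K_1\Subset K_0$, $$\sup_{z\in p+K_1}\big\|\widehat{f}_{m,n,Z_N}(z)-f(z)\big\|_F\le C'\Big(\sqrt{\frac{m!}{\gamma}}\cdot\frac{R_\mu^n}{\Lambda_n(\mu)^{1/2}}+R_{K_1}^m\Big),$$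 where $R_\mu:=\sup_{x\in\mathrm{supp}(\mu)}|x|_{K_0}$, $R_{K_1}:=\sup_{z\in K_1}|z|_{K_0}$, and $C'$ is a constant depending only on $f,p,K_0,K_1$ and $\mu$.
   Context: $E=\mathbb{C}^d$ and $F=\mathbb{C}^r$ carry the standard Hermitian inner products and norms. A set $S$ is absolutely convex if $ax+by\in S$ whenever $x,y\in S$ and $a,b\in\mathbb{C}$, $|a|+|b|\le1$. $|z|_{K_0}:=\inf\{t>0: z\in tK_0\}$. $K_1\Subset K_0$ means $K_1\subset\mathrm{int}(K_0)$. $^*$ on matrices and vectors is conjugate transpose, $\dagger$ the Moore–Penrose pseudo-inverse, $\|\cdot\|_{\rm op}$ the operator norm. A map on a compact set $K$ is analytic if it is the restriction of a holomorphic map on an open neighbourhood of $K$. Fix a numbering $\{\alpha^{(i)}\}_{i\ge1}$ of $\mathbb{Z}_{\ge0}^d$ with $\alpha^{(1)}=0$, $\alpha^{(i+1)}$ the $i$-th elementary vector for $1\le i\le d$, and $|\alpha^{(i)}|\le|\alpha^{(j)}|$ for $i\le j$; similarly $\{\beta^{(i)}\}$ of $\mathbb{Z}_{\ge0}^r$. Put $r_n^E=\binom{n+d}{d}$, $r_n^F=\binom{n+r}{r}$, $$u_{p,i}(z)=\frac{e^{-\|p\|^2/2}}{\sqrt{\alpha^{(i)}!}}(z-p)^{\alpha^{(i)}}e^{p^*z},\qquad v_{q,i}(w)=\frac{e^{-\|q\|^2/2}}{\sqrt{\beta^{(i)}!}}(w-q)^{\beta^{(i)}}e^{q^*w},$$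 and row vectors $\mathbf{u}_{p,n}(z)=(u_{p,1}(z),\dots,u_{p,r_n^E}(z))$, $\mathbf{v}_{q,n}(w)=(v_{q,1}(w),\dots,v_{q,r_n^F}(w))$. For $Z=(z^1,\dots,z^N)\in E^N$ let $\mathbf{U}_{p,n,Z}\in\mathbb{C}^{N\times r_n^E}$ be the matrix with rows $\mathbf{u}_{p,n}(z^i)$; for $W=(w^1,\dots,w^N)\in F^N$ let $\mathbf{V}_{q,n,W}\in\mathbb{C}^{N\times r_n^F}$ be the matrix with rows $\mathbf{v}_{q,n}(w^i)$. For $Z\in K^N$, $W=(f(z^1),\dots,f(z^N))$ and $m\le n$, $\widehat{\mathbf{C}}_{m,n,Z}\in\mathbb{C}^{r_m^F\times r_m^E}$ consists of the first $r_m^E$ columns of $\mathbf{V}_{f(p),m,W}^*(\mathbf{U}_{p,n,Z}^* )^\dagger$. For a Borel measure $\mu$ on $E$ (with the relevant moments finite), $\mathbf{D}_n(\mu)=\big(\int\overline{z^{\alpha^{(i)}}}z^{\alpha^{(j)}}d\mu(z)\big)_{i,j=1}^{r_n^E}$ and $\Lambda_n(\mu)$ is its smallest eigenvalue. *)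

theory Defs
  imports
    "HOL-Probability.Giry_Monad"
    "Jordan_Normal_Form.Gauss_Jordan_Elimination"
    "Jordan_Normal_Form.Schur_Decomposition"
begin

text \<open>
  Points of \<open>\<complex>\<^sup>d\<close> and \<open>\<complex>\<^sup>r\<close> are vectors of type \<open>complex ^ 'n\<close>, whose \<open>norm\<close> is the standard
  Hermitian norm. Matrices whose size varies with the degree are those of \<open>Jordan_Normal_Form\<close>.
  We keep \<open>$\<close> for the components of \<open>complex ^ 'n\<close>.
\<close>

no_notation vec_index (infixl \<open>$\<close> 100)


section \<open>Sets, gauges, analytic maps\<close>

definition absolutely_convex :: "(complex ^ 'n::finite) set \<Rightarrow> bool" where
  "absolutely_convex S \<longleftrightarrow>
     (\<forall>x\<in>S. \<forall>y\<in>S. \<forall>a b. cmod a + cmod b \<le> 1 \<longrightarrow> a *s x + b *s y \<in> S)"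

definition gauge_norm :: "'a::real_vector set \<Rightarrow> 'a \<Rightarrow> real" where
  "gauge_norm S z = Inf {t. 0 < t \<and> z \<in> (\<lambda>x. t *\<^sub>R x) ` S}"

definition holomorphic_map_on :: "(complex ^ 'n::finite \<Rightarrow> complex ^ 'm::finite) \<Rightarrow> (complex ^ 'n) set \<Rightarrow> bool" where
  "holomorphic_map_on g U \<longleftrightarrow>
     (\<forall>z\<in>U. \<exists>L. (g has_derivative L) (at z) \<and> Vector_Spaces.linear (*s) (*s) L)"

definition analytic_map_on :: "(complex ^ 'n::finite \<Rightarrow> complex ^ 'm::finite) \<Rightarrow> (complex ^ 'n) set \<Rightarrow> bool" where
  "analytic_map_on f K \<longleftrightarrow>
     (\<exists>U g. open U \<and> K \<subseteq> U \<and> holomorphic_map_on g U \<and> (\<forall>z\<in>K. f z = g z))"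


section \<open>Multi-indices\<close>

definition mi_deg :: "nat ^ 'n::finite \<Rightarrow> nat" where
  "mi_deg a = (\<Sum>k\<in>UNIV. a $ k)"

definition mi_fact :: "nat ^ 'n::finite \<Rightarrow> nat" where
  "mi_fact a = (\<Prod>k\<in>UNIV. fact (a $ k))"

definition mi_power :: "complex ^ 'n::finite \<Rightarrow> nat ^ 'n \<Rightarrow> complex" where
  "mi_power z a = (\<Prod>k\<in>UNIV. (z $ k) ^ (a $ k))"

text \<open>
  The linear order on the index type only serves to name the coordinates: \<open>coord i\<close> is the
  \<open>i\<close>-th one, counted from 0.
\<close>

definition coord :: "nat \<Rightarrow> 'n::{finite,linorder}" where
  "coord i = sorted_list_of_set (UNIV :: 'n set) ! i"

text \<open>
  Numberings start at 0, so that \<open>\<alpha> i\<close> here is the multi-index with number \<open>i + 1\<close> in the usual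
  count starting at 1.
\<close>

definition mi_numbering :: "(nat \<Rightarrow> nat ^ 'n::{finite,linorder}) \<Rightarrow> bool" where
  "mi_numbering \<alpha> \<longleftrightarrow>
     bij \<alpha> \<and> \<alpha> 0 = 0 \<and> (\<forall>i < CARD('n). \<alpha> (Suc i) = axis (coord i) 1) \<and>
     (\<forall>i j. i \<le> j \<longrightarrow> mi_deg (\<alpha> i) \<le> mi_deg (\<alpha> j))"

definition poly_dim :: "'n::finite itself \<Rightarrow> nat \<Rightarrow> nat" where
  "poly_dim _ n = (n + CARD('n)) choose CARD('n)"


section \<open>Complex matrices\<close>

definition vec_l2norm :: "complex Matrix.vec \<Rightarrow> real" where
  "vec_l2norm v = L2_set (\<lambda>i. cmod (vec_index v i)) {..<dim_vec v}"

definition mat_op_norm :: "complex Matrix.mat \<Rightarrow> real" where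
  "mat_op_norm A = (SUP v \<in> {v \<in> carrier_vec (dim_col A). vec_l2norm v \<le> 1}. vec_l2norm (A *\<^sub>v v))"

definition is_pseudo_inverse :: "complex Matrix.mat \<Rightarrow> complex Matrix.mat \<Rightarrow> bool" where
  "is_pseudo_inverse A X \<longleftrightarrow>
     X \<in> carrier_mat (dim_col A) (dim_row A) \<and> A * X * A = A \<and> X * A * X = X \<and>
     mat_adjoint (A * X) = A * X \<and> mat_adjoint (X * A) = X * A"

definition pseudo_inverse :: "complex Matrix.mat \<Rightarrow> complex Matrix.mat" where
  "pseudo_inverse A = (THE X. is_pseudo_inverse A X)"

definition pos_semidef :: "complex Matrix.mat \<Rightarrow> bool" where
  "pos_semidef A \<longleftrightarrow>
     square_mat A \<and> mat_adjoint A = A \<and>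
     (\<forall>v \<in> carrier_vec (dim_row A). 0 \<le> Re ((A *\<^sub>v v) \<bullet>c v))"

definition mat_sqrt :: "complex Matrix.mat \<Rightarrow> complex Matrix.mat" where
  "mat_sqrt A = (THE S. pos_semidef S \<and> S * S = A)"

definition mat_inv_sqrt :: "complex Matrix.mat \<Rightarrow> complex Matrix.mat" where
  "mat_inv_sqrt A = the (mat_inverse (mat_sqrt A))"

text \<open>Meant for Hermitian matrices, all of whose eigenvalues are real.\<close>

definition min_eigenvalue :: "complex Matrix.mat \<Rightarrow> real" where
  "min_eigenvalue A = Min {x. eigenvalue A (complex_of_real x)}"

definition first_cols :: "nat \<Rightarrow> complex Matrix.mat \<Rightarrow> complex Matrix.mat" where
  "first_cols k A = Matrix.mat (dim_row A) k (\<lambda>(i, j). A $$ (i, j))"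


section \<open>Measures\<close>

definition msupport :: "'a::topological_space measure \<Rightarrow> 'a set" where
  "msupport \<mu> = {x. \<forall>U. open U \<and> x \<in> U \<longrightarrow> 0 < emeasure \<mu> U}"

definition empirical_measure :: "nat \<Rightarrow> (nat \<Rightarrow> 'a::topological_space) \<Rightarrow> 'a measure" where
  "empirical_measure N x =
     measure_of UNIV (sets borel) (\<lambda>A. (\<Sum>i<N. emeasure (return borel (x i)) A) / of_nat N)"

definition moment_matrix :: "(nat \<Rightarrow> nat ^ 'n::finite) \<Rightarrow> nat \<Rightarrow> (complex ^ 'n) measure \<Rightarrow> complex Matrix.mat" where
  "moment_matrix \<alpha> n \<mu> =
     Matrix.mat (poly_dim TYPE('n) n) (poly_dim TYPE('n) n)
       (\<lambda>(i, j). \<integral>z. cnj (mi_power z (\<alpha> i)) * mi_power z (\<alpha> j) \<partial>\<mu>)"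


section \<open>The basis functions and the estimator\<close>

text \<open>
  With \<open>(p, \<alpha>)\<close> on \<open>\<complex>\<^sup>d\<close> these are the functions \<open>u\<^bsub>p,i\<^esub>\<close>, with \<open>(q, \<beta>)\<close> on \<open>\<complex>\<^sup>r\<close> the functions
  \<open>v\<^bsub>q,i\<^esub>\<close>. The last factor is \<open>exp (p\<^sup>* z)\<close>.
\<close>

definition fock_fun :: "(nat \<Rightarrow> nat ^ 'n::finite) \<Rightarrow> complex ^ 'n \<Rightarrow> nat \<Rightarrow> complex ^ 'n \<Rightarrow> complex" where
  "fock_fun \<alpha> p i z =
     complex_of_real (exp (- (norm p)\<^sup>2 / 2) / sqrt (real (mi_fact (\<alpha> i))))
       * mi_power (z - p) (\<alpha> i) * exp (\<Sum>k\<in>UNIV. cnj (p $ k) * z $ k)"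

definition fock_row :: "(nat \<Rightarrow> nat ^ 'n::finite) \<Rightarrow> complex ^ 'n \<Rightarrow> nat \<Rightarrow> complex ^ 'n \<Rightarrow> complex Matrix.mat" where
  "fock_row \<alpha> p n z = Matrix.mat 1 (poly_dim TYPE('n) n) (\<lambda>(_, j). fock_fun \<alpha> p j z)"

definition fock_matrix ::
  "(nat \<Rightarrow> nat ^ 'n::finite) \<Rightarrow> complex ^ 'n \<Rightarrow> nat \<Rightarrow> nat \<Rightarrow> (nat \<Rightarrow> complex ^ 'n) \<Rightarrow> complex Matrix.mat" where
  "fock_matrix \<alpha> p n N Z = Matrix.mat N (poly_dim TYPE('n) n) (\<lambda>(i, j). fock_fun \<alpha> p j (Z i))"

definition partial_deriv :: "'n::finite \<Rightarrow> (complex ^ 'n \<Rightarrow> complex) \<Rightarrow> complex ^ 'n \<Rightarrow> complex" where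
  "partial_deriv k g w = deriv (\<lambda>t. g (w + t *s axis k 1)) 0"

definition fock_row_partial ::
  "(nat \<Rightarrow> nat ^ 'n::finite) \<Rightarrow> complex ^ 'n \<Rightarrow> nat \<Rightarrow> 'n \<Rightarrow> complex ^ 'n \<Rightarrow> complex Matrix.mat" where
  "fock_row_partial \<beta> q n k w =
     Matrix.mat 1 (poly_dim TYPE('n) n) (\<lambda>(_, j). partial_deriv k (fock_fun \<beta> q j) w)"

definition C_hat ::
  "(nat \<Rightarrow> nat ^ 'd::finite) \<Rightarrow> (nat \<Rightarrow> nat ^ 'r::finite) \<Rightarrow> (complex ^ 'd \<Rightarrow> complex ^ 'r) \<Rightarrow>
   complex ^ 'd \<Rightarrow> nat \<Rightarrow> nat \<Rightarrow> nat \<Rightarrow> (nat \<Rightarrow> complex ^ 'd) \<Rightarrow> complex Matrix.mat" where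
  "C_hat \<alpha> \<beta> f p m n N Z =
     first_cols (poly_dim TYPE('d) m)
       (mat_adjoint (fock_matrix \<beta> (f p) m N (\<lambda>i. f (Z i)))
         * pseudo_inverse (mat_adjoint (fock_matrix \<alpha> p n N Z)))"

definition f_hat ::
  "(nat \<Rightarrow> nat ^ 'd::finite) \<Rightarrow> (nat \<Rightarrow> nat ^ 'r::finite) \<Rightarrow> (complex ^ 'd \<Rightarrow> complex ^ 'r) \<Rightarrow>
   complex ^ 'd \<Rightarrow> nat \<Rightarrow> nat \<Rightarrow> nat \<Rightarrow> (nat \<Rightarrow> complex ^ 'd) \<Rightarrow> complex ^ 'd \<Rightarrow> complex ^ 'r" where
  "f_hat \<alpha> \<beta> f p m n N Z z =
     (\<chi> i. (fock_row \<alpha> p m z * mat_adjoint (C_hat \<alpha> \<beta> f p m n N Z)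
             * mat_adjoint (fock_row_partial \<beta> (f p) m i 0)) $$ (0, 0))"

end

theory Submission
  imports
    Defs
    "HOL-Complex_Analysis.Cauchy_Integral_Formula"
    "Jordan_Normal_Form.Jordan_Normal_Form_Existence"
    "Jordan_Normal_Form.Jordan_Normal_Form_Uniqueness"
begin

text \<open>
  Write \<open>q = f p\<close> and \<open>x = z - p\<close>. The reproducing identity
  \<open>exp (w'\<^sup>* w) = (\<Sum>k. v\<^bsub>q,k\<^esub> w * cnj (v\<^bsub>q,k\<^esub> w'))\<close>, differentiated at \<open>w' = 0\<close>, recovers the
  coordinate \<open>w\<^sub>i\<close>. Cut off at degree \<open>m\<close>, it becomes an explicit function of \<open>w\<close>, built from truncated
  exponentials, that differs from \<open>w\<^sub>i\<close> by \<open>O (R ^ m)\<close> when \<open>norm (w - q) \<le> A * R\<close>, \<open>R \<le> 1\<close>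
  (\<open>fock_coord_sum\<close>, \<open>coord_approx_error\<close>). Since the pseudo-inverse of an injective matrix solves the
  normal equations, the estimator is the part of degree at most \<open>m\<close> of a least squares fit of degree \<open>n\<close>, in the
  basis \<open>u\<^bsub>p,j\<^esub>\<close>, to the values of this function at the points \<open>f z\<close> of the data
  (\<open>f_hat_least_squares\<close>).

  Dividing by \<open>exp (p\<^sup>* z)\<close> turns the fit into a weighted polynomial least squares problem in \<open>x\<close> whose weights
  are bounded above and away from zero. The fitted function \<open>G\<close> is holomorphic near \<open>\<rho> K\<^sub>0\<close> for some
  \<open>\<rho> > 1\<close>, with a bound that does not depend on \<open>m\<close>; hence its Taylor polynomial of degree \<open>k\<close>
  misses it at \<open>R y\<close>, \<open>y \<in> K\<^sub>0\<close>, by at most a constant times \<open>R ^ Suc k\<close> (\<open>taylor_expansion\<close>).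
  Let \<open>b\<close> be the difference between the fitted coefficients and the Taylor coefficients. The normal equations
  bound the mean square of the polynomial \<open>b\<close> over the data by that of the Taylor remainder, which is of
  size \<open>R\<^sub>\<mu> ^ n\<close>. The hypothesis on the operator norm says that the empirical moment form
  dominates \<open>\<gamma>\<close> times the moment form of \<open>\<mu>\<close>, and the latter dominates
  \<open>\<Lambda>\<close> times the squared Euclidean norm, where \<open>\<Lambda>\<close> is the smallest eigenvalue. So
  \<open>norm b\<close> is \<open>O (R\<^sub>\<mu> ^ n / sqrt (\<gamma> * \<Lambda>))\<close>. Evaluating the part of degree at most \<open>m\<close> costs
  the factor \<open>sqrt (fact m)\<close>, by the Cauchy-Schwarz inequality with weights \<open>\<alpha>!\<close> and
  \<open>(\<Sum>\<alpha>. \<bar>x\<^sup>\<alpha>\<bar>\<^sup>2 / \<alpha>!) \<le> exp (norm x ^ 2)\<close> (\<open>truncated_poly_bound\<close>). The Taylor remainder of degree \<open>m\<close>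
  and the cut-off of the coordinate contribute the summand \<open>R ^ m\<close> with \<open>R\<close> the gauge of \<open>K\<^sub>1\<close>.

  The facts about matrices rest on the diagonalization of Hermitian matrices, which is derived from the Jordan
  normal form. The facts about holomorphic functions of several variables are reduced to one variable by
  restriction to complex lines.
\<close>

section \<open>Adjoints and inner products\<close>

lemma dim_mat_adjoint [simp]:
  "dim_row (mat_adjoint A) = dim_col A" "dim_col (mat_adjoint A) = dim_row A"
  by (auto simp: mat_adjoint_def)

lemma mat_adjoint_carrier [simp]:
  "A \<in> carrier_mat n k \<Longrightarrow> mat_adjoint A \<in> carrier_mat k n"
  by (auto intro: carrier_matI)

lemma index_mat_adjoint [simp]:
  fixes A :: "complex mat"
  assumes "i < dim_col A" "j < dim_row A"
  shows "mat_adjoint A $$ (i, j) = cnj (A $$ (j, i))"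
  using assms by (simp add: mat_adjoint_def mat_of_rows_def)

lemma mat_adjoint_adjoint [simp]: "mat_adjoint (mat_adjoint A) = (A :: complex mat)"
  by (rule eq_matI) auto

lemma mat_adjoint_mult:
  fixes A B :: "complex mat"
  assumes "A \<in> carrier_mat n k" "B \<in> carrier_mat k l"
  shows "mat_adjoint (A * B) = mat_adjoint B * mat_adjoint A"
  using assms by (intro eq_matI) (auto simp: scalar_prod_def mult.commute)

lemma mat_adjoint_one [simp]: "mat_adjoint (1\<^sub>m n) = (1\<^sub>m n :: complex mat)"
  by (rule eq_matI) auto

lemma inner_prod_sum:
  fixes v w :: "complex Matrix.vec"
  assumes "w \<in> carrier_vec n"
  shows "v \<bullet>c w = (\<Sum>i<n. vec_index v i * cnj (vec_index w i))"
  using assms by (auto simp: scalar_prod_def atLeast0LessThan)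

lemma inner_prod_adjoint:
  fixes A :: "complex mat"
  assumes A: "A \<in> carrier_mat n k" and "v \<in> carrier_vec k" "w \<in> carrier_vec n"
  shows "(A *\<^sub>v v) \<bullet>c w = v \<bullet>c (mat_adjoint A *\<^sub>v w)"
proof -
  have "(A *\<^sub>v v) \<bullet>c w = (\<Sum>i<n. \<Sum>j<k. A $$ (i, j) * vec_index v j * cnj (vec_index w i))"
    using assms by (auto simp: inner_prod_sum scalar_prod_def sum_distrib_right atLeast0LessThan intro!: sum.cong)
  also have "\<dots> = (\<Sum>j<k. \<Sum>i<n. A $$ (i, j) * vec_index v j * cnj (vec_index w i))"
    by (rule sum.swap)
  also have "\<dots> = v \<bullet>c (mat_adjoint A *\<^sub>v w)"
    using assms by (auto simp: inner_prod_sum[where n=k] scalar_prod_def sum_distrib_left atLeast0LessThan mult_ac intro!: sum.cong)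
  finally show ?thesis .
qed

section \<open>Diagonalization of Hermitian matrices\<close>

definition diag_matrix :: "nat \<Rightarrow> (nat \<Rightarrow> complex) \<Rightarrow> complex mat" where
  "diag_matrix n d = Matrix.mat n n (\<lambda>(i, j). if i = j then d i else 0)"

lemma diag_matrix_carrier [simp]: "diag_matrix n d \<in> carrier_mat n n"
  by (simp add: diag_matrix_def)

text \<open>
  The two sums are the dimensions of the kernels of \<open>(A - a)\<^sup>2\<close> and of \<open>A - a\<close> in terms of
  the sizes of the Jordan blocks with eigenvalue \<open>a\<close>.
\<close>

lemma min_sums_eq_imp_all_one:
  fixes ks :: "nat list"
  assumes "\<forall>k\<in>set ks. k \<noteq> 0" "sum_list (map (min 2) ks) = sum_list (map (min 1) ks)"
  shows "\<forall>k\<in>set ks. k = 1"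
  using assms
proof (induction ks)
  case (Cons k ks)
  have "sum_list (map (min 1) ks) \<le> sum_list (map (min 2) ks)"
    by (rule sum_list_mono) auto
  moreover have "min 1 k \<le> min 2 k" by simp
  moreover have "min 2 k + sum_list (map (min 2) ks) = min 1 k + sum_list (map (min 1) ks)"
    using Cons.prems(2) by simp
  ultimately have "min 2 k = min 1 k" and eq: "sum_list (map (min 2) ks) = sum_list (map (min 1) ks)"
    by linarith+
  moreover have "k \<noteq> 0" using Cons.prems by simp
  ultimately have "k = 1" by (auto simp: min_def split: if_splits)
  with Cons.IH[OF _ eq] Cons.prems(1) show ?case by simp
qed simp

lemma jordan_matrix_all_blocks_one:
  assumes "\<forall>x\<in>set n_as. fst x = 1"
  shows "jordan_matrix n_as = diag_matrix (length n_as) (\<lambda>i. snd (n_as ! i))"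
  using assms
proof (induction n_as)
  case Nil
  then show ?case by (auto simp: jordan_matrix_def diag_matrix_def)
next
  case (Cons x xs)
  obtain a where x: "x = (1, a)" using Cons.prems by (cases x) auto
  have IH: "jordan_matrix xs = diag_matrix (length xs) (\<lambda>i. snd (xs ! i))" using Cons by auto
  have len: "sum_list (map fst xs) = length xs" 
    using Cons.prems by (induction xs) auto
  show ?case unfolding x jordan_matrix_Cons IH
    by (rule eq_matI) (auto simp: diag_matrix_def len nth_Cons split: nat.splits)
qed

text \<open>
  For Hermitian \<open>A\<close> the kernel of \<open>(A - a)\<^sup>2\<close> is that of \<open>A - a\<close>: a nonzero
  \<open>w = (A - a) v\<close> in the kernel of \<open>A - a\<close> would force \<open>a\<close> to be real, so that \<open>A - a\<close> is itself Hermitian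
  and \<open>\<langle>w, w\<rangle> = \<langle>v, (A - a) w\<rangle> = 0\<close>.
\<close>

lemma hermitian_generalized_eigenvector:
  fixes A :: "complex mat"
  assumes A: "A \<in> carrier_mat n n" and herm: "mat_adjoint A = A"
    and v: "v \<in> carrier_vec n" and w: "w = char_matrix A a *\<^sub>v v" and 0: "char_matrix A a *\<^sub>v w = 0\<^sub>v n"
  shows "w = 0\<^sub>v n"
proof (rule ccontr)
  assume nz: "w \<noteq> 0\<^sub>v n"
  let ?M = "char_matrix A a"
  have M: "?M \<in> carrier_mat n n" using A by (auto simp: char_matrix_def)
  have wc: "w \<in> carrier_vec n" using w M v by auto
  have Aw: "A *\<^sub>v w = a \<cdot>\<^sub>v w"
  proof -
    have "vec_index (?M *\<^sub>v w) i = vec_index (A *\<^sub>v w) i - a * vec_index w i" if "i < n" for i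
      using that A wc
      by (simp add: char_matrix_def scalar_prod_def algebra_simps sum.distrib sum_subtractf
          if_distrib[of "\<lambda>x. x * _"] if_distrib[of "\<lambda>x. _ * x"] cong: if_cong)
    then show ?thesis using 0 A wc by (intro eq_vecI) auto
  qed
  have ww: "w \<bullet>c w \<noteq> 0" using conjugate_square_eq_0_vec[OF wc] nz by auto
  have "(A *\<^sub>v w) \<bullet>c w = w \<bullet>c (A *\<^sub>v w)" using inner_prod_adjoint[OF A wc wc] herm by simp
  then have "a * (w \<bullet>c w) = cnj a * (w \<bullet>c w)"
    using wc unfolding Aw by (simp add: inner_prod_sum sum_distrib_left mult_ac)
  then have a: "cnj a = a" using ww by simp
  have Mh: "mat_adjoint ?M = ?M"
  proof (rule eq_matI)
    fix i j assume ij: "i < dim_row ?M" "j < dim_col ?M"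
    have "cnj (A $$ (j, i)) = A $$ (i, j)" 
      using ij A index_mat_adjoint[of i A j] unfolding herm by (auto simp: char_matrix_def)
    then show "mat_adjoint ?M $$ (i, j) = ?M $$ (i, j)"
      using ij A a by (auto simp: char_matrix_def)
  qed (use M in auto)
  have "w \<bullet>c w = v \<bullet>c (?M *\<^sub>v w)"
    using inner_prod_adjoint[OF M v wc] Mh w by simp
  also have "\<dots> = 0" unfolding 0 using v by (simp add: inner_prod_sum)
  finally show False using ww by simp
qed

text \<open>
  Since the kernels of \<open>(A - a)\<^sup>2\<close> and \<open>A - a\<close> agree for all \<open>a\<close>, no Jordan block is larger than \<open>1\<close>.
  The transition matrix \<open>P\<close> is not claimed to be unitary; what replaces unitarity below is that \<open>P\<^sup>* P\<close> commutes
  with the diagonal matrix.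
\<close>

lemma hermitian_diagonalizable:
  fixes A :: "complex mat"
  assumes A: "A \<in> carrier_mat n n" and herm: "mat_adjoint A = A"
  obtains P Q d where "P \<in> carrier_mat n n" "Q \<in> carrier_mat n n" "P * Q = 1\<^sub>m n" "Q * P = 1\<^sub>m n"
    "A = P * diag_matrix n d * Q"
proof -
  obtain as where "char_poly A = (\<Prod>a\<leftarrow>as. [:- a, 1:])" using char_poly_factorized[OF A] by auto
  then obtain n_as where jnf: "jordan_nf A n_as" using jordan_nf_exists[OF A] by blast
  have ker: "mat_kernel (char_matrix A a ^\<^sub>m 2) = mat_kernel (char_matrix A a ^\<^sub>m 1)" for a
  proof -
    let ?M = "char_matrix A a"
    have M: "?M \<in> carrier_mat n n" using A by (auto simp: char_matrix_def)
    have M2: "?M ^\<^sub>m 2 = ?M * ?M" using M by (simp add: numeral_2_eq_2)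
    have M1: "?M ^\<^sub>m 1 = ?M" using M by simp
    show ?thesis
      unfolding M1 M2 mat_kernel_def
      using M hermitian_generalized_eigenvector[OF A herm, of _ _ a]
      by (auto simp: assoc_mult_mat_vec[OF M M])
  qed
  have gen: "dim_gen_eigenspace A a 2 = dim_gen_eigenspace A a 1" for a
  proof -
    have "dim_col (char_matrix A a ^\<^sub>m 2) = dim_col (char_matrix A a ^\<^sub>m 1)"
      using A by (auto simp: char_matrix_def)
    then show ?thesis
      unfolding dim_gen_eigenspace_def kernel_dim_def ker by simp
  qed
  have "fst x = 1" if x: "x \<in> set n_as" for x
  proof -
    let ?ks = "map fst [(k, e)\<leftarrow>n_as. e = snd x]"
    have "\<forall>k\<in>set ?ks. k = 1"
    proof (rule min_sums_eq_imp_all_one)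
      show "\<forall>k\<in>set ?ks. k \<noteq> 0" using jnf unfolding jordan_nf_def by force
      show "sum_list (map (min 2) ?ks) = sum_list (map (min 1) ?ks)"
        using gen[of "snd x"] unfolding dim_gen_eigenspace[OF jnf] .
    qed
    moreover have "x \<in> set [(k, e)\<leftarrow>n_as. e = snd x]" using x by (cases x) auto
    then have "fst x \<in> set ?ks" unfolding set_map by (rule imageI)
    ultimately show ?thesis by blast
  qed
  then have J: "jordan_matrix n_as = diag_matrix (length n_as) (\<lambda>i. snd (n_as ! i))"
    by (intro jordan_matrix_all_blocks_one) auto
  obtain P Q where wit: "similar_mat_wit A (jordan_matrix n_as) P Q"
    using jnf unfolding jordan_nf_def similar_mat_def by auto
  note w = similar_mat_witD2[OF A wit]
  have "length n_as = n" using carrier_matD(1)[OF w(5)] unfolding J by (simp add: diag_matrix_def)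
  then show thesis using that w J by metis
qed

section \<open>Functional calculus and positive square roots\<close>

lemma diag_matrix_mult:
  "diag_matrix n g * diag_matrix n h = diag_matrix n (\<lambda>i. g i * h i)"
  by (rule eq_matI) (auto simp: diag_matrix_def scalar_prod_def if_distrib[of "\<lambda>x. x * _"] cong: if_cong)

lemma index_diag_matrix_mult:
  assumes "B \<in> carrier_mat n n" "i < n" "j < n"
  shows "(diag_matrix n g * B) $$ (i, j) = g i * B $$ (i, j)" "(B * diag_matrix n g) $$ (i, j) = B $$ (i, j) * g j"
  using assms by (auto simp: diag_matrix_def scalar_prod_def if_distrib[of "\<lambda>x. x * _"] if_distrib[of "\<lambda>x. _ * x"] cong: if_cong)

text \<open>
  Commuting with \<open>diag d\<close> means that the entry \<open>(i, j)\<close> vanishes unless \<open>d i = d j\<close>, and this condition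
  only becomes weaker when \<open>d\<close> is replaced by a function of \<open>d\<close>.
\<close>

lemma diag_matrix_commute_transfer:
  assumes B: "B \<in> carrier_mat n n" and comm: "diag_matrix n d * B = B * diag_matrix n d"
    and g: "\<And>i j. i < n \<Longrightarrow> j < n \<Longrightarrow> d i = d j \<Longrightarrow> g i = g j"
  shows "diag_matrix n g * B = B * diag_matrix n g"
proof (rule eq_matI)
  fix i j assume "i < dim_row (B * diag_matrix n g)" "j < dim_col (B * diag_matrix n g)"
  then have ij: "i < n" "j < n" using B by (auto simp: diag_matrix_def)
  have "d i * B $$ (i, j) = B $$ (i, j) * d j"
    using index_diag_matrix_mult(1)[OF B ij, of d] index_diag_matrix_mult(2)[OF B ij, of d]
    unfolding comm by (rule trans[OF sym])
  then show "(diag_matrix n g * B) $$ (i, j) = (B * diag_matrix n g) $$ (i, j)"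
    using g[OF ij] by (auto simp: index_diag_matrix_mult[OF B ij])
qed (use B in \<open>auto simp: diag_matrix_def\<close>)

lemma mult_carrier_square [simp]:
  "A \<in> carrier_mat n n \<Longrightarrow> B \<in> carrier_mat n n \<Longrightarrow> A * B \<in> carrier_mat n n"
  by (rule mult_carrier_mat)

locale hermitian_diagonalization =
  fixes n :: nat and A P Q :: "complex mat" and d :: "nat \<Rightarrow> complex"
  assumes A: "A \<in> carrier_mat n n" and herm: "mat_adjoint A = A"
    and P: "P \<in> carrier_mat n n" and Q: "Q \<in> carrier_mat n n"
    and PQ: "P * Q = 1\<^sub>m n" and QP: "Q * P = 1\<^sub>m n"
    and A_eq: "A = P * diag_matrix n d * Q"
begin

text \<open>
  This is \<open>h(A)\<close> when \<open>g i = h (d i)\<close>. Taking \<open>g\<close> as a function of the index leaves the compatibility condition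
  \<open>d i = d j \<Longrightarrow> g i = g j\<close> to the lemmas that depend on it.
\<close>

definition calc :: "(nat \<Rightarrow> complex) \<Rightarrow> complex mat" where
  "calc g = P * diag_matrix n g * Q"

lemma calc_carrier [simp]: "calc g \<in> carrier_mat n n"
  unfolding calc_def using P Q by (meson diag_matrix_carrier mult_carrier_mat)

lemma conj_mult:
  assumes "B \<in> carrier_mat n n" "C \<in> carrier_mat n n"
  shows "(P * B * Q) * (P * C * Q) = P * (B * C) * Q"
proof -
  have "(P * B * Q) * (P * C * Q) = P * B * (Q * P) * C * Q"
    using assms P Q by (simp add: assoc_mult_mat[of _ n n _ n _ n])
  also have "\<dots> = P * (B * C) * Q" 
    unfolding QP using assms P Q by (simp add: assoc_mult_mat[of _ n n _ n _ n])
  finally show ?thesis .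
qed

lemma conj_inv:
  assumes "B \<in> carrier_mat n n"
  shows "P * (Q * B * P) * Q = B"
proof -
  have "P * (Q * B * P) * Q = (P * Q) * B * (P * Q)"
    using assms P Q by (simp add: assoc_mult_mat[of _ n n _ n _ n])
  then show ?thesis unfolding PQ using assms by simp
qed

lemma calc_mult: "calc g * calc h = calc (\<lambda>i. g i * h i)"
  unfolding calc_def by (subst conj_mult) (auto simp: diag_matrix_mult)

lemma calc_d: "calc d = A" by (simp add: calc_def A_eq)

lemma calc_commute:
  assumes B: "B \<in> carrier_mat n n" and comm: "A * B = B * A"
    and g: "\<And>i j. i < n \<Longrightarrow> j < n \<Longrightarrow> d i = d j \<Longrightarrow> g i = g j"
  shows "calc g * B = B * calc g"
proof -
  let ?B = "Q * B * P"
  have Bc: "?B \<in> carrier_mat n n" using B P Q by auto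
  have inj: "X = Y" if "P * X * Q = P * Y * Q" "X \<in> carrier_mat n n" "Y \<in> carrier_mat n n" for X Y
  proof -
    have "Q * (P * X * Q) * P = X" if "X \<in> carrier_mat n n" for X
    proof -
      have "Q * (P * X * Q) * P = (Q * P) * X * (Q * P)"
        using that P Q by (simp add: assoc_mult_mat[of _ n n _ n _ n])
      then show ?thesis unfolding QP using that by simp
    qed
    then show ?thesis using that by metis
  qed
  have "P * (diag_matrix n d * ?B) * Q = P * (?B * diag_matrix n d) * Q"
    using comm conj_mult[OF _ Bc, of "diag_matrix n d"] conj_mult[OF Bc, of "diag_matrix n d"] conj_inv[OF B] A_eq
    by simp
  then have "diag_matrix n d * ?B = ?B * diag_matrix n d"
    by (rule inj) (use Bc in \<open>auto intro!: mult_carrier_mat[of _ n n]\<close>)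
  then have "diag_matrix n g * ?B = ?B * diag_matrix n g"
    by (rule diag_matrix_commute_transfer[OF Bc]) (rule g)
  then show ?thesis
    using conj_mult[OF _ Bc, of "diag_matrix n g"] conj_mult[OF Bc, of "diag_matrix n g"] conj_inv[OF B]
    by (simp add: calc_def)
qed

text \<open>
  Because \<open>A\<close> is Hermitian, \<open>P\<^sup>* P\<close> commutes with \<open>diag d\<close>, hence with \<open>diag g\<close>; this is the same as
  \<open>P (diag g) P\<^sup>-\<^sup>1\<close> being Hermitian for real \<open>g\<close>.
\<close>

lemma calc_hermitian:
  assumes real: "\<And>i. i < n \<Longrightarrow> cnj (d i) = d i" "\<And>i. i < n \<Longrightarrow> cnj (g i) = g i"
    and g: "\<And>i j. i < n \<Longrightarrow> j < n \<Longrightarrow> d i = d j \<Longrightarrow> g i = g j"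
  shows "mat_adjoint (calc g) = calc g"
proof -
  define P' Q' where "P' = mat_adjoint P" and "Q' = mat_adjoint Q"
  have c: "P' \<in> carrier_mat n n" "Q' \<in> carrier_mat n n" using P Q by (auto simp: P'_def Q'_def)
  have diag_adj: "mat_adjoint (diag_matrix n h) = diag_matrix n h" if "\<And>i. i < n \<Longrightarrow> cnj (h i) = h i" for h
    using that by (intro eq_matI) (auto simp: diag_matrix_def)
  have adj: "mat_adjoint (calc h) = Q' * diag_matrix n h * P'" if "\<And>i. i < n \<Longrightarrow> cnj (h i) = h i" for h
  proof -
    have "mat_adjoint (calc h) = Q' * (mat_adjoint (diag_matrix n h) * P')"
      using P Q mat_adjoint_mult[of "P * diag_matrix n h" n n Q n] mat_adjoint_mult[OF P diag_matrix_carrier, of h]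
      by (simp add: calc_def P'_def Q'_def mult_carrier_mat[of _ n n])
    also have "\<dots> = Q' * diag_matrix n h * P'"
      using c diag_adj[OF that] by (simp add: assoc_mult_mat[of _ n n _ n _ n])
    finally show ?thesis .
  qed
  have QP': "Q' * P' = 1\<^sub>m n" "P' * Q' = 1\<^sub>m n"
    unfolding P'_def Q'_def mat_adjoint_mult[OF P Q, symmetric] mat_adjoint_mult[OF Q P, symmetric] PQ QP
    by (rule mat_adjoint_one)+
  let ?G = "P' * P"
  have G: "?G \<in> carrier_mat n n" using c P by auto
  have *: "P' * (Q' * diag_matrix n h * P') * P = diag_matrix n h * ?G" for h
  proof -
    have "P' * (Q' * diag_matrix n h * P') * P = (P' * Q') * diag_matrix n h * ?G"
      using c P by (simp add: assoc_mult_mat[of _ n n _ n _ n])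
    then show ?thesis unfolding QP' by (simp add: left_mult_one_mat[of "diag_matrix n h" n n])
  qed
  have **: "P' * calc h * P = ?G * diag_matrix n h" for h
  proof -
    have "P' * calc h * P = ?G * diag_matrix n h * (Q * P)"
      using c P Q by (simp add: calc_def assoc_mult_mat[of _ n n _ n _ n])
    also have "\<dots> = ?G * diag_matrix n h" unfolding QP by (rule right_mult_one_mat[OF mult_carrier_square[OF G diag_matrix_carrier]])
    finally show ?thesis .
  qed
  have "diag_matrix n d * ?G = ?G * diag_matrix n d"
    using *[of d] **[of d] adj[of d] real(1) herm calc_d by simp
  then have comm: "diag_matrix n g * ?G = ?G * diag_matrix n g"
    by (rule diag_matrix_commute_transfer[OF G]) (rule g)
  have "mat_adjoint (calc g) = (Q' * P') * (Q' * diag_matrix n g * P') * (P * Q)"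
    unfolding QP' PQ using adj[of g] real(2) c
    by (simp add: left_mult_one_mat[of _ n n] right_mult_one_mat[of _ n n])
  also have "\<dots> = Q' * (P' * (Q' * diag_matrix n g * P') * P) * Q"
    using c P Q by (simp add: assoc_mult_mat[of _ n n _ n _ n])
  also have "\<dots> = Q' * (P' * calc g * P) * Q" unfolding * ** comm ..
  also have "\<dots> = (Q' * P') * calc g * (P * Q)"
    using c P Q by (simp add: assoc_mult_mat[of _ n n _ n _ n])
  also have "\<dots> = calc g" unfolding QP' PQ
    using calc_carrier[of g] by (simp add: left_mult_one_mat[of _ n n] right_mult_one_mat[of _ n n])
  finally show ?thesis .
qed

lemma eigenvalue_d:
  assumes "i < n"
  obtains v where "v \<in> carrier_vec n" "v \<noteq> 0\<^sub>v n" "A *\<^sub>v v = d i \<cdot>\<^sub>v v"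
proof
  let ?v = "P *\<^sub>v unit_vec n i"
  show "?v \<in> carrier_vec n" using P by auto
  have Qv: "Q *\<^sub>v ?v = unit_vec n i"
    using P Q assoc_mult_mat_vec[OF Q P, of "unit_vec n i"] QP by simp
  show "?v \<noteq> 0\<^sub>v n"
  proof
    assume "?v = 0\<^sub>v n"
    moreover have "Q *\<^sub>v 0\<^sub>v n = 0\<^sub>v n" using Q by (intro eq_vecI) auto
    ultimately have "unit_vec n i = (0\<^sub>v n :: complex Matrix.vec)" using Qv by simp
    then show False using assms by (metis index_unit_vec(1) index_zero_vec(1) zero_neq_one)
  qed
  have D: "diag_matrix n d *\<^sub>v unit_vec n i = d i \<cdot>\<^sub>v unit_vec n i"
    using assms by (intro eq_vecI) (auto simp: diag_matrix_def scalar_prod_def unit_vec_def if_distrib[of "\<lambda>x. _ * x"] cong: if_cong)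
  have "A *\<^sub>v ?v = P *\<^sub>v (diag_matrix n d *\<^sub>v (Q *\<^sub>v ?v))"
    unfolding A_eq using P Q by (simp add: assoc_mult_mat_vec[of _ n n _ n])
  also have "\<dots> = d i \<cdot>\<^sub>v ?v" unfolding Qv D using P by (simp add: mult_mat_vec[of _ n n])
  finally show "A *\<^sub>v ?v = d i \<cdot>\<^sub>v ?v" .
qed

lemma d_real:
  assumes "i < n"
  shows "cnj (d i) = d i"
proof -
  obtain v where v: "v \<in> carrier_vec n" "v \<noteq> 0\<^sub>v n" "A *\<^sub>v v = d i \<cdot>\<^sub>v v"
    using eigenvalue_d[OF assms] .
  have "v \<bullet>c v \<noteq> 0" using conjugate_square_eq_0_vec[OF v(1)] v(2) by auto
  moreover have "d i * (v \<bullet>c v) = cnj (d i) * (v \<bullet>c v)"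
    using inner_prod_adjoint[OF A v(1) v(1)] unfolding herm v(3)
    using v(1) by (simp add: inner_prod_sum sum_distrib_left mult_ac)
  ultimately show ?thesis by simp
qed

lemma d_eq_Re: "i < n \<Longrightarrow> d i = complex_of_real (Re (d i))"
  using d_real by (metis complex_cnj_cancel_iff complex_is_Real_iff of_real_Re Reals_cnj_iff)

text \<open>
  The matrix is the square of the Hermitian matrix with eigenvalues \<open>sqrt (g i)\<close>.
\<close>

lemma calc_pos_semidef:
  assumes "\<And>i. i < n \<Longrightarrow> 0 \<le> g i" "\<And>i j. i < n \<Longrightarrow> j < n \<Longrightarrow> d i = d j \<Longrightarrow> g i = g j"
  shows "pos_semidef (calc (\<lambda>i. complex_of_real (g i)))"
proof -
  let ?h = "\<lambda>i. complex_of_real (sqrt (g i))"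
  have T: "mat_adjoint (calc ?h) = calc ?h"
    by (intro calc_hermitian d_real) (simp_all, (drule (2) assms(2), simp)?)
  have h: "mat_adjoint (calc (\<lambda>i. complex_of_real (g i))) = calc (\<lambda>i. complex_of_real (g i))"
    by (intro calc_hermitian d_real) (simp_all, (drule (2) assms(2), simp)?)
  have "diag_matrix n (\<lambda>i. ?h i * ?h i) = diag_matrix n (\<lambda>i. complex_of_real (g i))"
    using assms(1) by (intro eq_matI) (auto simp: diag_matrix_def simp flip: of_real_mult)
  then have sq: "calc ?h * calc ?h = calc (\<lambda>i. complex_of_real (g i))"
    unfolding calc_mult by (simp add: calc_def)
  have "0 \<le> Re ((calc (\<lambda>i. complex_of_real (g i)) *\<^sub>v v) \<bullet>c v)" if v: "v \<in> carrier_vec n" for v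
  proof -
    have "(calc ?h *\<^sub>v (calc ?h *\<^sub>v v)) \<bullet>c v = (calc ?h *\<^sub>v v) \<bullet>c (calc ?h *\<^sub>v v)"
      using inner_prod_adjoint[OF calc_carrier _ v, of "calc ?h *\<^sub>v v" ?h] unfolding T
      using v calc_carrier by (simp add: mult_mat_vec_carrier[of _ n n])
    then show ?thesis
      using v conjugate_square_ge_0_vec[of "calc ?h *\<^sub>v v"]
      by (simp flip: sq add: assoc_mult_mat_vec[of _ n n _ n] less_eq_complex_def)
  qed
  then show ?thesis
    using carrier_matD[OF calc_carrier[of "\<lambda>i. complex_of_real (g i)"]] h by (auto simp: pos_semidef_def)
qed

end

lemma hermitian_diagonalization_exists:
  assumes "A \<in> carrier_mat n n" "mat_adjoint A = A"
  obtains P Q d where "hermitian_diagonalization n A P Q d"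
  using hermitian_diagonalizable[OF assms] assms unfolding hermitian_diagonalization_def by metis

lemma pos_semidef_carrier:
  "pos_semidef A \<Longrightarrow> A \<in> carrier_mat (dim_row A) (dim_row A)"
  by (auto simp: pos_semidef_def intro!: carrier_matI)

lemma (in hermitian_diagonalization) pos_semidef_d:
  assumes "pos_semidef A" "i < n"
  shows "0 \<le> Re (d i)"
proof -
  obtain v where v: "v \<in> carrier_vec n" "v \<noteq> 0\<^sub>v n" "A *\<^sub>v v = d i \<cdot>\<^sub>v v"
    using eigenvalue_d[OF assms(2)] .
  have pos: "0 < v \<bullet>c v" using conjugate_square_greater_0_vec[OF v(1)] v(2) by auto
  have "0 \<le> Re ((A *\<^sub>v v) \<bullet>c v)" using assms v(1) A by (auto simp: pos_semidef_def)
  also have "(A *\<^sub>v v) \<bullet>c v = d i * (v \<bullet>c v)" using v by simp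
  finally show ?thesis using pos by (simp add: less_complex_def zero_le_mult_iff)
qed

text \<open>
  That the root commutes with whatever commutes with \<open>A\<close> is what makes it unique among all positive semidefinite
  roots.
\<close>

lemma pos_semidef_root:
  assumes A: "A \<in> carrier_mat n n" and psd: "pos_semidef A"
  obtains S where "S \<in> carrier_mat n n" "pos_semidef S" "S * S = A"
    "\<And>B. B \<in> carrier_mat n n \<Longrightarrow> A * B = B * A \<Longrightarrow> S * B = B * S"
proof -
  have "mat_adjoint A = A" using psd by (simp add: pos_semidef_def)
  then obtain P Q d where D: "hermitian_diagonalization n A P Q d"
    using hermitian_diagonalization_exists[OF A] by blast
  interpret hermitian_diagonalization n A P Q d by (rule D)
  let ?g = "\<lambda>i. sqrt (Re (d i))"
  let ?S = "calc (\<lambda>i. complex_of_real (?g i))"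
  have "diag_matrix n (\<lambda>i. complex_of_real (?g i) * complex_of_real (?g i)) = diag_matrix n d"
    using pos_semidef_d[OF psd] d_eq_Re by (intro eq_matI) (auto simp: diag_matrix_def simp flip: of_real_mult)
  then have "?S * ?S = A"
    unfolding calc_mult calc_d[symmetric] by (simp add: calc_def)
  moreover have "pos_semidef ?S"
    by (rule calc_pos_semidef) (use pos_semidef_d[OF psd] in auto)
  moreover have "?S * B = B * ?S" if "B \<in> carrier_mat n n" "A * B = B * A" for B
    by (rule calc_commute[OF that]) auto
  ultimately show thesis using that[of ?S] by auto
qed

lemma pos_semidef_kernel:
  assumes A: "A \<in> carrier_mat n n" and psd: "pos_semidef A" and v: "v \<in> carrier_vec n"
    and 0: "Re ((A *\<^sub>v v) \<bullet>c v) = 0"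
  shows "A *\<^sub>v v = 0\<^sub>v n"
proof -
  obtain S where S: "S \<in> carrier_mat n n" "pos_semidef S" "S * S = A"
    using pos_semidef_root[OF A psd] by metis
  have Sv: "S *\<^sub>v v \<in> carrier_vec n" using S v by auto
  have "(A *\<^sub>v v) \<bullet>c v = (S *\<^sub>v v) \<bullet>c (S *\<^sub>v v)"
    using inner_prod_adjoint[OF S(1) Sv v] S v
    by (simp add: pos_semidef_def assoc_mult_mat_vec[of _ n n _ n] flip: S(3))
  then have "(S *\<^sub>v v) \<bullet>c (S *\<^sub>v v) = 0"
    using 0 conjugate_square_ge_0_vec[of "S *\<^sub>v v"] by (simp add: complex_eq_iff less_eq_complex_def)
  then have "S *\<^sub>v v = 0\<^sub>v n" using conjugate_square_eq_0_vec[OF Sv] by simp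
  then show ?thesis
    using S v by (simp add: assoc_mult_mat_vec[of _ n n _ n] flip: S(3)) (intro eq_vecI, auto)
qed

lemma inner_prod_add:
  fixes v w :: "complex Matrix.vec"
  assumes "v \<in> carrier_vec n" "w \<in> carrier_vec n" "u \<in> carrier_vec n"
  shows "(v + w) \<bullet>c u = v \<bullet>c u + w \<bullet>c u" "(v - w) \<bullet>c u = v \<bullet>c u - w \<bullet>c u"
    "u \<bullet>c (v - w) = u \<bullet>c v - u \<bullet>c w"
  using assms by (simp_all add: inner_prod_sum[where n=n] algebra_simps sum.distrib sum_subtractf)

lemma mat_eqI_mult_vec:
  fixes A B :: "complex mat"
  assumes A: "A \<in> carrier_mat n k" and B: "B \<in> carrier_mat n k"
    and eq: "\<And>v. v \<in> carrier_vec k \<Longrightarrow> A *\<^sub>v v = B *\<^sub>v v"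
  shows "A = B"
proof (rule eq_matI)
  fix i j assume "i < dim_row B" "j < dim_col B"
  then have ij: "i < n" "j < k" using B by auto
  have "vec_index (A *\<^sub>v unit_vec k j) i = vec_index (B *\<^sub>v unit_vec k j) i" using eq by simp
  then show "A $$ (i, j) = B $$ (i, j)" using A B ij by simp
qed (use A B in auto)

text \<open>
  For \<open>v = (S - T) y\<close> one has \<open>(S + T) v = (S\<^sup>2 - T\<^sup>2) y = 0\<close>, so the two nonnegative numbers \<open>\<langle>S v, v\<rangle>\<close> and
  \<open>\<langle>T v, v\<rangle>\<close> add up to zero. Hence \<open>S v = T v = 0\<close>, and \<open>\<langle>v, v\<rangle> = \<langle>y, (S - T) v\<rangle> = 0\<close>.
\<close>

lemma pos_semidef_root_unique:
  assumes S: "S \<in> carrier_mat n n" "pos_semidef S" and T: "T \<in> carrier_mat n n" "pos_semidef T"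
    and eq: "S * S = T * T" and comm: "S * T = T * S"
  shows "S = T"
proof (rule mat_eqI_mult_vec[OF S(1) T(1)])
  fix y :: "complex Matrix.vec" assume y: "y \<in> carrier_vec n"
  note [simp] = mult_mat_vec_carrier[OF S(1)] mult_mat_vec_carrier[OF T(1)] y
  define v where "v = S *\<^sub>v y - T *\<^sub>v y"
  have v [simp]: "v \<in> carrier_vec n" unfolding v_def by simp
  have SS: "S *\<^sub>v (S *\<^sub>v y) = T *\<^sub>v (T *\<^sub>v y)" and ST: "S *\<^sub>v (T *\<^sub>v y) = T *\<^sub>v (S *\<^sub>v y)"
    using eq comm S T y by (metis assoc_mult_mat_vec)+
  have Sv: "S *\<^sub>v v = S *\<^sub>v (S *\<^sub>v y) - S *\<^sub>v (T *\<^sub>v y)" 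
    unfolding v_def using S(1) by (simp add: mult_minus_distrib_mat_vec[of _ n n])
  have Tv: "T *\<^sub>v v = T *\<^sub>v (S *\<^sub>v y) - T *\<^sub>v (T *\<^sub>v y)" 
    unfolding v_def using T(1) by (simp add: mult_minus_distrib_mat_vec[of _ n n])
  have neg: "T *\<^sub>v v = - (S *\<^sub>v v)" unfolding Sv Tv SS ST by (intro eq_vecI) (use S T y in auto)
  have "Re ((T *\<^sub>v v) \<bullet>c v) = - Re ((S *\<^sub>v v) \<bullet>c v)"
    unfolding neg using S by (simp add: inner_prod_sum[where n=n] sum_negf)
  moreover have "0 \<le> Re ((T *\<^sub>v v) \<bullet>c v)" "0 \<le> Re ((S *\<^sub>v v) \<bullet>c v)"
    using S T v by (auto simp: pos_semidef_def)
  ultimately have "Re ((S *\<^sub>v v) \<bullet>c v) = 0" "Re ((T *\<^sub>v v) \<bullet>c v) = 0" by auto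
  then have Sv0: "S *\<^sub>v v = 0\<^sub>v n" and Tv0: "T *\<^sub>v v = 0\<^sub>v n"
    using pos_semidef_kernel S T v by blast+
  have "v \<bullet>c v = (S *\<^sub>v y) \<bullet>c v - (T *\<^sub>v y) \<bullet>c v"
    by (subst (1) v_def) (simp add: inner_prod_add[where n=n])
  also have "\<dots> = y \<bullet>c (S *\<^sub>v v) - y \<bullet>c (T *\<^sub>v v)"
    using inner_prod_adjoint[OF S(1) y v] inner_prod_adjoint[OF T(1) y v] S(2) T(2)
    by (simp add: pos_semidef_def)
  also have "\<dots> = 0" unfolding Sv0 Tv0 by simp
  finally have "v = 0\<^sub>v n" using conjugate_square_eq_0_vec[OF v] by simp
  then have "vec_index (S *\<^sub>v y) i = vec_index (T *\<^sub>v y) i" if "i < n" for i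
    using that S T unfolding v_def by (metis (no_types) carrier_vecD index_minus_vec(1) index_zero_vec(1) eq_iff_diff_eq_0 mult_mat_vec_carrier[OF T(1) y])
  then show "S *\<^sub>v y = T *\<^sub>v y" using S T by (intro eq_vecI) auto
qed

lemma mat_sqrt:
  assumes A: "A \<in> carrier_mat n n" and psd: "pos_semidef A"
  shows "mat_sqrt A \<in> carrier_mat n n" "pos_semidef (mat_sqrt A)" "mat_sqrt A * mat_sqrt A = A"
proof -
  obtain S where S: "S \<in> carrier_mat n n" "pos_semidef S" "S * S = A"
    and comm: "\<And>B. B \<in> carrier_mat n n \<Longrightarrow> A * B = B * A \<Longrightarrow> S * B = B * S"
    using pos_semidef_root[OF A psd] by metis
  have "T = S" if T: "pos_semidef T" "T * T = A" for T
  proof -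
    have Tc: "T \<in> carrier_mat n n"
      using pos_semidef_carrier[OF T(1)] T(2) A by (metis carrier_matD(1) index_mult_mat(2))
    have "A * T = T * A" unfolding T(2)[symmetric] by (rule assoc_mult_mat[OF Tc Tc Tc])
    then have "S * T = T * S" using comm Tc by blast
    then show ?thesis using pos_semidef_root_unique[OF S(1,2) Tc T(1)] S(3) T(2) by simp
  qed
  then have e: "mat_sqrt A = S" unfolding mat_sqrt_def using S by (intro the_equality) blast+
  show "mat_sqrt A \<in> carrier_mat n n" "pos_semidef (mat_sqrt A)" "mat_sqrt A * mat_sqrt A = A"
    unfolding e by (rule S)+
qed

lemma mat_inv_sqrt:
  assumes A: "A \<in> carrier_mat n n" and psd: "pos_semidef A" and inv: "invertible_mat A"
  shows "mat_inv_sqrt A \<in> carrier_mat n n" "mat_inv_sqrt A * mat_sqrt A = 1\<^sub>m n"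
    "mat_sqrt A * mat_inv_sqrt A = 1\<^sub>m n" "mat_adjoint (mat_inv_sqrt A) = mat_inv_sqrt A"
proof -
  define S where "S = mat_sqrt A"
  note S = mat_sqrt[OF A psd, folded S_def]
  obtain B where AB: "A * B = 1\<^sub>m n" and BA: "B * A = 1\<^sub>m (dim_row B)"
    using inv A unfolding invertible_mat_def inverts_mat_def by auto
  have B: "B \<in> carrier_mat n n"
    using AB BA A by (metis carrier_matD(2) carrier_matI index_mult_mat(3) index_one_mat(3))
  have BA': "B * A = 1\<^sub>m n" using BA B by simp
  have r: "S * (S * B) = 1\<^sub>m n" using assoc_mult_mat[OF S(1) S(1) B] S(3) AB by simp
  have l: "(B * S) * S = 1\<^sub>m n" using assoc_mult_mat[OF B S(1) S(1)] S(3) BA' by simp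
  have lr: "B * S = S * B"
  proof -
    have "B * S = (B * S) * (S * (S * B))" unfolding r using B S by simp
    also have "\<dots> = ((B * S) * S) * (S * B)" using B S(1) by (simp add: assoc_mult_mat[of _ n n _ n _ n])
    finally show ?thesis unfolding l using B S by simp
  qed
  have "mat_inverse S \<noteq> None"
  proof
    assume "mat_inverse S = None"
    then have "S \<notin> Units (ring_mat TYPE(complex) n ())" using mat_inverse(1)[OF S(1), where b="()"] by blast
    moreover have "S \<in> Units (ring_mat TYPE(complex) n ())"
      using S(1) B r l lr by (auto simp: Units_def ring_mat_def intro!: bexI[of _ "S * B"])
    ultimately show False by blast
  qed
  then obtain R where R: "mat_inverse S = Some R" by blast
  have Rp: "S * R = 1\<^sub>m n" "R * S = 1\<^sub>m n" "R \<in> carrier_mat n n"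
    using mat_inverse(2)[OF S(1) R] by auto
  have e: "mat_inv_sqrt A = R" unfolding mat_inv_sqrt_def using R S_def by simp
  have Sh: "mat_adjoint S = S" using S(2) by (simp add: pos_semidef_def)
  have "mat_adjoint R = mat_adjoint R * (S * R)" unfolding Rp(1) using Rp(3) by simp
  also have "\<dots> = mat_adjoint (S * R) * R"
    using Rp(3) S(1) by (simp add: mat_adjoint_mult[of _ n n _ n] Sh assoc_mult_mat[of _ n n _ n _ n])
  also have "\<dots> = R" unfolding Rp(1) using Rp(3) by simp
  finally have "mat_adjoint R = R" .
  then show "mat_inv_sqrt A \<in> carrier_mat n n" "mat_inv_sqrt A * mat_sqrt A = 1\<^sub>m n"
    "mat_sqrt A * mat_inv_sqrt A = 1\<^sub>m n" "mat_adjoint (mat_inv_sqrt A) = mat_inv_sqrt A"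
    using Rp e S_def by auto
qed

section \<open>The smallest eigenvalue and the operator norm\<close>

lemma finite_eigenvalues:
  fixes A :: "complex mat"
  assumes A: "A \<in> carrier_mat n n"
  shows "finite {a. eigenvalue A a}"
proof -
  have "char_poly A \<noteq> 0" using degree_monic_char_poly[OF A] by auto
  then have "finite {a. poly (char_poly A) a = 0}" by (rule poly_roots_finite)
  then show ?thesis using eigenvalue_root_char_poly[OF A] by simp
qed

text \<open>
  The second part is the Rayleigh bound: \<open>A - L\<close>, with \<open>L\<close> the smallest eigenvalue, is positive semidefinite
  because its eigenvalues \<open>d i - L\<close> are nonnegative.
\<close>

lemma min_eigenvalue:
  assumes A: "A \<in> carrier_mat n n" and psd: "pos_semidef A" and inv: "invertible_mat A" and n: "0 < n"
  shows "0 < min_eigenvalue A"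
    and "v \<in> carrier_vec n \<Longrightarrow> min_eigenvalue A * Re (v \<bullet>c v) \<le> Re ((A *\<^sub>v v) \<bullet>c v)"
proof -
  have "mat_adjoint A = A" using psd by (simp add: pos_semidef_def)
  then obtain P Q d where D: "hermitian_diagonalization n A P Q d"
    using hermitian_diagonalization_exists[OF A] by blast
  interpret hermitian_diagonalization n A P Q d by (rule D)
  let ?E = "{x. eigenvalue A (complex_of_real x)}"
  have fin: "finite ?E"
    using finite_vimageI[OF finite_eigenvalues[OF A], of complex_of_real]
    by (simp add: vimage_def inj_of_real)
  have Re_d: "Re (d i) \<in> ?E" if i: "i < n" for i
  proof -
    obtain v where "v \<in> carrier_vec n" "v \<noteq> 0\<^sub>v n" "A *\<^sub>v v = d i \<cdot>\<^sub>v v" using eigenvalue_d[OF i] .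
    then show ?thesis using A d_eq_Re[OF i] by (auto simp: eigenvalue_def eigenvector_def)
  qed
  then have ne: "?E \<noteq> {}" using n by blast
  define L where "L = min_eigenvalue A"
  have L_in: "L \<in> ?E" unfolding L_def min_eigenvalue_def using fin ne by (rule Min_in)
  have L_le: "L \<le> Re (d i)" if "i < n" for i
    unfolding L_def min_eigenvalue_def using fin Re_d[OF that] by (rule Min_le)
  show "0 < min_eigenvalue A"
  proof -
    obtain v where v: "v \<in> carrier_vec n" "v \<noteq> 0\<^sub>v n" "A *\<^sub>v v = complex_of_real L \<cdot>\<^sub>v v"
      using L_in A by (auto simp: eigenvalue_def eigenvector_def)
    have pos: "0 < v \<bullet>c v" using conjugate_square_greater_0_vec[OF v(1)] v(2) by auto
    have "0 \<le> Re ((A *\<^sub>v v) \<bullet>c v)" using psd v(1) A by (auto simp: pos_semidef_def)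
    then have "0 \<le> L" using v pos by (simp add: less_complex_def zero_le_mult_iff)
    moreover have "L \<noteq> 0"
    proof
      assume L0: "L = 0"
      obtain B where BA: "B * A = 1\<^sub>m (dim_row B)" and AB: "A * B = 1\<^sub>m n"
        using inv A unfolding invertible_mat_def inverts_mat_def by auto
      then have B: "B \<in> carrier_mat n n"
        using A by (metis carrier_matD(2) carrier_matI index_mult_mat(3) index_one_mat(3))
      have "v = B *\<^sub>v (A *\<^sub>v v)" using assoc_mult_mat_vec[OF B A v(1)] BA B v(1) by simp
      also have "\<dots> = 0\<^sub>v n" unfolding v(3) L0 using B v(1) by (intro eq_vecI) auto
      finally show False using v(2) by simp
    qed
    ultimately show ?thesis unfolding L_def by simp
  qed
  assume v: "v \<in> carrier_vec n"
  let ?C = "calc (\<lambda>i. complex_of_real (Re (d i) - L))"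
  have C: "?C = A - complex_of_real L \<cdot>\<^sub>m 1\<^sub>m n"
  proof -
    have "diag_matrix n (\<lambda>i. complex_of_real (Re (d i) - L)) = diag_matrix n d - complex_of_real L \<cdot>\<^sub>m 1\<^sub>m n"
      using d_eq_Re by (intro eq_matI) (auto simp: diag_matrix_def)
    then have "?C = P * diag_matrix n d * Q - P * (complex_of_real L \<cdot>\<^sub>m 1\<^sub>m n) * Q"
      using mult_minus_distrib_mat[OF P diag_matrix_carrier, of "complex_of_real L \<cdot>\<^sub>m 1\<^sub>m n" d]
        minus_mult_distrib_mat[of "P * diag_matrix n d" n n "P * (complex_of_real L \<cdot>\<^sub>m 1\<^sub>m n)" Q n] P Q
      by (simp add: calc_def)
    also have "P * (complex_of_real L \<cdot>\<^sub>m 1\<^sub>m n) * Q = complex_of_real L \<cdot>\<^sub>m (P * Q)"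
      using mult_smult_distrib[OF P one_carrier_mat] mult_smult_assoc_mat[OF P Q] right_mult_one_mat[OF P] by simp
    finally show ?thesis unfolding PQ A_eq[symmetric] .
  qed
  have "pos_semidef ?C" by (rule calc_pos_semidef) (use L_le in auto)
  then have "0 \<le> Re ((?C *\<^sub>v v) \<bullet>c v)"
    using v carrier_matD(1)[OF calc_carrier] by (simp add: pos_semidef_def)
  also have "?C *\<^sub>v v = A *\<^sub>v v - complex_of_real L \<cdot>\<^sub>v v"
  proof -
    have "(complex_of_real L \<cdot>\<^sub>m 1\<^sub>m n) *\<^sub>v v = complex_of_real L \<cdot>\<^sub>v v"
      using v by (intro eq_vecI) (auto simp: scalar_prod_def if_distrib[of "\<lambda>x. x * _"] if_distrib[of "\<lambda>x. _ * x"] cong: if_cong)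
    then show ?thesis unfolding C using minus_mult_distrib_mat_vec[OF A _ v, of "complex_of_real L \<cdot>\<^sub>m 1\<^sub>m n"] by simp
  qed
  also have "(A *\<^sub>v v - complex_of_real L \<cdot>\<^sub>v v) \<bullet>c v = (A *\<^sub>v v) \<bullet>c v - L * (v \<bullet>c v)"
    using A v by (subst inner_prod_add[where n=n]) auto
  finally show "min_eigenvalue A * Re (v \<bullet>c v) \<le> Re ((A *\<^sub>v v) \<bullet>c v)" unfolding L_def by simp
qed

lemma vec_l2norm_sq:
  assumes "v \<in> carrier_vec n"
  shows "(vec_l2norm v)\<^sup>2 = Re (v \<bullet>c v)"
  using assms
  by (simp add: vec_l2norm_def L2_set_def sum_nonneg inner_prod_sum[of _ n] complex_mult_cnj cmod_power2)

lemma vec_l2norm_smult: "vec_l2norm (c \<cdot>\<^sub>v v) = cmod c * vec_l2norm v"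
  by (auto simp: vec_l2norm_def norm_mult L2_set_right_distrib intro!: L2_set_cong)

text \<open>
  The supremum that defines the operator norm is one of reals, so it has to be shown to be over a bounded set; the sum
  of the absolute values of all entries is a bound.
\<close>

lemma mat_op_norm_bound:
  assumes M: "M \<in> carrier_mat n k" and w: "w \<in> carrier_vec k"
  shows "vec_l2norm (M *\<^sub>v w) \<le> mat_op_norm M * vec_l2norm w"
proof -
  have nn: "0 \<le> vec_l2norm v" for v by (simp add: vec_l2norm_def)
  let ?S = "{v \<in> carrier_vec (dim_col M). vec_l2norm v \<le> 1}"
  have bdd: "bdd_above ((\<lambda>v. vec_l2norm (M *\<^sub>v v)) ` ?S)"
  proof (rule bdd_aboveI2)
    fix v assume "v \<in> ?S"
    then have v: "v \<in> carrier_vec k" "vec_l2norm v \<le> 1" using M by auto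
    have vj: "cmod (vec_index v j) \<le> 1" if "j < k" for j
    proof -
      have "cmod (vec_index v j) \<le> vec_l2norm v"
        unfolding vec_l2norm_def using that v(1) by (intro member_le_L2_set) auto
      then show ?thesis using v(2) by simp
    qed
    have "vec_l2norm (M *\<^sub>v v) \<le> (\<Sum>i<n. cmod (vec_index (M *\<^sub>v v) i))"
      using M L2_set_le_sum[of "{..<n}" "\<lambda>i. cmod (vec_index (M *\<^sub>v v) i)"] by (simp add: vec_l2norm_def)
    also have "\<dots> \<le> (\<Sum>i<n. \<Sum>j<k. cmod (M $$ (i, j)))"
    proof (rule sum_mono)
      fix i assume "i \<in> {..<n}"
      then have "vec_index (M *\<^sub>v v) i = (\<Sum>j<k. M $$ (i, j) * vec_index v j)"
        using M v(1) by (simp add: scalar_prod_def atLeast0LessThan)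
      also have "cmod \<dots> \<le> (\<Sum>j<k. cmod (M $$ (i, j)))"
        using vj by (intro sum_norm_le) (simp add: norm_mult mult_left_le)
      finally show "cmod (vec_index (M *\<^sub>v v) i) \<le> (\<Sum>j<k. cmod (M $$ (i, j)))" .
    qed
    finally show "vec_l2norm (M *\<^sub>v v) \<le> (\<Sum>i<n. \<Sum>j<k. cmod (M $$ (i, j)))" .
  qed
  show ?thesis
  proof (cases "vec_l2norm w = 0")
    case True
    then have "(vec_l2norm w)\<^sup>2 = 0" by simp
    then have "w \<bullet>c w = 0"
      using vec_l2norm_sq[OF w] conjugate_square_ge_0_vec[of w] by (simp add: complex_eq_iff less_eq_complex_def)
    then have "w = 0\<^sub>v k" using conjugate_square_eq_0_vec[OF w] by simp
    then have "M *\<^sub>v w = 0\<^sub>v n" using M by (intro eq_vecI) auto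
    then show ?thesis using True by (simp add: vec_l2norm_def L2_set_def)
  next
    case False
    then have pos: "0 < vec_l2norm w" using nn[of w] by simp
    let ?u = "complex_of_real (1 / vec_l2norm w) \<cdot>\<^sub>v w"
    have "?u \<in> ?S" using M w pos by (auto simp: vec_l2norm_smult norm_divide)
    then have "vec_l2norm (M *\<^sub>v ?u) \<le> mat_op_norm M"
      unfolding mat_op_norm_def using bdd by (rule cSUP_upper)
    moreover have "M *\<^sub>v ?u = complex_of_real (1 / vec_l2norm w) \<cdot>\<^sub>v (M *\<^sub>v w)"
      using M w by (rule mult_mat_vec)
    ultimately show ?thesis using pos by (simp add: vec_l2norm_smult norm_divide field_simps)
  qed
qed

lemma inner_prod_Cauchy_Schwarz:
  assumes "v \<in> carrier_vec n" "w \<in> carrier_vec n"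
  shows "cmod (v \<bullet>c w) \<le> vec_l2norm v * vec_l2norm w"
proof -
  have "cmod (v \<bullet>c w) \<le> (\<Sum>i<n. \<bar>cmod (vec_index v i)\<bar> * \<bar>cmod (vec_index w i)\<bar>)"
    using assms by (simp add: inner_prod_sum[of _ n] sum_norm_le norm_mult)
  also have "\<dots> \<le> L2_set (\<lambda>i. cmod (vec_index v i)) {..<n} * L2_set (\<lambda>i. cmod (vec_index w i)) {..<n}"
    by (rule L2_set_mult_ineq)
  finally show ?thesis using assms by (simp add: vec_l2norm_def)
qed

text \<open>
  Substitute \<open>v = A\<^sup>1\<^sup>/\<^sup>2 a\<close> in \<open>\<langle>(1 - A\<^sup>-\<^sup>1\<^sup>/\<^sup>2 H A\<^sup>-\<^sup>1\<^sup>/\<^sup>2) v, v\<rangle> \<le> (1 - \<gamma>) \<langle>v, v\<rangle>\<close>: the left side is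
  \<open>\<langle>A a, a\<rangle> - \<langle>H a, a\<rangle>\<close> and \<open>\<langle>v, v\<rangle> = \<langle>A a, a\<rangle>\<close>.
\<close>

lemma form_lower_bound_of_op_norm:
  assumes A: "A \<in> carrier_mat n n" and psd: "pos_semidef A" and inv: "invertible_mat A"
    and H: "H \<in> carrier_mat n n"
    and op: "mat_op_norm (1\<^sub>m n - mat_inv_sqrt A * H * mat_inv_sqrt A) \<le> 1 - \<gamma>"
    and a: "a \<in> carrier_vec n"
  shows "\<gamma> * Re ((A *\<^sub>v a) \<bullet>c a) \<le> Re ((H *\<^sub>v a) \<bullet>c a)"
proof -
  define S R where "S = mat_sqrt A" and "R = mat_inv_sqrt A"
  note S = mat_sqrt[OF A psd, folded S_def]
  note R = mat_inv_sqrt[OF A psd inv, folded S_def R_def]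
  have Sh: "mat_adjoint S = S" using S(2) by (simp add: pos_semidef_def)
  define v where "v = S *\<^sub>v a"
  let ?M = "1\<^sub>m n - R * H * R"
  have v: "v \<in> carrier_vec n" using S a by (simp add: v_def)
  have M: "?M \<in> carrier_mat n n" using R H by auto
  have Rv: "R *\<^sub>v v = a" unfolding v_def using R S a by (simp add: assoc_mult_mat_vec[of _ n n _ n, symmetric])
  have vv: "v \<bullet>c v = (A *\<^sub>v a) \<bullet>c a"
    using inner_prod_adjoint[OF S(1) v a] Sh S a
    by (simp add: v_def assoc_mult_mat_vec[of _ n n _ n] flip: S(3))
  have "(R * H * R *\<^sub>v v) = R *\<^sub>v (H *\<^sub>v a)"
    using R H v by (simp add: Rv assoc_mult_mat_vec[of _ n n _ n])
  then have Mv: "?M *\<^sub>v v = v - R *\<^sub>v (H *\<^sub>v a)"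
    using R H v by (subst minus_mult_distrib_mat_vec[of _ n n]) auto
  have Ha: "H *\<^sub>v a \<in> carrier_vec n" using H a by simp
  have Mvv: "(?M *\<^sub>v v) \<bullet>c v = v \<bullet>c v - (H *\<^sub>v a) \<bullet>c a"
    unfolding Mv using inner_prod_adjoint[OF R(1) Ha v] R v Ha a Rv
    by (simp add: inner_prod_add[where n=n])
  have "Re ((?M *\<^sub>v v) \<bullet>c v) \<le> (1 - \<gamma>) * Re (v \<bullet>c v)"
  proof -
    have "Re ((?M *\<^sub>v v) \<bullet>c v) \<le> cmod ((?M *\<^sub>v v) \<bullet>c v)" by (rule complex_Re_le_cmod)
    also have "\<dots> \<le> vec_l2norm (?M *\<^sub>v v) * vec_l2norm v"
      by (rule inner_prod_Cauchy_Schwarz[OF mult_mat_vec_carrier[OF M v] v])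
    also have "\<dots> \<le> (mat_op_norm ?M * vec_l2norm v) * vec_l2norm v"
      by (intro mult_right_mono mat_op_norm_bound[OF M v]) (simp add: vec_l2norm_def)
    also have "\<dots> = mat_op_norm ?M * (vec_l2norm v)\<^sup>2" by (simp add: power2_eq_square)
    also have "\<dots> \<le> (1 - \<gamma>) * (vec_l2norm v)\<^sup>2"
      using op by (intro mult_right_mono) (auto simp: R_def)
    finally show ?thesis using vec_l2norm_sq[OF v] by simp
  qed
  then show ?thesis unfolding Mvv minus_complex.sel vv left_diff_distrib by linarith
qed

section \<open>Pseudo-inverses and normal equations\<close>

text \<open>
  Of the four Penrose equations only the Hermitian condition on \<open>X A\<close> is not implied by \<open>A X = 1\<close>.
  Two solutions have the same orthogonal projection \<open>X A\<close>, hence agree.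
\<close>

lemma pseudo_inverse_right_inverse:
  assumes A: "A \<in> carrier_mat k n" and X: "X \<in> carrier_mat n k"
    and AX: "A * X = 1\<^sub>m k" and h: "mat_adjoint (X * A) = X * A"
  shows "pseudo_inverse A = X"
proof -
  have pX: "is_pseudo_inverse A X"
    using A X h by (auto simp: is_pseudo_inverse_def AX assoc_mult_mat[of X n k A n X k])
  have "Y = X" if Y: "is_pseudo_inverse A Y" for Y
  proof -
    have Yc: "Y \<in> carrier_mat n k" and Y1: "A * Y * A = A" and Y2: "Y * A * Y = Y"
      and Y4: "mat_adjoint (Y * A) = Y * A" using Y A by (auto simp: is_pseudo_inverse_def)
    note c = mult_carrier_mat[OF A Yc] mult_carrier_mat[OF Yc A] mult_carrier_mat[OF X A]
    have "A * Y = A * Y * (A * X)" unfolding AX using right_mult_one_mat[OF c(1)] by (rule sym)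
    also have "\<dots> = A * Y * A * X" using assoc_mult_mat[OF c(1) A X] by simp
    finally have AY: "A * Y = 1\<^sub>m k" unfolding Y1 AX .
    have YX: "(Y * A) * (X * A) = Y * A"
    proof -
      have "(Y * A) * (X * A) = Y * (A * (X * A))" by (rule assoc_mult_mat[OF Yc A c(3)])
      also have "A * (X * A) = (A * X) * A" using assoc_mult_mat[OF A X A] by simp
      finally show ?thesis unfolding AX using A by simp
    qed
    have XY: "(X * A) * (Y * A) = X * A"
    proof -
      have "(X * A) * (Y * A) = X * (A * (Y * A))" by (rule assoc_mult_mat[OF X A c(2)])
      also have "A * (Y * A) = (A * Y) * A" using assoc_mult_mat[OF A Yc A] by simp
      finally show ?thesis unfolding AY using A by simp
    qed
    have "Y * A = mat_adjoint ((Y * A) * (X * A))" unfolding YX Y4 ..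
    also have "\<dots> = (X * A) * (Y * A)" unfolding mat_adjoint_mult[OF c(2,3)] h Y4 ..
    finally have "Y * A = X * A" unfolding XY .
    then have "Y = X * A * Y" using Y2 by simp
    also have "\<dots> = X * (A * Y)" by (rule assoc_mult_mat[OF X A Yc])
    finally show ?thesis unfolding AY using X by simp
  qed
  then show ?thesis unfolding pseudo_inverse_def using pX by (intro the_equality) blast+
qed

lemma injective_imp_inverse:
  fixes M :: "complex mat"
  assumes M: "M \<in> carrier_mat n n" and inj: "\<And>v. v \<in> carrier_vec n \<Longrightarrow> M *\<^sub>v v = 0\<^sub>v n \<Longrightarrow> v = 0\<^sub>v n"
  obtains B where "B \<in> carrier_mat n n" "M * B = 1\<^sub>m n" "B * M = 1\<^sub>m n"
proof -
  have "det M \<noteq> 0" using det_0_iff_vec_prod_zero[OF M] inj by blast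
  then have "M \<in> Units (ring_mat TYPE(complex) n ())" using det_non_zero_imp_unit[OF M, where b="()"] by blast
  then show thesis using that by (auto simp: Units_def ring_mat_def)
qed

text \<open>
  For injective \<open>U\<close> the pseudo-inverse of \<open>U\<^sup>*\<close> is \<open>U (U\<^sup>* U)\<^sup>-\<^sup>1\<close>, so \<open>L\<close> maps data to the coefficients of their
  least squares fit by the columns of \<open>U\<close>.
\<close>

lemma least_squares_normal_equations:
  fixes U :: "complex mat"
  assumes U: "U \<in> carrier_mat N n"
    and inj: "\<And>v. v \<in> carrier_vec n \<Longrightarrow> U *\<^sub>v v = 0\<^sub>v N \<Longrightarrow> v = 0\<^sub>v n"
  defines "L \<equiv> mat_adjoint (pseudo_inverse (mat_adjoint U))"
  shows "L \<in> carrier_mat n N" "mat_adjoint U * U * L = mat_adjoint U"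
proof -
  let ?V = "mat_adjoint U" and ?M = "mat_adjoint U * U"
  have V: "?V \<in> carrier_mat n N" using U by simp
  have M: "?M \<in> carrier_mat n n" using mult_carrier_mat[OF V U] .
  have "v = 0\<^sub>v n" if v: "v \<in> carrier_vec n" and z: "?M *\<^sub>v v = 0\<^sub>v n" for v
  proof -
    have Uv: "U *\<^sub>v v \<in> carrier_vec N" using U v by simp
    have "(U *\<^sub>v v) \<bullet>c (U *\<^sub>v v) = v \<bullet>c (?M *\<^sub>v v)"
      using inner_prod_adjoint[OF U v Uv] assoc_mult_mat_vec[OF V U v] by simp
    also have "\<dots> = 0" unfolding z using v by simp
    finally show ?thesis using inj[OF v] conjugate_square_eq_0_vec[OF Uv] by simp
  qed
  then obtain B where B: "B \<in> carrier_mat n n" "?M * B = 1\<^sub>m n" "B * ?M = 1\<^sub>m n"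
    using injective_imp_inverse[OF M] by blast
  have Mh: "mat_adjoint ?M = ?M" using mat_adjoint_mult[OF V U] by simp
  have Bh: "mat_adjoint B = B"
  proof -
    have "mat_adjoint B = mat_adjoint B * (?M * B)" unfolding B(2) using B(1) by simp
    also have "\<dots> = mat_adjoint (?M * B) * B"
      using assoc_mult_mat[of "mat_adjoint B" n n ?M n B n] B(1) M by (simp add: mat_adjoint_mult[OF M B(1)] Mh)
    also have "\<dots> = B" unfolding B(2) using B(1) by simp
    finally show ?thesis .
  qed
  have X: "U * B \<in> carrier_mat N n" using mult_carrier_mat[OF U B(1)] .
  have LB: "mat_adjoint (U * B) = B * ?V" using mat_adjoint_mult[OF U B(1)] Bh by simp
  have "pseudo_inverse ?V = U * B"
  proof (rule pseudo_inverse_right_inverse[OF V X])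
    show "?V * (U * B) = 1\<^sub>m n" using assoc_mult_mat[OF V U B(1)] B(2) by simp
    have "mat_adjoint (U * B * ?V) = mat_adjoint ?V * (B * ?V)" 
      unfolding mat_adjoint_mult[OF X V] LB ..
    also have "\<dots> = U * B * ?V" using assoc_mult_mat[OF U B(1) V] by simp
    finally show "mat_adjoint (U * B * ?V) = U * B * ?V" .
  qed
  then have L: "L = B * ?V" unfolding L_def using LB by simp
  show "L \<in> carrier_mat n N" unfolding L using mult_carrier_mat[OF B(1) V] .
  show "?M * L = ?V" unfolding L unfolding assoc_mult_mat[OF M B(1) V, symmetric] B(2)
    by (rule left_mult_one_mat[OF V])
qed

section \<open>Polynomial functions on complex vectors\<close>

definition polyfun :: "(complex ^ 'n::finite \<Rightarrow> complex) \<Rightarrow> bool" where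
  "polyfun f \<longleftrightarrow> (\<exists>A c. finite A \<and> (\<forall>v. f v = (\<Sum>a\<in>A. c a * mi_power v a)))"

lemma scaleR_eq_scalar_mult: "r *\<^sub>R x = complex_of_real r *s (x :: complex ^ 'n::finite)"
  by (simp add: Finite_Cartesian_Product.vec_eq_iff complex_eq_iff)

lemma mi_power_add: "mi_power v (a + b) = mi_power v a * mi_power v b"
  by (simp add: mi_power_def power_add prod.distrib)

lemma mi_power_zero [simp]: "mi_power v 0 = 1"
  by (simp add: mi_power_def)

lemma mi_power_axis: "mi_power v (axis i 1) = v $ i"
proof -
  have "mi_power v (axis i 1) = (\<Prod>k\<in>UNIV. if k = i then v $ i else 1)"
    unfolding mi_power_def by (intro prod.cong) (auto simp: axis_def)
  then show ?thesis by simp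
qed

lemma mi_power_scale: "mi_power (t *s v) a = t ^ mi_deg a * mi_power v a"
  by (simp add: mi_power_def mi_deg_def power_mult_distrib prod.distrib power_sum)

lemma polyfun_monomial: "polyfun (\<lambda>v. c * mi_power v a)"
  unfolding polyfun_def by (rule exI[of _ "{a}"], rule exI[of _ "\<lambda>_. c"]) simp

lemma polyfun_const: "polyfun (\<lambda>v. c)"
  using polyfun_monomial[of c 0] by simp

lemma polyfun_coord: "polyfun (\<lambda>v. v $ i)"
  using polyfun_monomial[of 1 "axis i 1"] unfolding mi_power_axis mult_1_left .

lemma polyfun_add:
  assumes "polyfun f" "polyfun g"
  shows "polyfun (\<lambda>v. f v + g v)"
proof -
  obtain A c where A: "finite A" "\<And>v. f v = (\<Sum>a\<in>A. c a * mi_power v a)"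
    using assms(1) by (auto simp: polyfun_def)
  obtain B d where B: "finite B" "\<And>v. g v = (\<Sum>a\<in>B. d a * mi_power v a)"
    using assms(2) by (auto simp: polyfun_def)
  have "f v + g v = (\<Sum>a\<in>A \<union> B. ((if a \<in> A then c a else 0) + (if a \<in> B then d a else 0)) * mi_power v a)" for v
  proof -
    have "f v = (\<Sum>a\<in>A \<union> B. (if a \<in> A then c a else 0) * mi_power v a)"
      unfolding A(2) using A(1) B(1) by (intro sum.mono_neutral_cong_left) auto
    moreover have "g v = (\<Sum>a\<in>A \<union> B. (if a \<in> B then d a else 0) * mi_power v a)"
      unfolding B(2) using A(1) B(1) by (intro sum.mono_neutral_cong_left) auto
    ultimately show ?thesis by (simp add: sum.distrib distrib_right)
  qed
  then show ?thesis unfolding polyfun_def using A(1) B(1)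
    by (intro exI[of _ "A \<union> B"] exI[of _ "\<lambda>a. (if a \<in> A then c a else 0) + (if a \<in> B then d a else 0)"]) auto
qed

lemma polyfun_sum: "(\<And>i. i \<in> I \<Longrightarrow> polyfun (f i)) \<Longrightarrow> polyfun (\<lambda>v. \<Sum>i\<in>I. f i v)"
  by (induction I rule: infinite_finite_induct) (auto intro: polyfun_const polyfun_add)

lemma polyfun_mult:
  assumes "polyfun f" "polyfun g"
  shows "polyfun (\<lambda>v. f v * g v)"
proof -
  obtain A c where A: "finite A" "\<And>v. f v = (\<Sum>a\<in>A. c a * mi_power v a)"
    using assms(1) by (auto simp: polyfun_def)
  obtain B d where B: "finite B" "\<And>v. g v = (\<Sum>a\<in>B. d a * mi_power v a)"
    using assms(2) by (auto simp: polyfun_def)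
  have "(\<lambda>v. f v * g v) = (\<lambda>v. \<Sum>a\<in>A. \<Sum>b\<in>B. (c a * d b) * mi_power v (a + b))"
    by (rule ext) (simp add: A(2) B(2) sum_product mi_power_add mult_ac)
  then show ?thesis by (simp add: polyfun_sum polyfun_monomial)
qed

lemma polyfun_poly: "polyfun g \<Longrightarrow> polyfun (\<lambda>v. poly q (g v))"
  by (induction q) (auto intro: polyfun_const polyfun_add polyfun_mult)

text \<open>
  The nodes are \<open>0, \<dots>, k\<close>. Interpolation makes the coefficients of a polynomial in one variable linear in finitely many
  of its values, which is how the induction over the coordinates in
  \<open>separately_polynomial_imp_polyfun\<close> can treat them as functions of the remaining variables.
\<close>

lemma Lagrange_interpolation_exists:
  "\<exists>L :: nat \<Rightarrow> complex poly.
    \<forall>q s. degree q \<le> k \<longrightarrow> poly q s = (\<Sum>l\<le>k. poly q (of_nat l) * poly (L l) s)"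
proof -
  define L :: "nat \<Rightarrow> complex poly" where
    "L l = (\<Prod>m\<in>{..k} - {l}. Polynomial.smult (1 / (of_nat l - of_nat m)) [:- of_nat m, 1:])" for l
  have deg: "degree (L l) \<le> k" if "l \<le> k" for l
  proof -
    have "degree (L l) \<le> (\<Sum>m\<in>{..k} - {l}. degree (Polynomial.smult (1 / (of_nat l - of_nat m :: complex)) [:- of_nat m, 1:]))"
      unfolding L_def by (rule order_trans[OF degree_prod_sum_le]) (simp_all only: o_def finite_Diff finite_atMost order_refl)
    also have "\<dots> \<le> (\<Sum>m\<in>{..k} - {l}. 1)" by (rule sum_mono) auto
    finally show ?thesis using that by simp
  qed
  have val: "poly (L l) (of_nat j) = (if l = j then 1 else 0)" if "l \<le> k" "j \<le> k" for l j
  proof (cases "l = j")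
    case True
    then show ?thesis unfolding L_def poly_prod using that by (auto intro!: prod.neutral simp flip: diff_divide_distrib)
  next
    case False
    then show ?thesis unfolding L_def poly_prod using that by (auto intro!: prod_zero bexI[of _ j])
  qed
  have "poly q s = (\<Sum>l\<le>k. poly q (of_nat l) * poly (L l) s)" if q: "degree q \<le> k" for q s
  proof -
    let ?r = "\<Sum>l\<le>k. Polynomial.smult (poly q (of_nat l)) (L l)"
    let ?A = "(of_nat :: nat \<Rightarrow> complex) ` {..k}"
    have card: "card ?A = Suc k" by (simp add: card_image inj_on_def)
    have "q = ?r"
    proof (rule poly_eqI_degree[of ?A])
      fix x assume "x \<in> ?A"
      then obtain j where j: "j \<le> k" "x = of_nat j" by auto
      then show "poly q x = poly ?r x" by (simp add: poly_sum val if_distrib[of "\<lambda>x. _ * x"] cong: if_cong)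
    next
      show "degree q < card ?A" using q card by simp
      have "degree ?r \<le> k" by (intro degree_sum_le) (auto intro: order_trans[OF degree_smult_le] deg)
      then show "degree ?r < card ?A" using card by simp
    qed
    then have "poly q s = poly ?r s" by (rule arg_cong)
    then show ?thesis by (simp add: poly_sum)
  qed
  then show ?thesis by blast
qed

definition separately_polynomial :: "nat \<Rightarrow> (complex ^ 'n::finite \<Rightarrow> complex) \<Rightarrow> bool" where
  "separately_polynomial k f \<longleftrightarrow> (\<forall>v i. \<exists>q. degree q \<le> k \<and> (\<forall>s. f (v + s *s axis i 1) = poly q s))"

text \<open>
  Induction on the set of coordinates that are allowed to be nonzero. Interpolating in one coordinate at the nodes
  \<open>0, \<dots>, k\<close> writes \<open>f\<close> in terms of the translates of \<open>f\<close> by the nodes, which are again polynomial in each variable.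
\<close>

lemma separately_polynomial_imp_polyfun:
  fixes f :: "complex ^ 'n::finite \<Rightarrow> complex"
  assumes "separately_polynomial k f"
  shows "polyfun f"
proof -
  define pr :: "'n set \<Rightarrow> complex ^ 'n \<Rightarrow> complex ^ 'n" where
    "pr I v = (\<chi> i. if i \<in> I then v $ i else 0)" for I v
  obtain L :: "nat \<Rightarrow> complex poly" where L: "\<And>q s. degree q \<le> k \<Longrightarrow> poly q s = (\<Sum>l\<le>k. poly q (of_nat l) * poly (L l) s)"
    using Lagrange_interpolation_exists[of k] by blast
  have "finite I \<Longrightarrow> separately_polynomial k f \<Longrightarrow> polyfun (\<lambda>v. f (pr I v))" for I and f :: "complex ^ 'n::finite \<Rightarrow> complex"
  proof (induction I arbitrary: f rule: finite_induct)
    case empty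
    have "pr {} v = 0" for v by (simp add: pr_def Finite_Cartesian_Product.vec_eq_iff)
    then show ?case by (simp add: polyfun_const)
  next
    case (insert i I)
    have eq: "f (pr (insert i I) v) = (\<Sum>l\<le>k. f (pr I v + of_nat l *s axis i 1) * poly (L l) (v $ i))" for v
    proof -
      obtain q where q: "degree q \<le> k" "\<And>s. f (pr I v + s *s axis i 1) = poly q s"
        using insert.prems unfolding separately_polynomial_def by metis
      have "pr (insert i I) v = pr I v + (v $ i) *s axis i 1"
        using insert.hyps by (auto simp: pr_def Finite_Cartesian_Product.vec_eq_iff axis_def)
      then have "f (pr (insert i I) v) = poly q (v $ i)" by (simp add: q(2))
      also have "\<dots> = (\<Sum>l\<le>k. poly q (of_nat l) * poly (L l) (v $ i))" by (rule L[OF q(1)])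
      finally show ?thesis by (simp only: q(2))
    qed
    have "separately_polynomial k (\<lambda>v. f (v + of_nat l *s axis i 1))" for l
      unfolding separately_polynomial_def
    proof (intro allI)
      fix v and j :: 'n
      obtain q where "degree q \<le> k" "\<forall>s. f ((v + of_nat l *s axis i 1) + s *s axis j 1) = poly q s"
        using insert.prems unfolding separately_polynomial_def by blast
      then show "\<exists>q. degree q \<le> k \<and> (\<forall>s. f (v + s *s axis j 1 + of_nat l *s axis i 1) = poly q s)"
        by (intro exI[of _ q]) (simp add: add_ac)
    qed
    then have "polyfun (\<lambda>v. f (pr I v + of_nat l *s axis i 1))" for l
      by (rule insert.IH)
    then show ?case unfolding eq
      by (intro polyfun_sum polyfun_mult polyfun_poly polyfun_coord) auto
  qed
  from this[of UNIV f] assms show ?thesis by (simp add: pr_def)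
qed

lemma finite_mi_deg_eq [simp]: "finite {a :: nat ^ 'n::finite. mi_deg a = k}"
  and finite_mi_deg_le [simp]: "finite {a :: nat ^ 'n::finite. mi_deg a \<le> k}"
proof -
  have le: "a $ i \<le> mi_deg a" for a :: "nat ^ 'n" and i
    unfolding mi_deg_def by (rule member_le_sum) auto
  have "{a :: nat ^ 'n. mi_deg a \<le> k} \<subseteq> vec_lambda ` (UNIV \<rightarrow>\<^sub>E {..k})"
  proof
    fix a :: "nat ^ 'n" assume "a \<in> {a. mi_deg a \<le> k}"
    then have "vec_nth a \<in> UNIV \<rightarrow>\<^sub>E {..k}" using le order_trans by (auto simp: PiE_def Pi_def) blast
    then show "a \<in> vec_lambda ` (UNIV \<rightarrow>\<^sub>E {..k})" by (metis image_eqI vec_nth_inverse)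
  qed
  then show "finite {a :: nat ^ 'n. mi_deg a \<le> k}" by (rule finite_subset) (intro finite_imageI finite_PiE, auto)
  then show "finite {a :: nat ^ 'n. mi_deg a = k}" by (rule rev_finite_subset) auto
qed

text \<open>
  Compare coefficients of \<open>t ^ k\<close> in \<open>f (t v) = t ^ k * f v\<close>.
\<close>

lemma homogeneous_polyfun:
  fixes f :: "complex ^ 'n::finite \<Rightarrow> complex"
  assumes "polyfun f" and hom: "\<And>t v. f (t *s v) = t ^ k * f v"
  obtains c where "\<And>v. f v = (\<Sum>a | mi_deg a = k. c a * mi_power v a)"
proof -
  obtain A c where A: "finite A" "\<And>v. f v = (\<Sum>a\<in>A. c a * mi_power v a)"
    using assms(1) by (auto simp: polyfun_def)
  have "f v = (\<Sum>a | mi_deg a = k. (if a \<in> A then c a else 0) * mi_power v a)" for v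
  proof -
    let ?p = "\<Sum>a\<in>A. monom (c a * mi_power v a) (mi_deg a)"
    have "poly ?p t = poly (monom (f v) k) t" for t
      using hom[of t v] by (simp add: poly_sum poly_monom A(2) mi_power_scale mult_ac)
    then have "poly ?p = poly (monom (f v) k)" by (rule ext)
    then have "?p = monom (f v) k" using poly_eq_poly_eq_iff by blast
    then have "coeff ?p k = f v" by simp
    then have "f v = (\<Sum>a\<in>A. if mi_deg a = k then c a * mi_power v a else 0)"
      by (simp add: coeff_sum)
    also have "\<dots> = (\<Sum>a\<in>A \<inter> {a. mi_deg a = k}. c a * mi_power v a)"
      using A(1) by (simp add: sum.inter_restrict)
    also have "\<dots> = (\<Sum>a | mi_deg a = k. (if a \<in> A then c a else 0) * mi_power v a)"
      by (intro sum.mono_neutral_cong_left) auto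
    finally show ?thesis .
  qed
  then show thesis by (rule that)
qed

section \<open>Taylor expansion on a balanced set\<close>

text \<open>
  For a balanced set \<open>K\<close>, holomorphy of the restrictions to complex lines together with a bound on \<open>\<rho> K\<close> is all that the Taylor expansion uses.
  The radius \<open>\<rho> > 1\<close> provides the geometric decay that makes the remainder summable up to and including the boundary
  of \<open>K\<close>.
\<close>

locale line_holomorphic =
  fixes K V :: "(complex ^ 'n::finite) set" and G :: "complex ^ 'n \<Rightarrow> complex" and \<rho> M :: real
  assumes zero_int: "0 \<in> interior K"
    and balanced: "\<And>x t. x \<in> K \<Longrightarrow> cmod t \<le> 1 \<Longrightarrow> t *s x \<in> K"
    and openV: "open V"
    and dil: "\<And>x t. x \<in> K \<Longrightarrow> cmod t \<le> \<rho> \<Longrightarrow> t *s x \<in> V"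
    and \<rho>: "1 < \<rho>"
    and bound: "\<And>x t. x \<in> K \<Longrightarrow> cmod t \<le> \<rho> \<Longrightarrow> cmod (G (t *s x)) \<le> M"
    and holo: "\<And>a b S. open S \<Longrightarrow> (\<And>s. s \<in> S \<Longrightarrow> a + s *s b \<in> V) \<Longrightarrow> (\<lambda>s. G (a + s *s b)) holomorphic_on S"
begin

text \<open>
  The homogeneous part of degree \<open>k\<close> of the expansion of \<open>G\<close> at \<open>0\<close>, through derivatives in one variable only. That it
  is a polynomial in \<open>x\<close> is the content of the lemmas that follow.
\<close>

definition hom_part :: "nat \<Rightarrow> complex ^ 'n \<Rightarrow> complex" where
  "hom_part k x = (deriv ^^ k) (\<lambda>t. G (t *s x)) 0 / fact k"

lemma ball_in_K: obtains \<epsilon> where "0 < \<epsilon>" "cball 0 \<epsilon> \<subseteq> K"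
  using zero_int unfolding mem_interior_cball by blast

lemma continuous_line: "continuous_on UNIV (\<lambda>s. a + s *s b :: complex ^ 'n)"
  unfolding vector_scalar_mult_def by (intro continuous_intros)

lemma open_line: "open {s. a + s *s b \<in> V}"
  using open_vimage[OF openV continuous_line[of a b]] by (simp add: vimage_def)

lemma holo_line: "(\<lambda>t. G (t *s x)) holomorphic_on {t. t *s x \<in> V}"
  using holo[of "{t. t *s x \<in> V}" 0 x] open_line[of 0 x] by simp

lemma disc_in: "x \<in> K \<Longrightarrow> cball 0 \<rho> \<subseteq> {t. t *s x \<in> V}"
  using dil by auto

lemma hom_part_sums:
  assumes "x \<in> K" "cmod t < \<rho>"
  shows "(\<lambda>k. hom_part k x * t ^ k) sums G (t *s x)"
proof -
  have "(\<lambda>t. G (t *s x)) holomorphic_on ball 0 \<rho>"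
    using holo_line disc_in[OF assms(1)] ball_subset_cball by (metis holomorphic_on_subset)
  from holomorphic_power_series[OF this, of t] assms(2) show ?thesis
    by (simp add: hom_part_def)
qed

lemma hom_part_bound:
  assumes "x \<in> K"
  shows "cmod (hom_part k x) \<le> M / \<rho> ^ k"
proof -
  have h: "(\<lambda>t. G (t *s x)) holomorphic_on cball 0 \<rho>"
    using holo_line disc_in[OF assms(1)] by (metis holomorphic_on_subset)
  have "cmod ((deriv ^^ k) (\<lambda>t. G (t *s x)) 0) \<le> fact k * M / \<rho> ^ k"
  proof (rule Cauchy_inequality)
    show "(\<lambda>t. G (t *s x)) holomorphic_on ball 0 \<rho>"
      by (rule holomorphic_on_subset[OF h]) (rule ball_subset_cball)
    show "continuous_on (cball 0 \<rho>) (\<lambda>t. G (t *s x))"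
      by (rule holomorphic_on_imp_continuous_on[OF h])
    show "0 < \<rho>" using \<rho> by simp
    show "cmod (G (t *s x)) \<le> M" if "cmod (0 - t) = \<rho>" for t
      using bound[OF assms, of t] that by simp
  qed
  then show ?thesis by (simp add: hom_part_def norm_divide field_simps)
qed

lemma M_nonneg: "0 \<le> M"
proof -
  have "0 \<in> K" using zero_int interior_subset by blast
  then have "cmod (G (0 *s 0)) \<le> M" using \<rho> by (intro bound) auto
  then show ?thesis using norm_ge_zero[of "G (0 *s 0)"] by linarith
qed

lemma hom_part_scale: "hom_part k (c *s x) = c ^ k * hom_part k x"
proof -
  let ?T = "{t. t *s x \<in> V}" and ?S = "{t. t *s (c *s x) \<in> V}"
  have T: "open ?T" and S: "open ?S" using open_line[of 0 x] open_line[of 0 "c *s x"] by auto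
  have "0 \<in> K" using zero_int interior_subset by blast
  then have "0 \<in> V" using dil[of 0 0] \<rho> by simp
  then have 0: "0 \<in> ?S" by simp
  have "(deriv ^^ k) (\<lambda>w. G ((c * w) *s x)) 0 = c ^ k * (deriv ^^ k) (\<lambda>t. G (t *s x)) (c * 0)"
    by (rule higher_deriv_compose_linear[OF holo_line S T 0]) (auto simp: mult.commute)
  then show ?thesis by (simp add: hom_part_def mult.commute)
qed

text \<open>
  By Cauchy's inequality the terms beyond degree \<open>n\<close> are at most \<open>M * (R / \<rho>) ^ k\<close>; keeping only
  \<open>R ^ k \<le> R ^ Suc n\<close> leaves a geometric series in \<open>1 / \<rho>\<close>.
\<close>

lemma hom_part_tail:
  assumes x: "x \<in> K" and R: "0 \<le> R" "R \<le> 1"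
  shows "cmod (G (R *\<^sub>R x) - (\<Sum>k\<le>n. hom_part k x * of_real R ^ k)) \<le> M / (\<rho> - 1) * R ^ Suc n"
proof -
  have Rx: "R *\<^sub>R x = complex_of_real R *s x" by (rule scaleR_eq_scalar_mult)
  have "(\<lambda>k. hom_part k x * of_real R ^ k) sums G (R *\<^sub>R x)"
    unfolding Rx using x R \<rho> by (intro hom_part_sums) auto
  then have 1: "(\<lambda>k. hom_part (k + Suc n) x * of_real R ^ (k + Suc n)) sums (G (R *\<^sub>R x) - (\<Sum>k\<le>n. hom_part k x * of_real R ^ k))"
    unfolding lessThan_Suc_atMost[symmetric] by (rule sums_split_initial_segment)
  have 2: "(\<lambda>k. (M * R ^ Suc n * inverse \<rho>) * inverse \<rho> ^ k) sums ((M * R ^ Suc n * inverse \<rho>) * (1 / (1 - inverse \<rho>)))"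
    using \<rho> by (intro sums_mult geometric_sums) (auto simp: field_simps)
  have "cmod (G (R *\<^sub>R x) - (\<Sum>k\<le>n. hom_part k x * of_real R ^ k)) \<le> (M * R ^ Suc n * inverse \<rho>) * (1 / (1 - inverse \<rho>))"
  proof (rule norm_sums_le[OF 1 2])
    fix k
    have "cmod (hom_part (k + Suc n) x * of_real R ^ (k + Suc n)) \<le> M / \<rho> ^ (k + Suc n) * R ^ (k + Suc n)"
      unfolding norm_mult norm_power norm_of_real abs_of_nonneg[OF R(1)]
      using R by (intro mult_right_mono hom_part_bound[OF x]) auto
    also have "\<dots> \<le> M / \<rho> ^ Suc k * R ^ Suc n"
      using R \<rho> M_nonneg by (intro mult_mono divide_left_mono power_increasing power_decreasing) auto
    finally show "cmod (hom_part (k + Suc n) x * of_real R ^ (k + Suc n)) \<le> (M * R ^ Suc n * inverse \<rho>) * inverse \<rho> ^ k"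
      by (simp add: field_simps)
  qed
  also have "\<dots> = M / (\<rho> - 1) * R ^ Suc n" using \<rho> by (simp add: field_simps)
  finally show ?thesis .
qed

lemma hom_part_bound_norm:
  assumes \<epsilon>: "0 < \<epsilon>" "cball 0 \<epsilon> \<subseteq> K"
  shows "cmod (hom_part k v) \<le> M * (norm v / \<epsilon>) ^ k"
proof (cases "v = 0")
  case True
  have "0 \<in> K" using \<epsilon> by auto
  then have "cmod (hom_part k 0) \<le> M" if "k = 0" using hom_part_bound[of 0 0] that by simp
  moreover have "hom_part k 0 = 0" if "k \<noteq> 0" using hom_part_scale[of k 0 0] that by (simp add: power_0_left)
  ultimately show ?thesis using True by (cases k) auto
next
  case False
  define u where "u = complex_of_real (\<epsilon> / norm v) *s v"
  have nu: "norm u = \<epsilon>"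
  proof -
    have "u = (\<epsilon> / norm v) *\<^sub>R v" unfolding u_def by (rule scaleR_eq_scalar_mult[symmetric])
    then show ?thesis using False \<epsilon> by simp
  qed
  then have "u \<in> K" using \<epsilon> by auto
  have v: "v = complex_of_real (norm v / \<epsilon>) *s u"
    using False \<epsilon> by (simp add: u_def Finite_Cartesian_Product.vec_eq_iff)
  have "cmod (hom_part k v) = (norm v / \<epsilon>) ^ k * cmod (hom_part k u)"
    by (subst v) (use \<epsilon> in \<open>simp add: hom_part_scale norm_mult norm_power norm_divide\<close>)
  also have "\<dots> \<le> (norm v / \<epsilon>) ^ k * M"
  proof (rule mult_left_mono)
    have "M / \<rho> ^ k \<le> M / 1" using \<rho> M_nonneg by (intro divide_left_mono) auto
    then show "cmod (hom_part k u) \<le> M" using hom_part_bound[OF \<open>u \<in> K\<close>, of k] by simp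
  qed (use \<epsilon> in auto)
  finally show ?thesis by (simp add: mult.commute)
qed

text \<open>
  With \<open>v = x + s y\<close>, the value of the part of degree \<open>k\<close> is the limit, as \<open>\<tau>\<close> tends to zero, of
  \<open>(G (\<tau> v) - (\<Sum>j<k. \<tau> ^ j * hom_part j v)) / \<tau> ^ k\<close>. The lower parts are holomorphic in \<open>s\<close> by induction and the
  convergence is uniform in bounded \<open>s\<close> by \<open>hom_part_tail\<close>, so the limit is holomorphic as well.
\<close>

lemma hom_part_line_entire: "(\<lambda>s. hom_part k (x + s *s y)) holomorphic_on UNIV"
proof (induction k rule: less_induct)
  case (less k)
  obtain \<epsilon> where \<epsilon>: "0 < \<epsilon>" "cball 0 \<epsilon> \<subseteq> K" using ball_in_K .
  have "(\<lambda>s. hom_part k (x + s *s y)) holomorphic_on ball 0 R" if R: "0 < R" for R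
  proof -
    \<comment> \<open>With this factor the scaled points \<open>\<delta> (x + s y)\<close>, \<open>\<bar>s\<bar> < R\<close>, all lie in \<open>K\<close>.\<close>
    define \<delta> where "\<delta> = \<epsilon> / (norm x + R * norm y + 1)"
    have den: "0 < norm x + R * norm y + 1" using R by (intro add_nonneg_pos) auto
    then have \<delta>: "0 < \<delta>" using \<epsilon> by (simp add: \<delta>_def)
    define w where "w s = complex_of_real \<delta> *s (x + s *s y)" for s
    have wK: "w s \<in> K" if s: "s \<in> ball 0 R" for s
    proof -
      have "w s = \<delta> *\<^sub>R (x + s *s y)" unfolding w_def by (rule scaleR_eq_scalar_mult[symmetric])
      moreover have "norm (x + s *s y) \<le> norm x + R * norm y"
      proof -
        have "norm (s *s y) = cmod s * norm y"
          by (simp add: norm_vec_def norm_mult L2_set_right_distrib)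
        also have "\<dots> \<le> R * norm y" using s by (intro mult_right_mono) auto
        finally show ?thesis using norm_triangle_ineq[of x "s *s y"] by linarith
      qed
      then have "\<delta> * norm (x + s *s y) \<le> \<delta> * (norm x + R * norm y + 1)"
        using \<delta> by (intro mult_left_mono) auto
      moreover have "\<delta> * (norm x + R * norm y + 1) = \<epsilon>" using den by (simp add: \<delta>_def)
      ultimately have "norm (w s) \<le> \<epsilon>" using \<delta> by simp
      then show ?thesis using \<epsilon> by auto
    qed
    define \<tau> where "\<tau> m = inverse (real (Suc m))" for m
    have \<tau>: "0 < \<tau> m" "\<tau> m \<le> 1" for m by (auto simp: \<tau>_def field_simps)
    define \<phi> where "\<phi> m s = (G (\<tau> m *\<^sub>R w s) - (\<Sum>j<k. hom_part j (w s) * of_real (\<tau> m) ^ j)) / of_real (\<tau> m * \<delta>) ^ k" for m s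
    have Qw: "hom_part j (w s) = of_real \<delta> ^ j * hom_part j (x + s *s y)" for j s
      unfolding w_def by (rule hom_part_scale)
    have hol: "\<phi> m holomorphic_on ball 0 R" for m
    proof -
      have eq: "\<tau> m *\<^sub>R w s = of_real (\<tau> m * \<delta>) *s x + s *s (of_real (\<tau> m * \<delta>) *s y)" for s
        unfolding scaleR_eq_scalar_mult by (simp add: w_def Finite_Cartesian_Product.vec_eq_iff algebra_simps)
      have inV: "\<tau> m *\<^sub>R w s \<in> V" if "s \<in> ball 0 R" for s
      proof -
        have "\<tau> m *\<^sub>R w s = of_real (\<tau> m) *s w s" by (rule scaleR_eq_scalar_mult)
        then show ?thesis using dil[OF wK[OF that], of "of_real (\<tau> m)"] \<tau>[of m] \<rho> by simp
      qed
      have "(\<lambda>s. G (\<tau> m *\<^sub>R w s)) holomorphic_on ball 0 R"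
        unfolding eq by (rule holo) (use inV in \<open>auto simp: eq\<close>)
      moreover have "(\<lambda>s. hom_part j (x + s *s y)) holomorphic_on ball 0 R" if "j < k" for j
        using less.IH[OF that] by (rule holomorphic_on_subset) auto
      ultimately show ?thesis unfolding \<phi>_def Qw using \<tau>[of m] \<delta>
        by (intro holomorphic_intros) auto
    qed
    have err: "cmod (\<phi> m s - hom_part k (x + s *s y)) \<le> M / (\<rho> - 1) / \<delta> ^ k * \<tau> m" if s: "s \<in> ball 0 R" for m s
    proof -
      have "\<phi> m s - hom_part k (x + s *s y) = (G (\<tau> m *\<^sub>R w s) - (\<Sum>j\<le>k. hom_part j (w s) * of_real (\<tau> m) ^ j)) / of_real (\<tau> m * \<delta>) ^ k"
        using \<tau>[of m] \<delta> by (simp add: \<phi>_def Qw lessThan_Suc_atMost[symmetric] field_simps)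
      also have "cmod \<dots> = cmod (G (\<tau> m *\<^sub>R w s) - (\<Sum>j\<le>k. hom_part j (w s) * of_real (\<tau> m) ^ j)) / (\<tau> m * \<delta>) ^ k"
        using \<tau>[of m] \<delta> by (simp add: norm_divide norm_power norm_mult)
      also have "\<dots> \<le> M / (\<rho> - 1) * \<tau> m ^ Suc k / (\<tau> m * \<delta>) ^ k"
        using hom_part_tail[OF wK[OF s], of "\<tau> m" k] \<tau>[of m] \<delta> by (intro divide_right_mono) auto
      also have "\<dots> = M / (\<rho> - 1) / \<delta> ^ k * \<tau> m"
        using \<tau>[of m] \<delta> by (simp add: power_mult_distrib)
      finally show ?thesis .
    qed
    have lim: "(\<lambda>m. M / (\<rho> - 1) / \<delta> ^ k * \<tau> m) \<longlonglongrightarrow> 0"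
      unfolding \<tau>_def by (rule tendsto_mult_right_zero[OF LIMSEQ_inverse_real_of_nat])
    have ul: "uniform_limit (ball 0 R) \<phi> (\<lambda>s. hom_part k (x + s *s y)) sequentially"
    proof (rule uniform_limitI)
      fix e :: real assume "0 < e"
      then have "\<forall>\<^sub>F m in sequentially. M / (\<rho> - 1) / \<delta> ^ k * \<tau> m < e"
        using lim by (auto dest: order_tendstoD)
      then show "\<forall>\<^sub>F m in sequentially. \<forall>s\<in>ball 0 R. dist (\<phi> m s) (hom_part k (x + s *s y)) < e"
        by eventually_elim (use err in \<open>fastforce simp: dist_norm intro: le_less_trans\<close>)
    qed
    show ?thesis
    proof (rule holomorphic_uniform_sequence[OF open_ball hol])
      fix z :: complex assume "z \<in> ball 0 R"
      then obtain d where "0 < d" "cball z d \<subseteq> ball 0 R" 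
        using open_ball[of 0 R] unfolding open_contains_cball by blast
      then show "\<exists>d>0. cball z d \<subseteq> ball 0 R \<and> uniform_limit (cball z d) \<phi> (\<lambda>s. hom_part k (x + s *s y)) sequentially"
        using uniform_limit_on_subset[OF ul] by blast
    qed
  qed
  note h = this
  show ?case
    unfolding holomorphic_on_def
  proof
    fix z :: complex
    have "z \<in> ball 0 (cmod z + 1)" by simp
    moreover have "(\<lambda>s. hom_part k (x + s *s y)) holomorphic_on ball 0 (cmod z + 1)" by (rule h) (simp add: add_nonneg_pos)
    ultimately show "(\<lambda>s. hom_part k (x + s *s y)) field_differentiable at z within UNIV"
      using holomorphic_on_imp_differentiable_at[of _ "ball 0 (cmod z + 1)" z] by auto
  qed
qed

text \<open>
  Along a coordinate line the part of degree \<open>k\<close> is entire and grows at most like \<open>\<bar>s\<bar> ^ k\<close>, so Liouville's theorem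
  applies.
\<close>

lemma hom_part_separately_polynomial: "separately_polynomial k (hom_part k)"
  unfolding separately_polynomial_def
proof (intro allI)
  fix v and i :: 'n
  let ?f = "\<lambda>s. hom_part k (v + s *s axis i 1)"
  obtain \<epsilon> where \<epsilon>: "0 < \<epsilon>" "cball 0 \<epsilon> \<subseteq> K" using ball_in_K .
  let ?B = "M * ((norm v + 1) / \<epsilon>) ^ k"
  define a where "a j = (deriv ^^ j) ?f 0 / fact j" for j
  have "?f s = (\<Sum>j\<le>k. a j * s ^ j)" for s
    unfolding a_def
  proof (rule Liouville_polynomial[OF hom_part_line_entire, of 1 _ _ _ ?B])
    fix z :: complex assume z: "1 \<le> cmod z"
    have "norm (z *s axis i (1::complex)) = cmod z"
    proof -
      have "z *s axis i (1::complex) = axis i z" by (simp add: Finite_Cartesian_Product.vec_eq_iff axis_def)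
      then show ?thesis by (simp add: norm_vec_def L2_set_def axis_def if_distrib[of cmod] if_distrib[of "\<lambda>x. x\<^sup>2"] cong: if_cong)
    qed
    then have "norm (v + z *s axis i 1) \<le> norm v + cmod z" using norm_triangle_ineq[of v "z *s axis i 1"] by simp
    also have "\<dots> \<le> (norm v + 1) * cmod z" using z mult_left_mono[OF z, of "norm v"] by (simp add: algebra_simps)
    finally have "norm (v + z *s axis i 1) / \<epsilon> \<le> (norm v + 1) * cmod z / \<epsilon>" using \<epsilon> by (intro divide_right_mono) auto
    then have "M * (norm (v + z *s axis i 1) / \<epsilon>) ^ k \<le> M * ((norm v + 1) * cmod z / \<epsilon>) ^ k"
      using M_nonneg \<epsilon> by (intro mult_left_mono power_mono) auto
    then show "cmod (?f z) \<le> ?B * cmod z ^ k"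
      using hom_part_bound_norm[OF \<epsilon>, of k "v + z *s axis i 1"] by (simp add: power_mult_distrib power_divide mult_ac)
  qed
  then have "?f s = poly (\<Sum>j\<le>k. monom (a j) j) s" for s
    by (simp add: poly_sum poly_monom)
  moreover have "degree (\<Sum>j\<le>k. monom (a j) j) \<le> k"
    by (intro degree_sum_le) (auto intro: order_trans[OF degree_monom_le])
  ultimately show "\<exists>q. degree q \<le> k \<and> (\<forall>s. ?f s = poly q s)" by blast
qed

text \<open>
  A single family of coefficients serves all degrees \<open>n\<close>; the truncation of a degree \<open>n\<close> fit to degree \<open>m\<close> is
  compared with the same expansion.
\<close>

theorem taylor_expansion:
  obtains c :: "nat ^ 'n \<Rightarrow> complex" where
    "\<And>x R n. x \<in> K \<Longrightarrow> 0 \<le> R \<Longrightarrow> R \<le> 1 \<Longrightarrow>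
      cmod (G (R *\<^sub>R x) - (\<Sum>a | mi_deg a \<le> n. c a * mi_power (R *\<^sub>R x) a)) \<le> M / (\<rho> - 1) * R ^ Suc n"
proof -
  have "\<exists>c. \<forall>v. hom_part k v = (\<Sum>a | mi_deg a = k. c a * mi_power v a)" for k
    using homogeneous_polyfun[OF separately_polynomial_imp_polyfun[OF hom_part_separately_polynomial] hom_part_scale] by metis
  then obtain c where c: "\<And>k v. hom_part k v = (\<Sum>a | mi_deg a = k. c k a * mi_power v a)" by metis
  have "(\<Sum>k\<le>n. hom_part k v) = (\<Sum>a | mi_deg a \<le> n. c (mi_deg a) a * mi_power v a)" for n v
  proof -
    have "(\<Sum>k\<le>n. hom_part k v) = (\<Sum>k\<le>n. \<Sum>a | mi_deg a = k. c (mi_deg a) a * mi_power v a)"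
      unfolding c by (intro sum.cong) auto
    also have "\<dots> = (\<Sum>a \<in> (\<Union>k\<in>{..n}. {a. mi_deg a = k}). c (mi_deg a) a * mi_power v a)"
      by (rule sum.UNION_disjoint[symmetric]) auto
    also have "(\<Union>k\<in>{..n}. {a :: nat ^ 'n. mi_deg a = k}) = {a. mi_deg a \<le> n}" by auto
    finally show ?thesis .
  qed
  note 1 = this
  have "hom_part k (R *\<^sub>R x) = hom_part k x * of_real R ^ k" for k R x
  proof -
    have "R *\<^sub>R x = complex_of_real R *s x" by (rule scaleR_eq_scalar_mult)
    then show ?thesis by (simp add: hom_part_scale)
  qed
  then show thesis using that[of "\<lambda>a. c (mi_deg a) a"] hom_part_tail by (simp flip: 1)
qed

end

section \<open>Counting multi-indices and the multinomial theorem\<close>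

text \<open>
  Functions supported in \<open>I\<close>, rather than vectors, so that the index set can grow in an induction.
\<close>

definition compositions :: "'n set \<Rightarrow> nat \<Rightarrow> ('n \<Rightarrow> nat) set" where
  "compositions I k = {a. (\<forall>i. i \<notin> I \<longrightarrow> a i = 0) \<and> sum a I = k}"

lemma finite_compositions:
  assumes "finite I"
  shows "finite (compositions I k)"
proof (rule finite_subset)
  show "compositions I k \<subseteq> {a. \<forall>i. (i \<in> I \<longrightarrow> a i \<in> {..k}) \<and> (i \<notin> I \<longrightarrow> a i = 0)}"
    using assms by (auto simp: compositions_def intro: member_le_sum)
  show "finite {a. \<forall>i. (i \<in> I \<longrightarrow> a i \<in> {..k}) \<and> (i \<notin> I \<longrightarrow> a i = (0::nat))}"
    using assms by (rule finite_set_of_finite_funs) simp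
qed

lemma sum_compositions_insert:
  fixes F :: "('n \<Rightarrow> nat) \<Rightarrow> 'a::comm_monoid_add"
  assumes I: "finite I" "i \<notin> I"
  shows "(\<Sum>a\<in>compositions (insert i I) k. F a) = (\<Sum>j\<le>k. \<Sum>a\<in>compositions I (k - j). F (a(i := j)))"
proof -
  have "(\<Sum>a\<in>compositions (insert i I) k. F a) = (\<Sum>(j, a)\<in>(SIGMA j:{..k}. compositions I (k - j)). F (a(i := j)))"
  proof (rule sum.reindex_bij_witness[where i = "\<lambda>(j, a). a(i := j)" and j = "\<lambda>a. (a i, a(i := 0))"], goal_cases)
    case (2 a)
    have "sum (a(i := 0)) I = sum a I" using I by (intro sum.cong) auto
    then show ?case using 2 I by (auto simp: compositions_def)
  next
    case (3 b)
    then show ?case using I by (auto simp: compositions_def fun_eq_iff)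
  next
    case (4 b)
    obtain j a where b: "b = (j, a)" by (cases b)
    have "sum (a(i := j)) I = sum a I" using I by (intro sum.cong) auto
    then show ?case using 4 I by (auto simp: b compositions_def)
  qed auto
  then show ?thesis using I by (simp add: sum.Sigma finite_compositions)
qed

lemma multinomial_compositions:
  fixes y :: "'n \<Rightarrow> complex"
  assumes "finite I"
  shows "(\<Sum>a\<in>compositions I k. \<Prod>i\<in>I. y i ^ a i / fact (a i)) = (\<Sum>i\<in>I. y i) ^ k / fact k"
  using assms
proof (induction I arbitrary: k rule: finite_induct)
  case empty
  have "compositions ({} :: 'n set) k = (if k = 0 then {\<lambda>_. 0} else {})"
    by (auto simp: compositions_def)
  then show ?case by simp
next
  case (insert i I)
  have "(\<Sum>a\<in>compositions (insert i I) k. \<Prod>l\<in>insert i I. y l ^ a l / fact (a l))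
    = (\<Sum>j\<le>k. \<Sum>a\<in>compositions I (k - j). y i ^ j / fact j * (\<Prod>l\<in>I. y l ^ a l / fact (a l)))"
    unfolding sum_compositions_insert[OF insert.hyps]
  proof (intro sum.cong refl)
    fix j a
    have "(\<Prod>l\<in>I. y l ^ (a(i := j)) l / fact ((a(i := j)) l)) = (\<Prod>l\<in>I. y l ^ a l / fact (a l))"
      using insert.hyps by (intro prod.cong) auto
    then show "(\<Prod>l\<in>insert i I. y l ^ (a(i := j)) l / fact ((a(i := j)) l))
      = y i ^ j / fact j * (\<Prod>l\<in>I. y l ^ a l / fact (a l))" using insert.hyps by simp
  qed
  also have "\<dots> = (\<Sum>j\<le>k. y i ^ j / fact j * ((\<Sum>l\<in>I. y l) ^ (k - j) / fact (k - j)))"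
    unfolding sum_distrib_left[symmetric] insert.IH ..
  also have "\<dots> = (\<Sum>j\<le>k. of_nat (k choose j) * y i ^ j * (\<Sum>l\<in>I. y l) ^ (k - j)) / fact k"
    unfolding sum_divide_distrib by (intro sum.cong) (auto simp: binomial_fact)
  also have "\<dots> = (y i + (\<Sum>l\<in>I. y l)) ^ k / fact k" by (simp add: binomial_ring)
  finally show ?case using insert.hyps by simp
qed

text \<open>
  Adding an index turns the count for total \<open>k\<close> into the sum of the counts for totals up to \<open>k\<close>, which is the hockey
  stick recursion of binomial coefficients.
\<close>

lemma card_compositions:
  assumes "finite I"
  shows "(\<Sum>k\<le>n. card (compositions I k)) = (n + card I) choose card I"
  using assms
proof (induction I arbitrary: n rule: finite_induct)
  case empty
  have "compositions ({} :: 'a set) k = (if k = 0 then {\<lambda>_. 0} else {})" for k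
    by (auto simp: compositions_def)
  then have "card (compositions ({} :: 'a set) k) = (if k = 0 then 1 else 0)" for k by simp
  then show ?case by simp
next
  case (insert i I)
  have "card (compositions (insert i I) k) = (\<Sum>j\<le>k. card (compositions I j))" for k
  proof -
    have "card (compositions (insert i I) k) = (\<Sum>j\<le>k. card (compositions I (k - j)))"
      using sum_compositions_insert[OF insert.hyps, of "\<lambda>_. 1 :: nat" k] by simp
    also have "\<dots> = (\<Sum>j\<le>k. card (compositions I j))"
      by (rule sum.reindex_bij_witness[where i = "\<lambda>j. k - j" and j = "\<lambda>j. k - j"]) auto
    finally show ?thesis .
  qed
  then have "(\<Sum>k\<le>n. card (compositions (insert i I) k)) = (\<Sum>k\<le>n. (card I + k) choose card I)"
    using insert.IH by (simp add: add.commute)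
  also have "\<dots> = Suc (card I + n) choose Suc (card I)"
    by (induction n) auto
  finally show ?case using insert.hyps by (simp add: add.commute)
qed

lemma mi_compositions:
  "bij_betw vec_nth {a :: nat ^ 'n::finite. mi_deg a = k} (compositions UNIV k)"
  by (rule bij_betw_byWitness[where f' = vec_lambda]) (auto simp: compositions_def mi_deg_def)

lemma card_mi_deg_le: "card {a :: nat ^ 'n::finite. mi_deg a \<le> n} = poly_dim TYPE('n) n"
proof -
  have "{a :: nat ^ 'n. mi_deg a \<le> n} = (\<Union>k\<in>{..n}. {a. mi_deg a = k})" by auto
  then have "card {a :: nat ^ 'n. mi_deg a \<le> n} = (\<Sum>k\<le>n. card {a :: nat ^ 'n. mi_deg a = k})"
    by (simp only:) (subst card_UN_disjoint, auto)
  also have "\<dots> = (\<Sum>k\<le>n. card (compositions (UNIV :: 'n set) k))"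
    by (intro sum.cong refl bij_betw_same_card[OF mi_compositions])
  finally show ?thesis by (simp add: card_compositions poly_dim_def)
qed

text \<open>
  There are \<open>n\<close> terms, so the degree is \<open>n - 1\<close> and \<open>exp_trunc 0\<close> is zero. With this convention differentiation lowers
  the index by one without exception.
\<close>

definition exp_trunc :: "nat \<Rightarrow> complex \<Rightarrow> complex" where
  "exp_trunc n x = (\<Sum>k<n. x ^ k / fact k)"

lemma multinomial:
  fixes y :: "complex ^ 'n::finite"
  shows "(\<Sum>a | mi_deg a = k. mi_power y a / of_nat (mi_fact a)) = (\<Sum>i\<in>UNIV. y $ i) ^ k / fact k"
proof -
  have "(\<Sum>a | mi_deg a = k. mi_power y a / of_nat (mi_fact a))
      = (\<Sum>a | mi_deg a = k. \<Prod>i\<in>UNIV. (y $ i) ^ (a $ i) / fact (a $ i))"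
    by (simp add: mi_power_def mi_fact_def prod_dividef)
  also have "\<dots> = (\<Sum>a\<in>compositions (UNIV :: 'n set) k. \<Prod>i\<in>UNIV. (y $ i) ^ a i / fact (a i))"
    by (rule sum.reindex_bij_betw[OF mi_compositions])
  finally show ?thesis by (simp add: multinomial_compositions)
qed

lemma mi_deg_le_UN: "{a :: nat ^ 'n::finite. mi_deg a \<le> n} = (\<Union>k\<in>{..n}. {a. mi_deg a = k})"
  by auto

lemma sum_multinomial:
  fixes y :: "complex ^ 'n::finite"
  shows "(\<Sum>a | mi_deg a \<le> n. mi_power y a / of_nat (mi_fact a)) = exp_trunc (Suc n) (\<Sum>i\<in>UNIV. y $ i)"
  unfolding mi_deg_le_UN exp_trunc_def lessThan_Suc_atMost
  by (subst sum.UNION_disjoint) (auto simp: multinomial)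

lemma exp_trunc_real_le:
  assumes "0 \<le> x"
  shows "(\<Sum>k<n. x ^ k / fact k) \<le> exp (x :: real)"
proof -
  have "(\<lambda>k. x ^ k / fact k) sums exp x" using exp_converges[of x] by (simp add: field_simps)
  then have "summable (\<lambda>k. x ^ k / fact k)" "suminf (\<lambda>k. x ^ k / fact k) = exp x"
    by (auto simp: sums_iff)
  then show ?thesis using sum_le_suminf[of "\<lambda>k. x ^ k / fact k" "{..<n}"] assms by simp
qed

text \<open>
  By the multinomial theorem for \<open>y\<^sub>i = \<bar>x\<^sub>i\<bar>\<^sup>2\<close> the sum is a partial sum of \<open>exp (norm x ^ 2)\<close>.
\<close>

lemma sum_mi_power_sq_le:
  fixes x :: "complex ^ 'n::finite"
  shows "(\<Sum>a | mi_deg a \<le> n. (cmod (mi_power x a))\<^sup>2 / real (mi_fact a)) \<le> exp ((norm x)\<^sup>2)"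
proof -
  let ?y = "\<chi> i. complex_of_real ((cmod (x $ i))\<^sup>2)"
  have "complex_of_real ((cmod (mi_power x a))\<^sup>2) = mi_power ?y a" for a
    by (simp add: mi_power_def norm_power power_mult[symmetric] prod_power_distrib mult.commute flip: prod_norm)
  then have "complex_of_real (\<Sum>a | mi_deg a \<le> n. (cmod (mi_power x a))\<^sup>2 / real (mi_fact a))
      = (\<Sum>a | mi_deg a \<le> n. mi_power ?y a / of_nat (mi_fact a))" by simp
  also have "\<dots> = exp_trunc (Suc n) (complex_of_real ((norm x)\<^sup>2))"
    unfolding sum_multinomial by (simp add: norm_vec_def L2_set_def sum_nonneg)
  also have "\<dots> = complex_of_real (\<Sum>k<Suc n. ((norm x)\<^sup>2) ^ k / fact k)"
    by (simp only: exp_trunc_def of_real_sum of_real_divide of_real_power of_real_fact)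
  finally show ?thesis using exp_trunc_real_le[of "(norm x)\<^sup>2" "Suc n"] by (simp only: of_real_eq_iff) simp
qed

lemma mi_fact_le: "mi_fact (a :: nat ^ 'n::finite) \<le> fact (mi_deg a)"
proof -
  have "finite I \<Longrightarrow> (\<Prod>i\<in>I. fact (a $ i)) \<le> (fact (\<Sum>i\<in>I. a $ i) :: nat)" for I
  proof (induction I rule: finite_induct)
    case (insert i I)
    have "fact (a $ i) * (\<Prod>i\<in>I. fact (a $ i)) \<le> fact (a $ i) * (fact (\<Sum>i\<in>I. a $ i) :: nat)"
      using insert by simp
    also have "\<dots> \<le> fact (a $ i + (\<Sum>i\<in>I. a $ i))"
      by (intro dvd_imp_le fact_fact_dvd_fact) simp
    finally show ?case using insert by simp
  qed simp
  then show ?thesis by (simp add: mi_fact_def mi_deg_def)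
qed

lemma mi_fact_pos [simp]: "0 < mi_fact a"
  by (simp add: mi_fact_def prod_pos)

lemma mi_fact_nonzero [simp]: "mi_fact a \<noteq> 0"
  by (simp add: mi_fact_def)

text \<open>
  The numbers of the multi-indices of degree at most \<open>n\<close> form an initial segment, because the degree is monotone along
  a numbering; the length of the segment is the number of these multi-indices.
\<close>

lemma mi_numbering_image:
  fixes \<alpha> :: "nat \<Rightarrow> nat ^ 'n::{finite,linorder}"
  assumes "mi_numbering \<alpha>"
  shows "bij_betw \<alpha> {..<poly_dim TYPE('n) n} {a. mi_deg a \<le> n}"
proof -
  have bij: "bij \<alpha>" and mono: "\<And>i j. i \<le> j \<Longrightarrow> mi_deg (\<alpha> i) \<le> mi_deg (\<alpha> j)"
    using assms by (auto simp: mi_numbering_def)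
  let ?A = "{i. mi_deg (\<alpha> i) \<le> n}"
  have bA: "bij_betw \<alpha> ?A {a. mi_deg a \<le> n}"
    using bij unfolding bij_betw_def bij_def inj_on_def surj_def by (auto simp: image_iff)
  have cA: "card ?A = poly_dim TYPE('n) n"
    using bij_betw_same_card[OF bA] card_mi_deg_le by metis
  have fA: "finite ?A" using bij_betw_finite[OF bA] by simp
  have "?A = {..<card ?A}"
  proof (cases "?A = {}")
    case False
    have "?A = {..Max ?A}"
      using Max_in[OF fA False] Max_ge[OF fA] mono order_trans by blast
    moreover from this have "card ?A = Suc (Max ?A)" using card_atMost by metis
    ultimately show ?thesis using lessThan_Suc_atMost by metis
  qed auto
  then show ?thesis using bA cA by metis
qed

lemma sum_mi_numbering:
  fixes \<alpha> :: "nat \<Rightarrow> nat ^ 'n::{finite,linorder}"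
  assumes "mi_numbering \<alpha>"
  shows "(\<Sum>j<poly_dim TYPE('n) n. F (\<alpha> j)) = (\<Sum>a | mi_deg a \<le> n. F a)"
  by (rule sum.reindex_bij_betw[OF mi_numbering_image[OF assms]])

section \<open>Recovering a coordinate from the truncated kernel\<close>

lemma exp_trunc_deriv:
  "(exp_trunc (Suc n) has_field_derivative exp_trunc n x) (at x)"
proof -
  have "((\<lambda>x. \<Sum>k<Suc n. x ^ k / fact k) has_field_derivative (\<Sum>k<Suc n. of_nat k * x ^ (k - 1) / fact k)) (at x)"
    by (auto intro!: derivative_eq_intros sum.cong)
  also have "(\<Sum>k<Suc n. of_nat k * x ^ (k - 1) / fact k) = exp_trunc n x"
    unfolding sum.lessThan_Suc_shift exp_trunc_def by (simp add: fact_reduce del: of_nat_Suc)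
  finally show ?thesis unfolding exp_trunc_def[abs_def] .
qed

lemma mi_power_mult: "mi_power u a * mi_power v a = mi_power (\<chi> j. u $ j * v $ j) a"
  by (simp add: mi_power_def prod.distrib power_mult_distrib)

lemma cnj_mi_power: "cnj (mi_power u a) = mi_power (\<chi> j. cnj (u $ j)) a"
  by (simp add: mi_power_def)

definition herm_pairing :: "complex ^ 'n::finite \<Rightarrow> complex ^ 'n \<Rightarrow> complex" where
  "herm_pairing q w = (\<Sum>k\<in>UNIV. cnj (q $ k) * w $ k)"

lemma herm_pairing_self: "herm_pairing q q = complex_of_real ((norm q)\<^sup>2)"
  by (simp add: herm_pairing_def norm_vec_def L2_set_def sum_nonneg mult.commute flip: complex_norm_square)

lemma herm_pairing_diff: "herm_pairing q (v - w) = herm_pairing q v - herm_pairing q w"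
  by (simp add: herm_pairing_def algebra_simps sum_subtractf)

text \<open>
  The degree \<open>m\<close> truncation of the reproducing kernel \<open>exp (w\<^sup>* v)\<close>, expanded around \<open>q\<close>.
\<close>

lemma fock_kernel_sum:
  fixes \<beta> :: "nat \<Rightarrow> nat ^ 'n::{finite,linorder}"
  assumes "mi_numbering \<beta>"
  shows "(\<Sum>k<poly_dim TYPE('n) m. cnj (fock_fun \<beta> q k w) * fock_fun \<beta> q k v)
    = exp (herm_pairing q v + cnj (herm_pairing q w) - complex_of_real ((norm q)\<^sup>2))
      * exp_trunc (Suc m) (\<Sum>j\<in>UNIV. cnj ((w - q) $ j) * (v - q) $ j)"
proof -
  define F where "F a = exp (herm_pairing q v + cnj (herm_pairing q w) - complex_of_real ((norm q)\<^sup>2))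
      * (mi_power (\<chi> j. cnj ((w - q) $ j) * (v - q) $ j) a / of_nat (mi_fact a))" for a
  have "cnj (fock_fun \<beta> q k w) * fock_fun \<beta> q k v = F (\<beta> k)" for k
  proof -
    let ?c = "complex_of_real (exp (- (norm q)\<^sup>2 / 2) / sqrt (real (mi_fact (\<beta> k))))"
    have cc: "?c * ?c = exp (- complex_of_real ((norm q)\<^sup>2)) / of_nat (mi_fact (\<beta> k))"
    proof -
      have "exp (- (norm q)\<^sup>2 / 2) * exp (- (norm q)\<^sup>2 / 2) = exp (- (norm q)\<^sup>2)"
        by (simp flip: exp_add)
      then have "(exp (- (norm q)\<^sup>2 / 2) / sqrt (real (mi_fact (\<beta> k)))) * (exp (- (norm q)\<^sup>2 / 2) / sqrt (real (mi_fact (\<beta> k))))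
        = exp (- (norm q)\<^sup>2) / real (mi_fact (\<beta> k))" by simp
      then show ?thesis
        unfolding of_real_mult[symmetric]
        by (simp only: of_real_divide exp_of_real[symmetric] of_real_minus of_real_of_nat_eq)
    qed
    have "cnj (fock_fun \<beta> q k w) * fock_fun \<beta> q k v
      = (?c * ?c) * (mi_power (\<chi> j. cnj ((w - q) $ j)) (\<beta> k) * mi_power (v - q) (\<beta> k))
        * (exp (cnj (herm_pairing q w)) * exp (herm_pairing q v))"
    proof -
      have ff: "fock_fun \<beta> q k u = ?c * mi_power (u - q) (\<beta> k) * exp (herm_pairing q u)" for u
        by (simp only: fock_fun_def herm_pairing_def)
      show ?thesis unfolding ff by (simp add: cnj_mi_power exp_cnj mult_ac)
    qed
    also have "\<dots> = F (\<beta> k)"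
      unfolding cc mi_power_mult F_def by (simp add: exp_add exp_diff exp_minus field_simps)
    finally show ?thesis .
  qed
  then have "(\<Sum>k<poly_dim TYPE('n) m. cnj (fock_fun \<beta> q k w) * fock_fun \<beta> q k v)
      = (\<Sum>a | mi_deg a \<le> m. F a)" using sum_mi_numbering[OF assms, of F m] by simp
  also have "\<dots> = exp (herm_pairing q v + cnj (herm_pairing q w) - complex_of_real ((norm q)\<^sup>2))
      * exp_trunc (Suc m) (\<Sum>j\<in>UNIV. cnj ((w - q) $ j) * (v - q) $ j)"
    unfolding F_def sum_distrib_left[symmetric] sum_multinomial by simp
  finally show ?thesis .
qed

text \<open>
  The limit for \<open>m \<rightarrow> \<infinity>\<close> is \<open>exp x * (w\<^sub>i * exp (- x)) = w\<^sub>i\<close>. The two truncation orders differ by one because the first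
  comes from the exponential factor and the second from the derivative of the truncated kernel.
\<close>

definition coord_approx :: "nat \<Rightarrow> complex ^ 'n::finite \<Rightarrow> 'n \<Rightarrow> complex ^ 'n \<Rightarrow> complex" where
  "coord_approx m q i w = (let x = herm_pairing q (w - q) in
     exp x * (q $ i * exp_trunc (Suc m) (- x) + (w $ i - q $ i) * exp_trunc m (- x)))"

lemma fock_fun_line_differentiable:
  "(\<lambda>t. fock_fun \<beta> q k (0 + t *s axis i 1)) field_differentiable at t"
proof -
  have "(\<lambda>t. fock_fun \<beta> q k (0 + t *s axis i 1)) holomorphic_on UNIV"
    unfolding fock_fun_def mi_power_def vector_add_component vector_minus_component vector_smult_component
    by (intro holomorphic_intros)
  then show ?thesis using holomorphic_on_imp_differentiable_at[of _ UNIV t] by auto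
qed

text \<open>
  The sum is the conjugate of the derivative at \<open>t = 0\<close> of the truncated kernel \<open>fock_kernel_sum\<close> at \<open>v = t e\<^sub>i\<close>.
\<close>

lemma fock_coord_sum:
  fixes \<beta> :: "nat \<Rightarrow> nat ^ 'n::{finite,linorder}"
  assumes "mi_numbering \<beta>"
  shows "(\<Sum>k<poly_dim TYPE('n) m. fock_fun \<beta> q k w * cnj (partial_deriv i (fock_fun \<beta> q k) 0))
    = coord_approx m q i w"
proof -
  define x where "x = herm_pairing q (w - q)"
  let ?h = "\<lambda>k t. fock_fun \<beta> q k (0 + t *s axis i 1)"
  let ?H = "\<lambda>t. \<Sum>k<poly_dim TYPE('n) m. cnj (fock_fun \<beta> q k w) * ?h k t"
  let ?d = "\<Sum>k<poly_dim TYPE('n) m. cnj (fock_fun \<beta> q k w) * partial_deriv i (fock_fun \<beta> q k) 0"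
  have d1: "(?H has_field_derivative ?d) (at 0)"
    unfolding partial_deriv_def
    by (intro DERIV_sum DERIV_cmult field_differentiable_derivI fock_fun_line_differentiable)
  have s1: "herm_pairing q (0 + t *s axis i 1) = cnj (q $ i) * t" for t
    by (simp add: herm_pairing_def axis_def if_distrib[of "\<lambda>x. _ * x"] cong: if_cong)
  have s2: "(\<Sum>j\<in>UNIV. cnj ((w - q) $ j) * (0 + t *s axis i 1 - q) $ j) = cnj (w $ i - q $ i) * t - cnj x" for t
  proof -
    have "(\<Sum>j\<in>UNIV. cnj ((w - q) $ j) * (0 + t *s axis i 1 - q) $ j)
      = (\<Sum>j\<in>UNIV. (if j = i then cnj (w $ i - q $ i) * t else 0) - cnj ((w - q) $ j) * q $ j)"
      by (intro sum.cong) (auto simp: axis_def algebra_simps)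
    then show ?thesis by (simp add: sum_subtractf x_def herm_pairing_def mult.commute)
  qed
  have nx: "cnj (q $ i) * t + cnj (herm_pairing q w) - complex_of_real ((norm q)\<^sup>2) = cnj (q $ i) * t + cnj x" for t
    by (simp add: x_def herm_pairing_diff herm_pairing_self)
  have H: "?H = (\<lambda>t. exp (cnj (q $ i) * t + cnj x) * exp_trunc (Suc m) (cnj (w $ i - q $ i) * t - cnj x))"
    unfolding fock_kernel_sum[OF assms] s1 s2 nx ..
  have "(?H has_field_derivative
      (exp (cnj x) * (cnj (q $ i) * exp_trunc (Suc m) (- cnj x) + cnj (w $ i - q $ i) * exp_trunc m (- cnj x)))) (at 0)"
    unfolding H
    by (rule derivative_eq_intros DERIV_chain2[OF exp_trunc_deriv] refl)+ (simp add: algebra_simps)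
  with d1 have "?d = exp (cnj x) * (cnj (q $ i) * exp_trunc (Suc m) (- cnj x) + cnj (w $ i - q $ i) * exp_trunc m (- cnj x))"
    by (rule DERIV_unique)
  then have "cnj ?d = exp x * (q $ i * exp_trunc (Suc m) (- x) + (w $ i - q $ i) * exp_trunc m (- x))"
    by (simp add: exp_cnj exp_trunc_def)
  then show ?thesis by (simp add: coord_approx_def Let_def x_def)
qed

section \<open>Moment matrices of measures\<close>

definition mi_poly :: "(nat \<Rightarrow> nat ^ 'n::finite) \<Rightarrow> nat \<Rightarrow> (nat \<Rightarrow> complex) \<Rightarrow> complex ^ 'n \<Rightarrow> complex" where
  "mi_poly \<alpha> R a z = (\<Sum>j<R. a j * mi_power z (\<alpha> j))"

lemma moment_matrix_carrier [simp]:
  "moment_matrix \<alpha> n (\<mu> :: (complex ^ 'n::finite) measure) \<in> carrier_mat (poly_dim TYPE('n) n) (poly_dim TYPE('n) n)"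
  by (simp add: moment_matrix_def)

text \<open>
  The quadratic form of a moment matrix is the squared \<open>L\<^sup>2\<close> norm of the polynomial with the given coefficients.
\<close>

lemma moment_matrix_form:
  fixes \<mu> :: "(complex ^ 'n::finite) measure" and n :: nat
  defines "R \<equiv> poly_dim TYPE('n) n"
  assumes int: "\<And>i j. integrable \<mu> (\<lambda>z. cnj (mi_power z (\<alpha> i)) * mi_power z (\<alpha> j))"
  shows "(moment_matrix \<alpha> n \<mu> *\<^sub>v Matrix.vec R a) \<bullet>c Matrix.vec R a
    = complex_of_real (\<integral>z. (cmod (mi_poly \<alpha> R a z))\<^sup>2 \<partial>\<mu>)"
proof -
  have "(moment_matrix \<alpha> n \<mu> *\<^sub>v Matrix.vec R a) \<bullet>c Matrix.vec R a
    = (\<Sum>i<R. \<Sum>j<R. cnj (a i) * a j * (\<integral>z. cnj (mi_power z (\<alpha> i)) * mi_power z (\<alpha> j) \<partial>\<mu>))"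
    by (subst inner_prod_sum[of _ R])
      (auto simp: moment_matrix_def scalar_prod_def R_def[symmetric] sum_distrib_left sum_distrib_right atLeast0LessThan mult_ac intro!: sum.cong)
  also have "\<dots> = (\<integral>z. (\<Sum>i<R. \<Sum>j<R. cnj (a i) * a j * (cnj (mi_power z (\<alpha> i)) * mi_power z (\<alpha> j))) \<partial>\<mu>)"
    using int by (simp add: integral_sum integrable_sum)
  also have "(\<lambda>z. \<Sum>i<R. \<Sum>j<R. cnj (a i) * a j * (cnj (mi_power z (\<alpha> i)) * mi_power z (\<alpha> j)))
    = (\<lambda>z. complex_of_real ((cmod (mi_poly \<alpha> R a z))\<^sup>2))"
    by (rule ext, simp only: complex_norm_square mi_poly_def cnj_sum sum_product)
      (subst sum.swap, simp add: mult_ac)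
  finally show ?thesis by (simp only: integral_complex_of_real)
qed

lemma moment_matrix_psd:
  fixes \<mu> :: "(complex ^ 'n::finite) measure"
  assumes int: "\<And>i j. integrable \<mu> (\<lambda>z. cnj (mi_power z (\<alpha> i)) * mi_power z (\<alpha> j))"
  shows "pos_semidef (moment_matrix \<alpha> n \<mu>)"
  unfolding pos_semidef_def
proof (intro conjI ballI)
  let ?D = "moment_matrix \<alpha> n \<mu>" and ?R = "poly_dim TYPE('n) n"
  show "square_mat ?D" by (simp add: moment_matrix_def)
  show "mat_adjoint ?D = ?D"
  proof (rule eq_matI)
    fix i j assume "i < dim_row ?D" "j < dim_col ?D"
    then have "i < ?R" "j < ?R" by (auto simp: moment_matrix_def)
    then show "mat_adjoint ?D $$ (i, j) = ?D $$ (i, j)"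
      by (simp add: moment_matrix_def mult.commute Bochner_Integration.integral_cnj[symmetric] del: Bochner_Integration.integral_cnj)
  qed (auto simp: moment_matrix_def)
  fix v :: "complex Matrix.vec" assume "v \<in> carrier_vec (dim_row ?D)"
  then have "v = Matrix.vec ?R (vec_index v)" by (intro eq_vecI) (auto simp: moment_matrix_def)
  then have "Re ((?D *\<^sub>v v) \<bullet>c v) = (\<integral>z. (cmod (mi_poly \<alpha> ?R (vec_index v) z))\<^sup>2 \<partial>\<mu>)"
    using moment_matrix_form[OF int, where n = n and a = "vec_index v"] by simp
  then show "0 \<le> Re ((?D *\<^sub>v v) \<bullet>c v)" by simp
qed

lemma continuous_mi_power: "continuous_on S (\<lambda>z. mi_power z a)"
  unfolding mi_power_def by (intro continuous_intros)

lemma integrable_moments: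
  fixes \<mu> :: "(complex ^ 'n::finite) measure"
  assumes \<mu>: "sets \<mu> = sets borel" "prob_space \<mu>" "measure \<mu> K = 1" and K: "compact K"
  shows "integrable \<mu> (\<lambda>z. cnj (mi_power z a) * mi_power z b)"
proof -
  interpret prob_space \<mu> by (rule \<mu>(2))
  let ?f = "\<lambda>z :: complex ^ 'n. cnj (mi_power z a) * mi_power z b"
  have cont: "continuous_on UNIV ?f" by (intro continuous_intros continuous_mi_power)
  have "compact (?f ` K)" by (rule compact_continuous_image[OF continuous_on_subset[OF cont] K]) simp
  then obtain B where B: "\<And>z. z \<in> K \<Longrightarrow> cmod (?f z) \<le> B"
    unfolding compact_eq_bounded_closed bounded_iff by blast
  have "K \<in> sets \<mu>" using \<mu>(1) K by (simp add: compact_imp_closed)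
  then have "AE z in \<mu>. z \<in> K" using \<mu>(3) by (simp add: AE_in_set_eq_1)
  then have "AE z in \<mu>. norm (?f z) \<le> B" by eventually_elim (rule B)
  moreover have "?f \<in> borel_measurable \<mu>"
    using borel_measurable_continuous_onI[OF cont] measurable_cong_sets[OF \<mu>(1) refl] by blast
  ultimately show ?thesis by (intro integrable_const_bound) auto
qed

lemma empirical_measure_eq_distr:
  fixes x :: "nat \<Rightarrow> 'a::topological_space"
  assumes "1 \<le> N"
  shows "empirical_measure N x = distr (uniform_count_measure {..<N}) borel x"
proof -
  let ?M = "distr (uniform_count_measure {..<N}) borel x"
  have "(\<Sum>i<N. emeasure (return borel (x i)) A) / of_nat N = emeasure ?M A" if A: "A \<in> sets borel" for A
  proof -
    have "(\<Sum>i<N. emeasure (return borel (x i)) A) = (\<Sum>i<N. if x i \<in> A then 1 else 0)"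
      using A by (intro sum.cong) (auto simp: indicator_def)
    also have "\<dots> = of_nat (card {i\<in>{..<N}. x i \<in> A})"
      by (subst sum.inter_filter[symmetric]) auto
    finally have 1: "(\<Sum>i<N. emeasure (return borel (x i)) A) = of_nat (card {i\<in>{..<N}. x i \<in> A})" .
    have "emeasure ?M A = emeasure (uniform_count_measure {..<N}) {i\<in>{..<N}. x i \<in> A}"
      using A by (subst emeasure_distr) (auto simp: space_uniform_count_measure intro!: arg_cong2[where f = emeasure])
    also have "\<dots> = ennreal (real (card {i\<in>{..<N}. x i \<in> A}) / real N)"
      by (subst emeasure_uniform_count_measure) auto
    also have "\<dots> = of_nat (card {i\<in>{..<N}. x i \<in> A}) / of_nat N"
      using assms by (simp add: divide_ennreal[symmetric] ennreal_of_nat_eq_real_of_nat)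
    finally show ?thesis using 1 by simp
  qed
  then have "measure_of UNIV (sets borel) (\<lambda>A. (\<Sum>i<N. emeasure (return borel (x i)) A) / of_nat N)
      = measure_of UNIV (sets borel) (emeasure ?M)"
    by (intro measure_of_eq) (auto simp: sets.sigma_sets_eq[of borel, simplified])
  also have "\<dots> = ?M" using measure_of_of_measure[of ?M] by simp
  finally show ?thesis unfolding empirical_measure_def .
qed

lemma empirical_measure_integral:
  fixes f :: "'a::topological_space \<Rightarrow> 'b::{banach, second_countable_topology}"
  assumes N: "1 \<le> N" and f: "f \<in> borel_measurable borel"
  shows "integrable (empirical_measure N x) f"
    and "(\<integral>z. f z \<partial>empirical_measure N x) = (\<Sum>l<N. f (x l)) /\<^sub>R real N"
proof -
  have m: "x \<in> measurable (uniform_count_measure {..<N}) borel"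
    by (simp add: measurable_def space_uniform_count_measure sets_uniform_count_measure)
  have i: "integrable (uniform_count_measure {..<N}) (\<lambda>i. f (x i))"
    unfolding uniform_count_measure_def by (rule integrable_point_measure_finite) auto
  then show "integrable (empirical_measure N x) f"
    unfolding empirical_measure_eq_distr[OF N] using integrable_distr_eq[OF m f] by simp
  have "(\<integral>z. f z \<partial>empirical_measure N x) = (\<integral>i. f (x i) \<partial>uniform_count_measure {..<N})"
    unfolding empirical_measure_eq_distr[OF N] by (rule integral_distr[OF m f])
  also have "\<dots> = (\<Sum>l<N. (1 / real N) *\<^sub>R f (x l))"
    unfolding uniform_count_measure_def by (subst lebesgue_integral_point_measure_finite) auto
  finally show "(\<integral>z. f z \<partial>empirical_measure N x) = (\<Sum>l<N. f (x l)) /\<^sub>R real N"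
    by (simp add: scaleR_sum_right divide_inverse)
qed

text \<open>
  The two comparisons of quadratic forms combined: empirical moments dominate \<open>\<gamma>\<close> times the moments of \<open>\<mu>\<close>, and these
  dominate the smallest eigenvalue times the identity.
\<close>

lemma empirical_norm_lower_bound:
  fixes \<mu> :: "(complex ^ 'n::finite) measure" and a :: "nat \<Rightarrow> complex" and n :: nat
  defines "R \<equiv> poly_dim TYPE('n) n"
  assumes \<mu>: "sets \<mu> = sets borel" "prob_space \<mu>" "measure \<mu> K = 1" and K: "compact K"
    and N: "1 \<le> N" and inv: "invertible_mat (moment_matrix \<alpha> n \<mu>)" and \<gamma>: "0 < \<gamma>"
    and op: "mat_op_norm (1\<^sub>m R - mat_inv_sqrt (moment_matrix \<alpha> n \<mu>)
      * moment_matrix \<alpha> n (empirical_measure N x) * mat_inv_sqrt (moment_matrix \<alpha> n \<mu>)) \<le> 1 - \<gamma>"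
  shows "0 < min_eigenvalue (moment_matrix \<alpha> n \<mu>)"
    and "\<gamma> * min_eigenvalue (moment_matrix \<alpha> n \<mu>) * (\<Sum>j<R. (cmod (a j))\<^sup>2)
      \<le> (\<Sum>l<N. (cmod (mi_poly \<alpha> R a (x l)))\<^sup>2) / real N"
proof -
  let ?D = "moment_matrix \<alpha> n \<mu>" and ?H = "moment_matrix \<alpha> n (empirical_measure N x)"
  have D: "?D \<in> carrier_mat R R" and H: "?H \<in> carrier_mat R R" by (simp_all add: R_def)
  have psd: "pos_semidef ?D" by (rule moment_matrix_psd) (rule integrable_moments[OF \<mu> K])
  have R: "0 < R" by (simp add: R_def poly_dim_def zero_less_binomial)
  show "0 < min_eigenvalue ?D" by (rule min_eigenvalue(1)[OF D psd inv R])
  let ?v = "Matrix.vec R a"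
  have v: "?v \<in> carrier_vec R" by simp
  have "?v \<bullet>c ?v = complex_of_real (\<Sum>j<R. (cmod (a j))\<^sup>2)"
    unfolding of_real_sum complex_norm_square by (subst inner_prod_sum[OF v]) (auto intro!: sum.cong)
  then have "\<gamma> * min_eigenvalue ?D * (\<Sum>j<R. (cmod (a j))\<^sup>2) = \<gamma> * (min_eigenvalue ?D * Re (?v \<bullet>c ?v))"
    by simp
  also have "\<dots> \<le> \<gamma> * Re ((?D *\<^sub>v ?v) \<bullet>c ?v)"
    using \<gamma> min_eigenvalue(2)[OF D psd inv R v] by (intro mult_left_mono) auto
  also have "\<dots> \<le> Re ((?H *\<^sub>v ?v) \<bullet>c ?v)"
    by (rule form_lower_bound_of_op_norm[OF D psd inv H op v])
  also have "\<dots> = (\<integral>z. (cmod (mi_poly \<alpha> R a z))\<^sup>2 \<partial>empirical_measure N x)"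
  proof -
    have "integrable (empirical_measure N x) (\<lambda>z. cnj (mi_power z (\<alpha> i)) * mi_power z (\<alpha> j))" for i j
      by (intro empirical_measure_integral(1)[OF N] borel_measurable_continuous_onI continuous_intros continuous_mi_power)
    from moment_matrix_form[OF this] show ?thesis unfolding R_def by simp
  qed
  also have "\<dots> = (\<Sum>l<N. (cmod (mi_poly \<alpha> R a (x l)))\<^sup>2) /\<^sub>R real N"
    unfolding mi_poly_def
    by (intro empirical_measure_integral(2)[OF N] borel_measurable_continuous_onI continuous_intros continuous_mi_power)
  finally show "\<gamma> * min_eigenvalue ?D * (\<Sum>j<R. (cmod (a j))\<^sup>2)
      \<le> (\<Sum>l<N. (cmod (mi_poly \<alpha> R a (x l)))\<^sup>2) / real N" by (simp add: divide_inverse mult.commute)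
qed

section \<open>The estimator as a least squares fit\<close>

lemma poly_dim_mono: "m \<le> n \<Longrightarrow> poly_dim TYPE('n::finite) m \<le> poly_dim TYPE('n) n"
  unfolding card_mi_deg_le[symmetric] by (intro card_mono) auto

text \<open>
  The coefficient vector is \<open>c = L g\<close>, where \<open>L\<close> is the least squares operator of the matrix of the \<open>u\<^bsub>p,j\<^esub>\<close> and
  \<open>g l\<close> is the approximate coordinate of the \<open>l\<close>-th value of \<open>f\<close>. Taking the first columns in the definition of the
  estimator discards the coefficients of degree above \<open>m\<close>, but the equations for \<open>c\<close> hold up to degree \<open>n\<close>.
\<close>

lemma f_hat_least_squares:
  fixes p :: "complex ^ 'd::{finite,linorder}" and f :: "complex ^ 'd::_ \<Rightarrow> complex ^ 'r::{finite,linorder}"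
  defines "R \<equiv> poly_dim TYPE('d)"
  assumes \<beta>: "mi_numbering \<beta>" and mn: "m \<le> n"
    and inj: "\<And>a. (\<And>l. l < N \<Longrightarrow> (\<Sum>j<R n. fock_fun \<alpha> p j (Z l) * a j) = 0) \<Longrightarrow> (\<And>j. j < R n \<Longrightarrow> a j = 0)"
  obtains c where
    "\<And>j. j < R n \<Longrightarrow> (\<Sum>l<N. cnj (fock_fun \<alpha> p j (Z l)) *
        ((\<Sum>k<R n. fock_fun \<alpha> p k (Z l) * c k) - coord_approx m (f p) i (f (Z l)))) = 0"
    "\<And>z. f_hat \<alpha> \<beta> f p m n N Z z $ i = (\<Sum>j<R m. fock_fun \<alpha> p j z * c j)"
proof -
  define U where "U = fock_matrix \<alpha> p n N Z"
  define V where "V = fock_matrix \<beta> (f p) m N (\<lambda>l. f (Z l))"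
  define L where "L = mat_adjoint (pseudo_inverse (mat_adjoint U))"
  define S where "S = poly_dim TYPE('r) m"
  have U: "U \<in> carrier_mat N (R n)" and V: "V \<in> carrier_mat N S"
    by (auto simp: U_def V_def fock_matrix_def R_def S_def)
  have Ui: "U $$ (l, j) = fock_fun \<alpha> p j (Z l)" if "l < N" "j < R n" for l j
    using that by (simp add: U_def fock_matrix_def R_def)
  have Vi: "V $$ (l, k) = fock_fun \<beta> (f p) k (f (Z l))" if "l < N" "k < S" for l k
    using that by (simp add: V_def fock_matrix_def S_def)
  have injU: "v = 0\<^sub>v (R n)" if v: "v \<in> carrier_vec (R n)" and z: "U *\<^sub>v v = 0\<^sub>v N" for v
  proof -
    have "(\<Sum>j<R n. fock_fun \<alpha> p j (Z l) * vec_index v j) = 0" if l: "l < N" for l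
    proof -
      have "(\<Sum>j<R n. fock_fun \<alpha> p j (Z l) * vec_index v j) = vec_index (U *\<^sub>v v) l"
        using U v l by (simp add: scalar_prod_def Ui atLeast0LessThan)
      then show ?thesis using z l by simp
    qed
    then have "vec_index v j = 0" if "j < R n" for j using inj that by blast
    then show ?thesis using v by (intro eq_vecI) auto
  qed
  have L: "L \<in> carrier_mat (R n) N" and ne: "mat_adjoint U * U * L = mat_adjoint U"
    using least_squares_normal_equations[OF U injU] by (simp_all add: L_def)
  define P where "P = pseudo_inverse (mat_adjoint U)"
  have P: "P \<in> carrier_mat N (R n)" using L by (metis L_def P_def mat_adjoint_adjoint mat_adjoint_carrier)
  have PL: "cnj (P $$ (l, j)) = L $$ (j, l)" if "l < N" "j < R n" for l j
    using that P by (simp add: L_def P_def[symmetric])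
  define b where "b k = cnj (partial_deriv i (fock_fun \<beta> (f p) k) 0)" for k
  define g where "g l = coord_approx m (f p) i (f (Z l))" for l
  have g: "g l = (\<Sum>k<S. V $$ (l, k) * b k)" if "l < N" for l
    using fock_coord_sum[OF \<beta>, where m = m and q = "f p" and w = "f (Z l)" and i = i] that by (simp add: g_def b_def Vi S_def)
  define c where "c j = (\<Sum>l<N. L $$ (j, l) * g l)" for j
  have Rmn: "R m \<le> R n" unfolding R_def using mn by (rule poly_dim_mono)
  have "f_hat \<alpha> \<beta> f p m n N Z z $ i = (\<Sum>j<R m. fock_fun \<alpha> p j z * c j)" for z
  proof -
    define C where "C = C_hat \<alpha> \<beta> f p m n N Z"
    have C: "C \<in> carrier_mat S (R m)"
      by (simp add: C_def C_hat_def first_cols_def V_def[symmetric] U_def[symmetric] R_def) (use V in auto)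
    have Ci: "cnj (C $$ (k, j)) = (\<Sum>l<N. V $$ (l, k) * L $$ (j, l))" if kj: "k < S" "j < R m" for k j
    proof -
      have "C $$ (k, j) = (mat_adjoint V * P) $$ (k, j)"
        using kj V by (simp add: C_def C_hat_def first_cols_def V_def[symmetric] U_def[symmetric] P_def R_def)
      also have "\<dots> = (\<Sum>l<N. cnj (V $$ (l, k)) * P $$ (l, j))"
        using kj V P Rmn by (simp add: scalar_prod_def atLeast0LessThan)
      finally show ?thesis using kj Rmn PL by simp
    qed
    have "f_hat \<alpha> \<beta> f p m n N Z z $ i
      = (\<Sum>k<S. (\<Sum>j<R m. fock_fun \<alpha> p j z * cnj (C $$ (k, j))) * b k)"
      using C by (simp add: f_hat_def C_def[symmetric] fock_row_def fock_row_partial_def scalar_prod_def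
          atLeast0LessThan b_def S_def[symmetric] R_def)
    also have "\<dots> = (\<Sum>k<S. \<Sum>j<R m. \<Sum>l<N. fock_fun \<alpha> p j z * (L $$ (j, l) * (V $$ (l, k) * b k)))"
      by (simp add: Ci sum_distrib_left sum_distrib_right mult_ac)
    also have "\<dots> = (\<Sum>j<R m. \<Sum>l<N. \<Sum>k<S. fock_fun \<alpha> p j z * (L $$ (j, l) * (V $$ (l, k) * b k)))"
      by (rule trans[OF sum.swap]) (intro sum.cong refl sum.swap)
    also have "\<dots> = (\<Sum>j<R m. fock_fun \<alpha> p j z * c j)"
      by (simp add: c_def g sum_distrib_left)
    finally show ?thesis .
  qed
  moreover have "(\<Sum>l<N. cnj (fock_fun \<alpha> p j (Z l)) *
        ((\<Sum>k<R n. fock_fun \<alpha> p k (Z l) * c k) - coord_approx m (f p) i (f (Z l)))) = 0" if j: "j < R n" for j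
  proof -
    define cv gv where "cv = Matrix.vec (R n) c" and "gv = Matrix.vec N g"
    have cv: "cv \<in> carrier_vec (R n)" and gv: "gv \<in> carrier_vec N" by (simp_all add: cv_def gv_def)
    have Lg: "L *\<^sub>v gv = cv"
      using L by (intro eq_vecI) (auto simp: cv_def gv_def c_def scalar_prod_def atLeast0LessThan)
    have U': "mat_adjoint U \<in> carrier_mat (R n) N" using U by simp
    have "mat_adjoint U *\<^sub>v (U *\<^sub>v cv) = (mat_adjoint U * U) *\<^sub>v (L *\<^sub>v gv)"
      unfolding Lg by (rule assoc_mult_mat_vec[OF U' U cv, symmetric])
    also have "\<dots> = mat_adjoint U * U * L *\<^sub>v gv"
      by (rule assoc_mult_mat_vec[OF mult_carrier_mat[OF U' U] L gv, symmetric])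
    finally have "mat_adjoint U *\<^sub>v (U *\<^sub>v cv) = mat_adjoint U *\<^sub>v gv" unfolding ne .
    then have "vec_index (mat_adjoint U *\<^sub>v (U *\<^sub>v cv)) j = vec_index (mat_adjoint U *\<^sub>v gv) j" by simp
    then have "(\<Sum>l<N. cnj (U $$ (l, j)) * (\<Sum>k<R n. U $$ (l, k) * c k)) = (\<Sum>l<N. cnj (U $$ (l, j)) * g l)"
      using j U by (simp add: scalar_prod_def atLeast0LessThan cv_def gv_def)
    then show ?thesis using j by (simp add: Ui right_diff_distrib sum_subtractf g_def)
  qed
  ultimately show thesis using that by blast
qed

text \<open>
  The hypothesis \<open>orth\<close> says that the residual \<open>B - e\<close> is orthogonal to \<open>B\<close> in the weighted inner product, so
  the weighted norm of \<open>B\<close> is at most that of \<open>e\<close>, by \<open>2 \<bar>B e\<bar> \<le> \<bar>B\<bar>\<^sup>2 + \<bar>e\<bar>\<^sup>2\<close>.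
\<close>

lemma weighted_least_squares_bound:
  fixes B e :: "nat \<Rightarrow> complex" and w :: "nat \<Rightarrow> real"
  assumes orth: "(\<Sum>l<N. complex_of_real (w l) * cnj (B l) * (B l - e l)) = 0"
    and lo: "0 < lo" "\<And>l. l < N \<Longrightarrow> lo \<le> w l" and hi: "\<And>l. l < N \<Longrightarrow> w l \<le> hi"
    and e: "\<And>l. l < N \<Longrightarrow> cmod (e l) \<le> \<epsilon>" and N: "1 \<le> N"
  shows "(\<Sum>l<N. (cmod (B l))\<^sup>2) / real N \<le> hi / lo * \<epsilon>\<^sup>2"
proof -
  have w: "0 < w l" if "l < N" for l using lo that by (meson less_le_trans)
  have hi0: "0 \<le> hi" using w[of 0] hi[of 0] N by linarith
  have "Re (complex_of_real (w l) * cnj (B l) * (B l - e l)) \<ge> w l * (cmod (B l))\<^sup>2 / 2 - w l * (cmod (e l))\<^sup>2 / 2"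
    if l: "l < N" for l
  proof -
    have "Re (cnj (B l) * e l) \<le> cmod (B l) * cmod (e l)"
      using complex_Re_le_cmod[of "cnj (B l) * e l"] by (simp add: norm_mult)
    also have "\<dots> \<le> ((cmod (B l))\<^sup>2 + (cmod (e l))\<^sup>2) / 2"
      using sum_squares_bound[of "cmod (B l)" "cmod (e l)"] by simp
    finally have "(cmod (B l))\<^sup>2 - Re (cnj (B l) * e l) \<ge> (cmod (B l))\<^sup>2 / 2 - (cmod (e l))\<^sup>2 / 2" by argo
    then have "w l * ((cmod (B l))\<^sup>2 / 2 - (cmod (e l))\<^sup>2 / 2) \<le> w l * ((cmod (B l))\<^sup>2 - Re (cnj (B l) * e l))"
      using w[OF l] by (intro mult_left_mono) auto
    also have "\<dots> = Re (complex_of_real (w l) * cnj (B l) * (B l - e l))"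
    proof -
      have "complex_of_real (w l) * cnj (B l) * (B l - e l)
        = complex_of_real (w l) * (complex_of_real ((cmod (B l))\<^sup>2) - cnj (B l) * e l)"
        unfolding complex_norm_square by (simp add: algebra_simps)
      also have "Re \<dots> = w l * Re (complex_of_real ((cmod (B l))\<^sup>2) - cnj (B l) * e l)"
        by simp
      finally show ?thesis by simp
    qed
    finally show ?thesis by (simp add: algebra_simps)
  qed
  then have "(\<Sum>l<N. w l * (cmod (B l))\<^sup>2 / 2 - w l * (cmod (e l))\<^sup>2 / 2) \<le> Re (\<Sum>l<N. complex_of_real (w l) * cnj (B l) * (B l - e l))"
    unfolding Re_sum by (intro sum_mono) auto
  then have "(\<Sum>l<N. w l * (cmod (B l))\<^sup>2) \<le> (\<Sum>l<N. w l * (cmod (e l))\<^sup>2)"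
    unfolding orth by (simp add: sum_subtractf flip: sum_divide_distrib)
  moreover have "lo * (\<Sum>l<N. (cmod (B l))\<^sup>2) \<le> (\<Sum>l<N. w l * (cmod (B l))\<^sup>2)"
    unfolding sum_distrib_left using lo by (intro sum_mono mult_right_mono) auto
  moreover have "(\<Sum>l<N. w l * (cmod (e l))\<^sup>2) \<le> (\<Sum>l<N. hi * \<epsilon>\<^sup>2)"
    using hi e hi0 by (intro sum_mono mult_mono power_mono) auto
  ultimately have "lo * (\<Sum>l<N. (cmod (B l))\<^sup>2) \<le> real N * (hi * \<epsilon>\<^sup>2)" by simp
  then show ?thesis using lo(1) N by (simp add: field_simps)
qed

section \<open>The gauge of an absolutely convex body\<close>

lemma absolutely_convex_balanced:
  assumes "absolutely_convex K" "x \<in> K" "cmod t \<le> 1"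
  shows "t *s x \<in> K"
proof -
  have "t *s x + 0 *s x \<in> K"
    using assms unfolding absolutely_convex_def by (metis add.right_neutral norm_zero)
  then show ?thesis by simp
qed

lemma gauge_norm_bdd: "bdd_below {t. 0 < t \<and> x \<in> (\<lambda>x. t *\<^sub>R x) ` S}"
  by (rule bdd_belowI[of _ 0]) auto

lemma gauge_norm_mem:
  assumes "x \<in> K"
  shows "0 \<le> gauge_norm K x" "gauge_norm K x \<le> 1"
proof -
  have 1: "1 \<in> {t. 0 < t \<and> x \<in> (\<lambda>x. t *\<^sub>R x) ` K}" using assms by (auto intro!: image_eqI[of _ _ x])
  then show "gauge_norm K x \<le> 1" unfolding gauge_norm_def by (rule cInf_lower[OF _ gauge_norm_bdd])
  show "0 \<le> gauge_norm K x" unfolding gauge_norm_def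
  proof (rule cInf_greatest)
    show "{t. 0 < t \<and> x \<in> (\<lambda>x. t *\<^sub>R x) ` K} \<noteq> {}" using 1 by blast
  qed auto
qed

text \<open>
  The infimum in the gauge is attained: \<open>x / s \<in> K\<close> for all \<open>s > R\<close>, and \<open>K\<close> is closed. For \<open>R = 0\<close>
  boundedness of \<open>K\<close> forces \<open>x = 0\<close>.
\<close>

lemma gauge_norm_scale:
  fixes K :: "(complex ^ 'n::finite) set"
  assumes K: "compact K" "absolutely_convex K" "0 \<in> interior K"
    and x: "x \<in> K" and R: "gauge_norm K x \<le> R"
  obtains y where "y \<in> K" "x = R *\<^sub>R y"
proof -
  let ?T = "{t. 0 < t \<and> x \<in> (\<lambda>x. t *\<^sub>R x) ` K}"
  have R0: "0 \<le> R" using gauge_norm_mem[OF x] R by linarith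
  have ne: "?T \<noteq> {}" 
  proof -
    have "1 \<in> ?T" using x by (auto intro!: image_eqI[of _ _ x])
    then show ?thesis by blast
  qed
  have sK: "inverse s *\<^sub>R x \<in> K" if s: "R < s" for s
  proof -
    have "Inf ?T < s" using R s by (simp add: gauge_norm_def)
    then obtain t where t: "0 < t" "x \<in> (\<lambda>x. t *\<^sub>R x) ` K" "t < s" using cInf_lessD[OF ne] by blast
    then obtain y where y: "y \<in> K" "x = t *\<^sub>R y" by blast
    have "inverse s *\<^sub>R x = (t / s) *\<^sub>R y"
      unfolding y(2) by (simp add: divide_inverse mult.commute)
    then have "inverse s *\<^sub>R x = complex_of_real (t / s) *s y"
      by (simp only: scaleR_eq_scalar_mult)
    moreover have "cmod (complex_of_real (t / s)) \<le> 1" using t by (simp add: norm_divide)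
    ultimately show ?thesis using absolutely_convex_balanced[OF K(2) y(1)] by metis
  qed
  show thesis
  proof (cases "R = 0")
    case True
    have "x = 0"
    proof (rule ccontr)
      assume nz: "x \<noteq> 0"
      obtain b where b: "0 < b" "\<And>y. y \<in> K \<Longrightarrow> norm y \<le> b"
        using compact_imp_bounded[OF K(1)] bounded_pos by metis
      have "0 < norm x / (2 * b)" using nz b by simp
      then have "norm (inverse (norm x / (2 * b)) *\<^sub>R x) \<le> b" using sK b(2) True by blast
      then show False using nz b(1) by (simp add: field_simps)
    qed
    then show thesis using that[of 0] K(3) interior_subset by auto
  next
    case False
    then have Rp: "0 < R" using R0 by simp
    have "(\<lambda>k. R + inverse (real (Suc k))) \<longlonglongrightarrow> R + 0"
      by (intro tendsto_add tendsto_const LIMSEQ_inverse_real_of_nat)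
    then have "(\<lambda>k. inverse (R + inverse (real (Suc k))) *\<^sub>R x) \<longlonglongrightarrow> inverse (R + 0) *\<^sub>R x"
      using Rp by (intro tendsto_scaleR tendsto_inverse tendsto_const) auto
    moreover have "inverse (R + inverse (real (Suc k))) *\<^sub>R x \<in> K" for k by (rule sK) simp
    ultimately have "inverse (R + 0) *\<^sub>R x \<in> K"
      using compact_imp_closed[OF K(1)] by (meson closed_sequentially)
    then show thesis using that[of "inverse R *\<^sub>R x"] Rp by simp
  qed
qed

text \<open>
  A point of \<open>t K\<close> with \<open>\<bar>t\<bar> \<le> \<rho>\<close> is \<open>\<rho> y = y + (\<rho> - 1) y\<close> with \<open>y \<in> K\<close>, so it is close to \<open>K\<close> when \<open>\<rho>\<close> is close to
  \<open>1\<close>.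
\<close>

lemma dilation_inside:
  fixes K :: "(complex ^ 'n::finite) set"
  assumes K: "compact K" "absolutely_convex K" and U: "open U" "(+) p ` K \<subseteq> U"
  obtains \<rho> where "1 < \<rho>" "\<And>x t. x \<in> K \<Longrightarrow> cmod t \<le> \<rho> \<Longrightarrow> p + t *s x \<in> U"
proof -
  have "compact ((+) p ` K)" using K(1) by (rule compact_translation)
  then obtain e where e: "0 < e" "(\<Union>z\<in>(+) p ` K. ball z e) \<subseteq> U"
    using compact_subset_open_imp_ball_epsilon_subset[OF _ U] by blast
  obtain b where b: "0 < b" "\<And>y. y \<in> K \<Longrightarrow> norm y \<le> b"
    using compact_imp_bounded[OF K(1)] bounded_pos by metis
  define \<rho> where "\<rho> = 1 + e / (2 * b)"
  have \<rho>: "1 < \<rho>" using e b by (simp add: \<rho>_def)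
  have "p + t *s x \<in> U" if x: "x \<in> K" and t: "cmod t \<le> \<rho>" for x t
  proof -
    define y where "y = (t / of_real \<rho>) *s x"
    have y: "y \<in> K" unfolding y_def
      using t \<rho> by (intro absolutely_convex_balanced[OF K(2) x]) (simp add: norm_divide)
    have "t *s x = \<rho> *\<^sub>R y" unfolding y_def scaleR_eq_scalar_mult using \<rho> by simp
    also have "\<dots> = y + (e / (2 * b)) *\<^sub>R y" by (simp add: \<rho>_def scaleR_add_left)
    finally have eq: "p + t *s x = (p + y) + (e / (2 * b)) *\<^sub>R y" by simp
    have "norm ((e / (2 * b)) *\<^sub>R y) \<le> e / (2 * b) * b" using b(2)[OF y] e b(1) by (simp add: mult_left_mono del: times_divide_eq_left)
    also have "\<dots> < e" using e b by simp
    finally have "p + t *s x \<in> ball (p + y) e" unfolding eq by (simp add: dist_norm)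
    then show ?thesis using e(2) y by blast
  qed
  then show thesis using that \<rho> by blast
qed

section \<open>Estimates for the approximate coordinate\<close>

lemma exp_trunc_norm: "cmod (exp_trunc n y) \<le> exp (cmod y)"
proof -
  have "cmod (exp_trunc n y) \<le> (\<Sum>k<n. cmod y ^ k / fact k)"
    unfolding exp_trunc_def by (rule sum_norm_le) (simp add: norm_divide norm_power)
  then show ?thesis using exp_trunc_real_le[of "cmod y" n] by simp
qed

lemma exp_trunc_error: "cmod (exp_trunc n y - exp y) \<le> cmod y ^ n / fact n * exp (cmod y)"
proof -
  have s: "(\<lambda>k. x ^ k / fact k) sums exp x" for x :: "'a::{real_normed_field, banach}"
    using exp_converges[of x] by (simp add: scaleR_conv_of_real field_simps)
  have 1: "(\<lambda>k. y ^ (k + n) / fact (k + n)) sums (exp y - exp_trunc n y)"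
    unfolding exp_trunc_def by (rule sums_split_initial_segment[OF s])
  have 2: "(\<lambda>k. cmod y ^ n / fact n * (cmod y ^ k / fact k)) sums (cmod y ^ n / fact n * exp (cmod y))"
    by (rule sums_mult[OF s])
  have "cmod (exp y - exp_trunc n y) \<le> cmod y ^ n / fact n * exp (cmod y)"
  proof (rule norm_sums_le[OF 1 2])
    fix k
    have "(fact n * fact k :: nat) \<le> fact (k + n)"
      using dvd_imp_le[OF fact_fact_dvd_fact[of n k]] by (simp add: add.commute)
    then have "(fact n * fact k :: real) \<le> fact (k + n)" by (metis of_nat_fact of_nat_le_iff of_nat_mult)
    then have "cmod y ^ (k + n) / fact (k + n) \<le> cmod y ^ (k + n) / (fact n * fact k)"
      by (intro divide_left_mono) auto
    then show "cmod (y ^ (k + n) / fact (k + n)) \<le> cmod y ^ n / fact n * (cmod y ^ k / fact k)"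
      by (simp add: norm_divide norm_mult norm_power power_add mult_ac)
  qed
  then show ?thesis by (simp add: norm_minus_commute)
qed

lemma exp_norm_le: "cmod (exp z) \<le> exp (cmod z)"
  using complex_Re_le_cmod by simp

lemma herm_pairing_norm: "cmod (herm_pairing q w) \<le> norm q * norm w"
proof -
  have "cmod (herm_pairing q w) \<le> (\<Sum>k\<in>UNIV. \<bar>cmod (q $ k)\<bar> * \<bar>cmod (w $ k)\<bar>)"
    unfolding herm_pairing_def by (rule sum_norm_le) (simp add: norm_mult)
  also have "\<dots> \<le> norm q * norm w" unfolding norm_vec_def by (rule L2_set_mult_ineq)
  finally show ?thesis .
qed

lemma norm_component_le: "cmod (v $ i) \<le> norm (v :: complex ^ 'n::finite)"
  by (rule Finite_Cartesian_Product.norm_nth_le)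

text \<open>
  The point is that the bound does not depend on \<open>m\<close>.
\<close>

lemma coord_approx_norm:
  fixes q w :: "complex ^ 'n::finite"
  assumes "norm w \<le> W"
  shows "cmod (coord_approx m q i w) \<le> exp (2 * (norm q * (W + norm q))) * (2 * norm q + W)"
proof -
  define x where "x = herm_pairing q (w - q)"
  let ?X = "norm q * (W + norm q)"
  have "cmod x \<le> norm q * norm (w - q)" unfolding x_def by (rule herm_pairing_norm)
  also have "\<dots> \<le> ?X" using norm_triangle_ineq4[of w q] assms by (intro mult_left_mono) auto
  finally have x: "cmod x \<le> ?X" .
  have ex: "cmod (exp x) \<le> exp ?X" by (rule order_trans[OF exp_norm_le]) (use x in simp)
  have tr: "cmod (exp_trunc k (- x)) \<le> exp ?X" for k
    by (rule order_trans[OF exp_trunc_norm]) (use x in simp)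
  have "cmod (w $ i - q $ i) \<le> norm w + norm q"
    using norm_component_le[of "w - q" i] norm_triangle_ineq4[of w q] by simp
  then have wq: "cmod (w $ i - q $ i) \<le> norm q + W" using assms by linarith
  have "cmod (q $ i * exp_trunc (Suc m) (- x) + (w $ i - q $ i) * exp_trunc m (- x))
    \<le> norm q * exp ?X + (norm q + W) * exp ?X"
    using wq by (intro norm_triangle_le add_mono)
      (auto simp: norm_mult intro!: mult_mono tr norm_component_le intro: order_trans[OF norm_ge_zero])
  then have "cmod (coord_approx m q i w) \<le> exp ?X * (norm q * exp ?X + (norm q + W) * exp ?X)"
    unfolding coord_approx_def Let_def x_def[symmetric] norm_mult by (intro mult_mono ex) auto
  also have "\<dots> = exp (2 * ?X) * (2 * norm q + W)" unfolding exp_double power2_eq_square by (simp add: algebra_simps)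
  finally show ?thesis .
qed

text \<open>
  The exponent \<open>x = q\<^sup>* (w - q)\<close> is at most \<open>B R\<close> with \<open>B = norm q * A\<close>, so the truncation errors are at most
  \<open>(B R) ^ k / fact k * exp B\<close> with \<open>k \<ge> m\<close>, and \<open>B ^ k / fact k \<le> exp B\<close> uniformly in \<open>k\<close>.
\<close>

lemma coord_approx_error:
  fixes q w :: "complex ^ 'n::finite"
  assumes wq: "norm (w - q) \<le> A * R" and R: "0 \<le> R" "R \<le> 1" and A: "0 \<le> A"
  shows "cmod (coord_approx m q i w - w $ i) \<le> exp (3 * (norm q * A)) * (norm q + A) * R ^ m"
proof -
  define x where "x = herm_pairing q (w - q)"
  let ?B = "norm q * A"
  have B: "0 \<le> ?B" using A by simp
  have "cmod x \<le> norm q * norm (w - q)" unfolding x_def by (rule herm_pairing_norm)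
  also have "\<dots> \<le> norm q * (A * R)" using wq by (intro mult_left_mono) auto
  finally have x: "cmod x \<le> ?B * R" by (simp add: mult_ac)
  have "?B * R \<le> ?B * 1" using R B by (intro mult_left_mono) auto
  then have xB: "cmod x \<le> ?B" using x by simp
  have err: "cmod (exp_trunc k (- x) - exp (- x)) \<le> exp (2 * ?B) * R ^ m" if "m \<le> k" for k
  proof -
    have pk: "?B ^ k / fact k \<le> exp ?B"
      using exp_trunc_real_le[OF B, of "Suc k"] sum_nonneg[of "{..<k}" "\<lambda>k. ?B ^ k / fact k"] B by simp
    have "cmod (exp_trunc k (- x) - exp (- x)) \<le> cmod x ^ k / fact k * exp (cmod x)"
      using exp_trunc_error[of k "- x"] by simp
    also have "\<dots> \<le> (?B * R) ^ k / fact k * exp ?B"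
      using x xB A R(1) by (intro mult_mono divide_right_mono power_mono) auto
    also have "\<dots> = (?B ^ k / fact k) * R ^ k * exp ?B" by (simp add: power_mult_distrib)
    also have "\<dots> \<le> exp ?B * R ^ m * exp ?B"
      using pk R that by (intro mult_right_mono mult_mono power_decreasing) auto
    finally show ?thesis unfolding exp_double power2_eq_square by (simp add: mult_ac)
  qed
  have "exp x * exp (- x) = 1" by (simp flip: exp_add)
  then have "coord_approx m q i w - w $ i
    = exp x * (q $ i * (exp_trunc (Suc m) (- x) - exp (- x)) + (w $ i - q $ i) * (exp_trunc m (- x) - exp (- x)))"
    unfolding coord_approx_def Let_def x_def[symmetric] by (simp add: algebra_simps)
  also have "cmod \<dots> \<le> exp ?B * (norm q * (exp (2 * ?B) * R ^ m) + A * (exp (2 * ?B) * R ^ m))"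
  proof -
    have "cmod (exp x) \<le> exp ?B" by (rule order_trans[OF exp_norm_le]) (use xB in simp)
    moreover have "cmod (w $ i - q $ i) \<le> A"
      using norm_component_le[of "w - q" i] wq mult_left_mono[OF R(2) A] by simp
    ultimately show ?thesis unfolding norm_mult using R A
      by (intro mult_mono norm_triangle_le add_mono)
        (auto simp: norm_mult intro!: mult_mono err norm_component_le)
  qed
  also have "\<dots> = exp (?B + 2 * ?B) * (norm q + A) * R ^ m" unfolding exp_add by (simp add: algebra_simps)
  also have "?B + 2 * ?B = 3 * ?B" by simp
  finally show ?thesis .
qed

section \<open>Holomorphic maps along complex lines\<close>

text \<open>
  Chain rule; complex linearity of the derivative \<open>L\<close> turns \<open>h \<mapsto> L (h b)\<close> into multiplication by \<open>L b\<close>.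
\<close>

lemma holomorphic_map_line:
  fixes g :: "complex ^ 'd::finite \<Rightarrow> complex ^ 'r::finite"
  assumes g: "holomorphic_map_on g U" and S: "open S" and in_U: "\<And>s. s \<in> S \<Longrightarrow> p + (a + s *s b) \<in> U"
  shows "(\<lambda>s. g (p + (a + s *s b)) $ j) holomorphic_on S"
  unfolding holomorphic_on_open[OF S]
proof
  fix s assume "s \<in> S"
  then obtain L where L: "(g has_derivative L) (at (p + (a + s *s b)))" "Vector_Spaces.linear (*s) (*s) L"
    using g in_U unfolding holomorphic_map_on_def by blast
  have "linear (\<lambda>s. s *s b)"
    by (rule linearI) (auto simp: Finite_Cartesian_Product.vec_eq_iff algebra_simps)
  then have bl: "bounded_linear (\<lambda>s. s *s b)" by (simp add: linear_conv_bounded_linear)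
  have "((\<lambda>s. p + (a + s *s b)) has_derivative (\<lambda>h. h *s b)) (at s)"
    by (rule derivative_eq_intros bounded_linear_imp_has_derivative[OF bl] refl)+ simp
  from has_derivative_compose[OF this L(1)]
  have "((\<lambda>s. g (p + (a + s *s b))) has_derivative (\<lambda>h. L (h *s b))) (at s)" .
  then have "((\<lambda>s. g (p + (a + s *s b)) $ j) has_derivative (\<lambda>h. L (h *s b) $ j)) (at s)"
    by (rule bounded_linear.has_derivative[OF bounded_linear_vec_nth])
  moreover have "(\<lambda>h. L (h *s b) $ j) = (*) (L b $ j)"
  proof -
    have "L (h *s b) = h *s L b" for h
      using L(2) unfolding Vector_Spaces.linear_def by (blast intro: module_hom.scale)
    then show ?thesis by (auto simp: mult.commute)
  qed
  ultimately have "((\<lambda>s. g (p + (a + s *s b)) $ j) has_field_derivative (L b $ j)) (at s)"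
    by (simp add: has_field_derivative_def)
  then show "\<exists>f'. ((\<lambda>s. g (p + (a + s *s b)) $ j) has_field_derivative f') (at s)" by blast
qed

lemma exp_trunc_holomorphic [holomorphic_intros]:
  assumes "h holomorphic_on S"
  shows "(\<lambda>s. exp_trunc n (h s)) holomorphic_on S"
  unfolding exp_trunc_def using assms by (intro holomorphic_intros) auto

section \<open>The error of one coordinate\<close>

lemma fock_fun_factor:
  "fock_fun \<alpha> p j (p + x) = complex_of_real (exp (- (norm p)\<^sup>2 / 2) / sqrt (real (mi_fact (\<alpha> j))))
     * exp (herm_pairing p (p + x)) * mi_power x (\<alpha> j)"
  by (simp add: fock_fun_def herm_pairing_def)

lemma norm_exp_herm_pairing:
  assumes "norm z \<le> P"
  shows "exp (- (norm p * P)) \<le> cmod (exp (herm_pairing p z))" "cmod (exp (herm_pairing p z)) \<le> exp (norm p * P)"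
proof -
  have "cmod (herm_pairing p z) \<le> norm p * P"
    by (rule order_trans[OF herm_pairing_norm]) (use assms in \<open>intro mult_left_mono, auto\<close>)
  then have "\<bar>Re (herm_pairing p z)\<bar> \<le> norm p * P" using abs_Re_le_cmod order_trans by blast
  then show "exp (- (norm p * P)) \<le> cmod (exp (herm_pairing p z))" "cmod (exp (herm_pairing p z)) \<le> exp (norm p * P)"
    by auto
qed

text \<open>
  The Cauchy-Schwarz inequality for \<open>b\<^sub>j * sqrt (\<alpha>\<^sub>j!)\<close> and \<open>x\<^sup>\<alpha> / sqrt (\<alpha>\<^sub>j!)\<close>, with \<open>\<alpha>! \<le> fact m\<close> in degree at most
  \<open>m\<close>. The sum of squares on the right runs up to degree \<open>n\<close> because that is what the least squares bound controls.
\<close>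

lemma truncated_poly_bound:
  fixes \<alpha> :: "nat \<Rightarrow> nat ^ 'n::{finite,linorder}"
  assumes \<alpha>: "mi_numbering \<alpha>" and mn: "m \<le> n" and x: "norm x \<le> X"
  shows "cmod (mi_poly \<alpha> (poly_dim TYPE('n) m) b x)
    \<le> sqrt (fact m * (\<Sum>j<poly_dim TYPE('n) n. (cmod (b j))\<^sup>2)) * exp (X\<^sup>2)"
proof -
  let ?R = "poly_dim TYPE('n)"
  let ?s = "\<lambda>j. sqrt (real (mi_fact (\<alpha> j)))"
  have s: "0 < ?s j" for j by simp
  have deg: "mi_deg (\<alpha> j) \<le> m" if "j < ?R m" for j
    using mi_numbering_image[OF \<alpha>, of m] that unfolding bij_betw_def by blast
  have "cmod (mi_poly \<alpha> (?R m) b x) \<le> (\<Sum>j<?R m. \<bar>cmod (b j) * ?s j\<bar> * \<bar>cmod (mi_power x (\<alpha> j)) / ?s j\<bar>)"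
    unfolding mi_poly_def by (rule sum_norm_le) (simp add: norm_mult abs_mult)
  also have "\<dots> \<le> L2_set (\<lambda>j. cmod (b j) * ?s j) {..<?R m} * L2_set (\<lambda>j. cmod (mi_power x (\<alpha> j)) / ?s j) {..<?R m}"
    by (rule L2_set_mult_ineq)
  also have "\<dots> \<le> sqrt (fact m * (\<Sum>j<?R n. (cmod (b j))\<^sup>2)) * exp (X\<^sup>2)"
  proof (rule mult_mono)
    have "(\<Sum>j<?R m. (cmod (b j) * ?s j)\<^sup>2) \<le> (\<Sum>j<?R m. fact m * (cmod (b j))\<^sup>2)"
    proof (rule sum_mono)
      fix j assume "j \<in> {..<?R m}"
      then have "mi_fact (\<alpha> j) \<le> fact m"
        using mi_fact_le[of "\<alpha> j"] fact_mono_nat[OF deg[of j]] by (simp add: le_trans)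
      then have "real (mi_fact (\<alpha> j)) \<le> fact m" by (metis of_nat_fact of_nat_le_iff)
      then show "(cmod (b j) * ?s j)\<^sup>2 \<le> fact m * (cmod (b j))\<^sup>2"
        by (simp add: power_mult_distrib mult.commute mult_right_mono)
    qed
    also have "\<dots> \<le> (\<Sum>j<?R n. fact m * (cmod (b j))\<^sup>2)"
      using poly_dim_mono[OF mn, where 'n = 'n] by (intro sum_mono2) auto
    finally show "L2_set (\<lambda>j. cmod (b j) * ?s j) {..<?R m} \<le> sqrt (fact m * (\<Sum>j<?R n. (cmod (b j))\<^sup>2))"
      unfolding L2_set_def by (simp add: sum_distrib_left)
    have "(\<Sum>j<?R m. (cmod (mi_power x (\<alpha> j)) / ?s j)\<^sup>2) = (\<Sum>j<?R m. (cmod (mi_power x (\<alpha> j)))\<^sup>2 / real (mi_fact (\<alpha> j)))"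
      by (simp add: power_divide)
    also have "\<dots> = (\<Sum>a | mi_deg a \<le> m. (cmod (mi_power x a))\<^sup>2 / real (mi_fact a))"
      by (rule sum_mi_numbering[OF \<alpha>])
    also have "\<dots> \<le> exp ((norm x)\<^sup>2)" by (rule sum_mi_power_sq_le)
    also have "\<dots> \<le> exp (X\<^sup>2)" using x by (simp add: power_mono)
    also have "\<dots> \<le> (exp (X\<^sup>2))\<^sup>2" by (simp add: power2_eq_square)
    finally show "L2_set (\<lambda>j. cmod (mi_power x (\<alpha> j)) / ?s j) {..<?R m} \<le> exp (X\<^sup>2)"
      unfolding L2_set_def by (intro real_le_lsqrt) auto
  qed (auto intro!: sum_nonneg mult_nonneg_nonneg)
  finally show ?thesis .
qed

text \<open>
  The scaled functions \<open>\<kappa> j * \<omega> * x\<^sup>\<alpha>\<close> stand for the \<open>u\<^bsub>p,j\<^esub>\<close>, and \<open>t\<close> for any reference polynomial. Subtracting the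
  reference and testing the normal equations against \<open>b\<close> gives the orthogonality that
  \<open>weighted_least_squares_bound\<close> asks for.
\<close>

lemma weighted_normal_equations:
  fixes \<alpha> :: "nat \<Rightarrow> nat ^ 'n::finite" and t G :: "nat \<Rightarrow> complex"
  assumes ne: "\<And>j. j < R \<Longrightarrow> (\<Sum>l<N. cnj (\<kappa> j * \<omega> l * mi_power (x l) (\<alpha> j)) *
      ((\<Sum>k<R. \<kappa> k * \<omega> l * mi_power (x l) (\<alpha> k) * c k) - \<omega> l * G l)) = 0"
    and \<kappa>: "\<And>j. \<kappa> j \<noteq> 0"
  defines "b \<equiv> \<lambda>j. \<kappa> j * c j - t j"
  shows "(\<Sum>l<N. complex_of_real ((cmod (\<omega> l))\<^sup>2) * cnj (mi_poly \<alpha> R b (x l)) *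
      (mi_poly \<alpha> R b (x l) - (G l - mi_poly \<alpha> R t (x l)))) = 0"
proof -
  let ?B = "\<lambda>l. mi_poly \<alpha> R b (x l)" and ?e = "\<lambda>l. G l - mi_poly \<alpha> R t (x l)"
  have B: "\<omega> l * (?B l - ?e l) = (\<Sum>k<R. \<kappa> k * \<omega> l * mi_power (x l) (\<alpha> k) * c k) - \<omega> l * G l" for l
    by (simp add: mi_poly_def b_def algebra_simps sum_subtractf sum_distrib_left)
  have z: "(\<Sum>l<N. complex_of_real ((cmod (\<omega> l))\<^sup>2) * cnj (mi_power (x l) (\<alpha> j)) * (?B l - ?e l)) = 0"
    if j: "j < R" for j
  proof -
    have "cnj (\<kappa> j) * (\<Sum>l<N. complex_of_real ((cmod (\<omega> l))\<^sup>2) * cnj (mi_power (x l) (\<alpha> j)) * (?B l - ?e l))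
      = (\<Sum>l<N. cnj (\<kappa> j * \<omega> l * mi_power (x l) (\<alpha> j)) * (\<omega> l * (?B l - ?e l)))"
      unfolding sum_distrib_left complex_norm_square by (intro sum.cong) (auto simp: mult_ac)
    also have "\<dots> = 0" unfolding B by (rule ne[OF j])
    finally show ?thesis using \<kappa>[of j] by simp
  qed
  have "(\<Sum>l<N. complex_of_real ((cmod (\<omega> l))\<^sup>2) * cnj (?B l) * (?B l - ?e l))
    = (\<Sum>l<N. \<Sum>j<R. cnj (b j) * (complex_of_real ((cmod (\<omega> l))\<^sup>2) * cnj (mi_power (x l) (\<alpha> j)) * (?B l - ?e l)))"
  proof (rule sum.cong[OF refl])
    fix l
    have "cnj (?B l) = (\<Sum>j<R. cnj (b j) * cnj (mi_power (x l) (\<alpha> j)))" by (simp add: mi_poly_def)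
    then show "complex_of_real ((cmod (\<omega> l))\<^sup>2) * cnj (?B l) * (?B l - ?e l)
      = (\<Sum>j<R. cnj (b j) * (complex_of_real ((cmod (\<omega> l))\<^sup>2) * cnj (mi_power (x l) (\<alpha> j)) * (?B l - ?e l)))"
      by (simp only: sum_distrib_left sum_distrib_right mult_ac)
  qed
  also have "\<dots> = (\<Sum>j<R. cnj (b j) * (\<Sum>l<N. complex_of_real ((cmod (\<omega> l))\<^sup>2) * cnj (mi_power (x l) (\<alpha> j)) * (?B l - ?e l)))"
    unfolding sum_distrib_left by (rule sum.swap)
  also have "\<dots> = 0" by (intro sum.neutral ballI) (simp only: z lessThan_iff mult_zero_right)
  finally show ?thesis .
qed

text \<open>
  The scales \<open>R\<close> and \<open>R1\<close> stand for the gauges of the data and of the point of evaluation, and \<open>\<Lambda>\<close> for the smallest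
  eigenvalue. The constant is quantified before all of them; it depends on \<open>p\<close>, \<open>f\<close> and \<open>K\<close> only.
\<close>

lemma coordinate_error:
  fixes p :: "complex ^ 'd::{finite,linorder}"
    and f :: "complex ^ 'd::_ \<Rightarrow> complex ^ 'r::{finite,linorder}"
    and K :: "(complex ^ 'd::_) set"
  assumes K: "compact K" "absolutely_convex K" "0 \<in> interior K"
    and f: "analytic_map_on f ((+) p ` K)"
  obtains C where "0 \<le> C"
    "\<And>(\<alpha> :: nat \<Rightarrow> nat ^ 'd::_) (\<beta> :: nat \<Rightarrow> nat ^ 'r::_) m n N x0 \<Lambda> \<gamma> R R1 x i.
      mi_numbering \<alpha> \<Longrightarrow> mi_numbering \<beta> \<Longrightarrow> m \<le> n \<Longrightarrow> 1 \<le> N \<Longrightarrow> 0 < \<gamma> \<Longrightarrow> 0 < \<Lambda> \<Longrightarrow>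
      0 \<le> R \<Longrightarrow> R \<le> 1 \<Longrightarrow> 0 \<le> R1 \<Longrightarrow> R1 \<le> 1 \<Longrightarrow>
      (\<And>l. l < N \<Longrightarrow> \<exists>y\<in>K. x0 l = R *\<^sub>R y) \<Longrightarrow> (\<exists>y\<in>K. x = R1 *\<^sub>R y) \<Longrightarrow>
      (\<And>a. \<gamma> * \<Lambda> * (\<Sum>j<poly_dim TYPE('d) n. (cmod (a j))\<^sup>2)
        \<le> (\<Sum>l<N. (cmod (mi_poly \<alpha> (poly_dim TYPE('d) n) a (x0 l)))\<^sup>2) / real N) \<Longrightarrow>
      cmod (f_hat \<alpha> \<beta> f p m n N (\<lambda>l. p + x0 l) (p + x) $ i - f (p + x) $ i)
        \<le> C * (sqrt (fact m / \<gamma>) * (R ^ n / sqrt \<Lambda>) + R1 ^ m)"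
proof -
  obtain U g where U: "open U" "(+) p ` K \<subseteq> U" and g: "holomorphic_map_on g U"
    and fg: "\<And>x. x \<in> K \<Longrightarrow> f (p + x) = g (p + x)"
    using f unfolding analytic_map_on_def by blast
  obtain \<rho> where \<rho>: "1 < \<rho>" and dil: "\<And>x t. x \<in> K \<Longrightarrow> cmod t \<le> \<rho> \<Longrightarrow> p + t *s x \<in> U"
    using dilation_inside[OF K(1,2) U] by metis
  define V where "V = {x. p + x \<in> U}"
  have openV: "open V"
    using open_vimage[OF U(1), of "\<lambda>x. p + x"] by (simp add: V_def vimage_def continuous_intros)
  have K0: "0 \<in> K" using K(3) interior_subset by blast
  have bal: "t *s x \<in> K" if "x \<in> K" "cmod t \<le> 1" for x t
    using absolutely_convex_balanced[OF K(2) that] .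
  have balR: "s *\<^sub>R y \<in> K" if "y \<in> K" "0 \<le> s" "s \<le> 1" for s y
    using bal[OF that(1), of "of_real s"] that by (simp add: scaleR_eq_scalar_mult)
  define q where "q = f p"
  have q: "q = g p" using fg[OF K0] by (simp add: q_def)
  define T where "T = (\<lambda>(t, x). p + t *s x) ` (cball (0::complex) \<rho> \<times> K)"
  have cT: "compact T"
    unfolding T_def
    by (intro compact_continuous_image compact_Times compact_cball K(1))
      (auto simp: case_prod_unfold vector_scalar_mult_def intro!: continuous_intros)
  have TU: "T \<subseteq> U" using dil by (auto simp: T_def)
  have T_mem: "p + t *s x \<in> T" if "x \<in> K" "cmod t \<le> \<rho>" for t x
    using that by (force simp: T_def)
  have cont_g: "continuous_on T g"
  proof (rule continuous_on_subset[OF _ TU], rule differentiable_imp_continuous_on)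
    show "g differentiable_on U"
      using g unfolding holomorphic_map_on_def differentiable_on_def differentiable_def
      by (meson has_derivative_at_withinI)
  qed
  obtain W where W: "\<And>z. z \<in> T \<Longrightarrow> norm (g z) \<le> W"
    using compact_imp_bounded[OF compact_continuous_image[OF cont_g cT]] by (auto simp: bounded_iff)
  obtain P where P: "\<And>z. z \<in> T \<Longrightarrow> norm z \<le> P"
    using compact_imp_bounded[OF cT] by (auto simp: bounded_iff)
  obtain X where X: "\<And>x. x \<in> K \<Longrightarrow> norm x \<le> X"
    using compact_imp_bounded[OF K(1)] by (auto simp: bounded_iff)
  have pK: "p + x \<in> T" if "x \<in> K" for x using T_mem[OF that, of 1] \<rho> by simp
  have W0: "0 \<le> W" using W[OF pK[OF K0]] norm_ge_zero order_trans by blast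
  have P0: "0 \<le> P" using P[OF pK[OF K0]] norm_ge_zero order_trans by blast

  have holo: "(\<lambda>s. g (p + (a + s *s b)) $ j) holomorphic_on S" if "open S" "\<And>s. s \<in> S \<Longrightarrow> a + s *s b \<in> V" for a b S j
    by (rule holomorphic_map_line[OF g that(1)]) (use that(2) in \<open>simp add: V_def\<close>)
  \<comment> \<open>The degree \<open>0\<close> Taylor remainder of the coordinates of \<open>f\<close> yields the Lipschitz bound \<open>lip\<close> below.\<close>
  have lineF: "line_holomorphic K V (\<lambda>x. g (p + x) $ j) \<rho> W" for j
  proof
    show "cmod (g (p + t *s x) $ j) \<le> W" if "x \<in> K" "cmod t \<le> \<rho>" for x t
      using norm_component_le[of "g (p + t *s x)" j] W[OF T_mem[OF that]] by linarith
  qed (use K(3) bal openV dil \<rho> holo in \<open>auto simp: V_def\<close>)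
  define A where "A = real CARD('r) * (W / (\<rho> - 1))"
  have A0: "0 \<le> A" using W0 \<rho> by (simp add: A_def)
  have lip: "norm (g (p + s *\<^sub>R y) - q) \<le> A * s" if y: "y \<in> K" and s: "0 \<le> s" "s \<le> 1" for s y
  proof -
    have "cmod ((g (p + s *\<^sub>R y) - q) $ j) \<le> W / (\<rho> - 1) * s" for j
      using line_holomorphic.hom_part_tail[OF lineF y s, of j 0] line_holomorphic.hom_part_def[OF lineF, of j 0 y] q by simp
    then have "(\<Sum>j\<in>UNIV. cmod ((g (p + s *\<^sub>R y) - q) $ j)) \<le> (\<Sum>j\<in>(UNIV :: 'r set). W / (\<rho> - 1) * s)"
      by (intro sum_mono)
    moreover have "norm (g (p + s *\<^sub>R y) - q) \<le> (\<Sum>j\<in>UNIV. cmod ((g (p + s *\<^sub>R y) - q) $ j))"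
      unfolding norm_vec_def by (rule L2_set_le_sum) auto
    ultimately show ?thesis by (simp add: A_def)
  qed

  \<comment> \<open>Removing the factor \<open>exp (p\<^sup>* z)\<close> common to the \<open>u\<^bsub>p,j\<^esub>\<close> leaves the function that is fitted by polynomials.\<close>
  define G where "G i m x = exp (- herm_pairing p (p + x)) * coord_approx m q i (g (p + x))" for i m x
  define M where "M = exp (norm p * P) * (exp (2 * (norm q * (W + norm q))) * (2 * norm q + W))"
  have lineG: "line_holomorphic K V (G i m) \<rho> M" for i m
  proof
    show "cmod (G i m (t *s x)) \<le> M" if "x \<in> K" "cmod t \<le> \<rho>" for x t
    proof -
      have "cmod (exp (- herm_pairing p (p + t *s x))) \<le> exp (norm p * P)"
      proof (rule order_trans[OF exp_norm_le])
        have "cmod (herm_pairing p (p + t *s x)) \<le> norm p * P"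
          by (rule order_trans[OF herm_pairing_norm]) (intro mult_left_mono P T_mem that norm_ge_zero)
        then show "exp (cmod (- herm_pairing p (p + t *s x))) \<le> exp (norm p * P)" by simp
      qed
      then show ?thesis unfolding G_def M_def norm_mult
        by (intro mult_mono coord_approx_norm W T_mem that) auto
    qed
    show "(\<lambda>s. G i m (a + s *s b)) holomorphic_on S" if "open S" "\<And>s. s \<in> S \<Longrightarrow> a + s *s b \<in> V" for a b S
      unfolding G_def coord_approx_def Let_def herm_pairing_def
        vector_add_component vector_minus_component vector_smult_component
      by (intro holomorphic_intros holo that)
  qed (use K(3) bal openV dil \<rho> in \<open>auto simp: V_def\<close>)
  define D where "D = M / (\<rho> - 1)"
  have M0: "0 \<le> M" using W0 by (simp add: M_def)
  have D0: "0 \<le> D" using M0 \<rho> by (simp add: D_def)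

  \<comment> \<open>The factor \<open>\<bar>exp (p\<^sup>* z)\<bar>\<close> lies between \<open>1 / w\<close> and \<open>w\<close> on \<open>p + K\<close>.\<close>
  define w where "w = exp (norm p * P)"
  have w0: "0 < w" by (simp add: w_def)
  define C1 where "C1 = w * (exp (X\<^sup>2) * (w\<^sup>2 * D))"
  define C2 where "C2 = w * D + exp (3 * (norm q * A)) * (norm q + A)"
  define C where "C = C1 + C2"
  have C1: "0 \<le> C1" and C2: "0 \<le> C2" using D0 A0 w0 by (simp_all add: C1_def C2_def)
  have main: "cmod (f_hat \<alpha> \<beta> f p m n N (\<lambda>l. p + x0 l) (p + x) $ i - f (p + x) $ i)
        \<le> C * (sqrt (fact m / \<gamma>) * (R ^ n / sqrt \<Lambda>) + R1 ^ m)"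
    if \<alpha>: "mi_numbering \<alpha>" and \<beta>: "mi_numbering \<beta>" and mn: "m \<le> n" and N: "1 \<le> N"
      and \<gamma>: "0 < \<gamma>" and \<Lambda>: "0 < \<Lambda>" and R: "0 \<le> R" "R \<le> 1" and R1: "0 \<le> R1" "R1 \<le> 1"
      and x0: "\<And>l. l < N \<Longrightarrow> \<exists>y\<in>K. x0 l = R *\<^sub>R y" and x: "\<exists>y\<in>K. x = R1 *\<^sub>R y"
      and lower: "\<And>a. \<gamma> * \<Lambda> * (\<Sum>j<poly_dim TYPE('d) n. (cmod (a j))\<^sup>2)
        \<le> (\<Sum>l<N. (cmod (mi_poly \<alpha> (poly_dim TYPE('d) n) a (x0 l)))\<^sup>2) / real N"
    for \<alpha> :: "nat \<Rightarrow> nat ^ 'd::_" and \<beta> :: "nat \<Rightarrow> nat ^ 'r::_" and m n N x0 \<Lambda> \<gamma> R R1 x i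
  proof -
    let ?Rm = "poly_dim TYPE('d) m" and ?Rn = "poly_dim TYPE('d) n"
    define \<kappa> where "\<kappa> j = complex_of_real (exp (- (norm p)\<^sup>2 / 2) / sqrt (real (mi_fact (\<alpha> j))))" for j
    define \<omega> where "\<omega> y = exp (herm_pairing p (p + y))" for y
    have \<kappa>: "\<kappa> j \<noteq> 0" for j by (simp add: \<kappa>_def)
    have fock: "fock_fun \<alpha> p j (p + y) = \<kappa> j * \<omega> y * mi_power y (\<alpha> j)" for j y
      by (simp only: fock_fun_factor \<kappa>_def \<omega>_def)
    have \<omega>_bounds: "inverse w \<le> cmod (\<omega> y)" "cmod (\<omega> y) \<le> w" if "y \<in> K" for y
      using norm_exp_herm_pairing[OF P[OF pK[OF that]]] by (simp_all add: \<omega>_def w_def exp_minus)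
    have \<omega>G: "\<omega> y * G i m y = coord_approx m q i (g (p + y))" for y
      by (simp add: \<omega>_def G_def exp_minus)
    have x0K: "x0 l \<in> K" if "l < N" for l using x0[OF that] balR R by auto
    have xK: "x \<in> K" using x balR R1 by auto

    obtain t :: "nat ^ 'd::_ \<Rightarrow> complex" where t: "\<And>y s k. y \<in> K \<Longrightarrow> 0 \<le> s \<Longrightarrow> s \<le> 1 \<Longrightarrow>
      cmod (G i m (s *\<^sub>R y) - (\<Sum>a | mi_deg a \<le> k. t a * mi_power (s *\<^sub>R y) a)) \<le> D * s ^ Suc k"
      using line_holomorphic.taylor_expansion[OF lineG[of i m], folded D_def] by blast
    define \<tau> where "\<tau> j = t (\<alpha> j)" for j
    have \<tau>: "mi_poly \<alpha> (poly_dim TYPE('d) k) \<tau> y = (\<Sum>a | mi_deg a \<le> k. t a * mi_power y a)" for k y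
      unfolding mi_poly_def \<tau>_def by (rule sum_mi_numbering[OF \<alpha>])
    have taylor: "cmod (G i m y - mi_poly \<alpha> (poly_dim TYPE('d) k) \<tau> y) \<le> D * s ^ k"
      if "\<exists>v\<in>K. y = s *\<^sub>R v" "0 \<le> s" "s \<le> 1" for y s k
    proof -
      obtain v where v: "v \<in> K" "y = s *\<^sub>R v" using \<open>\<exists>v\<in>K. y = s *\<^sub>R v\<close> by blast
      have "cmod (G i m y - mi_poly \<alpha> (poly_dim TYPE('d) k) \<tau> y) \<le> D * s ^ Suc k"
        unfolding \<tau> v(2) by (rule t[OF v(1) that(2,3)])
      also have "\<dots> \<le> D * s ^ k" using D0 that by (intro mult_left_mono power_decreasing) auto
      finally show ?thesis .
    qed

    have inj: "a j = 0" if a: "\<And>l. l < N \<Longrightarrow> (\<Sum>j<?Rn. fock_fun \<alpha> p j (p + x0 l) * a j) = 0" and j: "j < ?Rn" for a j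
    proof -
      have "mi_poly \<alpha> ?Rn (\<lambda>j. \<kappa> j * a j) (x0 l) = 0" if "l < N" for l
      proof -
        have "\<omega> (x0 l) * mi_poly \<alpha> ?Rn (\<lambda>j. \<kappa> j * a j) (x0 l) = 0"
          using a[OF that] by (simp add: mi_poly_def fock sum_distrib_left mult_ac)
        then show ?thesis by (simp add: \<omega>_def)
      qed
      then have "\<gamma> * \<Lambda> * (\<Sum>j<?Rn. (cmod (\<kappa> j * a j))\<^sup>2) \<le> 0"
        using lower[of "\<lambda>j. \<kappa> j * a j"] by simp
      then have "(\<Sum>j<?Rn. (cmod (\<kappa> j * a j))\<^sup>2) \<le> 0" using \<gamma> \<Lambda> by (simp add: mult_le_0_iff zero_less_mult_iff)
      then have "(\<Sum>j<?Rn. (cmod (\<kappa> j * a j))\<^sup>2) = 0" by (intro antisym sum_nonneg) auto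
      then have "\<forall>j\<in>{..<?Rn}. (cmod (\<kappa> j * a j))\<^sup>2 = 0" by (subst (asm) sum_nonneg_eq_0_iff) auto
      then have "(cmod (\<kappa> j * a j))\<^sup>2 = 0" using j by blast
      then show ?thesis using \<kappa>[of j] by simp
    qed
    obtain c where
      ne: "\<And>j. j < ?Rn \<Longrightarrow> (\<Sum>l<N. cnj (fock_fun \<alpha> p j (p + x0 l)) *
        ((\<Sum>k<?Rn. fock_fun \<alpha> p k (p + x0 l) * c k) - coord_approx m (f p) i (f (p + x0 l)))) = 0"
      and fh: "\<And>z. f_hat \<alpha> \<beta> f p m n N (\<lambda>l. p + x0 l) z $ i = (\<Sum>j<?Rm. fock_fun \<alpha> p j z * c j)"
      using f_hat_least_squares[OF \<beta> mn, of N \<alpha> p "\<lambda>l. p + x0 l" f i] inj by blast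
    \<comment> \<open>Fitted minus Taylor coefficients, as coefficients of monomials.\<close>
    define b where "b = (\<lambda>j. \<kappa> j * c j - \<tau> j)"
    have orth: "(\<Sum>l<N. complex_of_real ((cmod (\<omega> (x0 l)))\<^sup>2) * cnj (mi_poly \<alpha> ?Rn b (x0 l)) *
      (mi_poly \<alpha> ?Rn b (x0 l) - (G i m (x0 l) - mi_poly \<alpha> ?Rn \<tau> (x0 l)))) = 0"
      unfolding b_def
    proof (rule weighted_normal_equations)
      fix j assume j: "j < ?Rn"
      have "(\<Sum>l<N. cnj (\<kappa> j * \<omega> (x0 l) * mi_power (x0 l) (\<alpha> j)) *
          ((\<Sum>k<?Rn. \<kappa> k * \<omega> (x0 l) * mi_power (x0 l) (\<alpha> k) * c k) - \<omega> (x0 l) * G i m (x0 l)))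
        = (\<Sum>l<N. cnj (fock_fun \<alpha> p j (p + x0 l)) *
        ((\<Sum>k<?Rn. fock_fun \<alpha> p k (p + x0 l) * c k) - coord_approx m (f p) i (f (p + x0 l))))"
        by (intro sum.cong refl) (simp only: fock \<omega>G q_def fg[OF x0K] lessThan_iff)
      then show "(\<Sum>l<N. cnj (\<kappa> j * \<omega> (x0 l) * mi_power (x0 l) (\<alpha> j)) *
          ((\<Sum>k<?Rn. \<kappa> k * \<omega> (x0 l) * mi_power (x0 l) (\<alpha> k) * c k) - \<omega> (x0 l) * G i m (x0 l))) = 0"
        using ne[OF j] by simp
    qed (rule \<kappa>)
    define S where "S = (\<Sum>j<?Rn. (cmod (b j))\<^sup>2)"
    have S0: "0 \<le> S" by (simp add: S_def sum_nonneg)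
    have "(\<Sum>l<N. (cmod (mi_poly \<alpha> ?Rn b (x0 l)))\<^sup>2) / real N \<le> w\<^sup>2 / (inverse w)\<^sup>2 * (D * R ^ n)\<^sup>2"
    proof (rule weighted_least_squares_bound[OF orth])
      show "0 < (inverse w)\<^sup>2" using w0 by simp
      show "(inverse w)\<^sup>2 \<le> (cmod (\<omega> (x0 l)))\<^sup>2" "(cmod (\<omega> (x0 l)))\<^sup>2 \<le> w\<^sup>2" if "l < N" for l
        using \<omega>_bounds[OF x0K[OF that]] w0 by (auto intro!: power_mono)
      show "cmod (G i m (x0 l) - mi_poly \<alpha> ?Rn \<tau> (x0 l)) \<le> D * R ^ n" if "l < N" for l
        by (rule taylor[OF x0[OF that] R])
    qed (rule N)
    also have "\<dots> = (w\<^sup>2 * (D * R ^ n))\<^sup>2"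
      using w0 by (simp add: power_mult_distrib power_inverse field_simps)
    finally have "\<gamma> * \<Lambda> * S \<le> (w\<^sup>2 * (D * R ^ n))\<^sup>2" using lower[of b] unfolding S_def by linarith
    then have "S \<le> (w\<^sup>2 * (D * R ^ n))\<^sup>2 / (\<gamma> * \<Lambda>)" using \<gamma> \<Lambda> by (simp add: field_simps)
    then have sqS: "sqrt S \<le> w\<^sup>2 * (D * R ^ n) / (sqrt \<gamma> * sqrt \<Lambda>)"
      using real_sqrt_le_mono D0 R by (fastforce simp: real_sqrt_divide real_sqrt_mult)

    have e1: "cmod (mi_poly \<alpha> ?Rm b x) \<le> exp (X\<^sup>2) * (w\<^sup>2 * D) * (sqrt (fact m / \<gamma>) * (R ^ n / sqrt \<Lambda>))"
    proof -
      have "cmod (mi_poly \<alpha> ?Rm b x) \<le> sqrt (fact m * S) * exp (X\<^sup>2)"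
        unfolding S_def by (rule truncated_poly_bound[OF \<alpha> mn X[OF xK]])
      also have "\<dots> = sqrt (fact m) * sqrt S * exp (X\<^sup>2)" by (simp add: real_sqrt_mult)
      also have "\<dots> \<le> sqrt (fact m) * (w\<^sup>2 * (D * R ^ n) / (sqrt \<gamma> * sqrt \<Lambda>)) * exp (X\<^sup>2)"
        using sqS by (intro mult_right_mono mult_left_mono) auto
      also have "\<dots> = exp (X\<^sup>2) * (w\<^sup>2 * D) * (sqrt (fact m / \<gamma>) * (R ^ n / sqrt \<Lambda>))"
        by (simp add: real_sqrt_divide)
      finally show ?thesis .
    qed
    have e2: "cmod (mi_poly \<alpha> ?Rm \<tau> x - G i m x) \<le> D * R1 ^ m"
      using taylor[OF x R1, of m] by (simp add: norm_minus_commute)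
    have e3: "cmod (coord_approx m q i (g (p + x)) - g (p + x) $ i) \<le> exp (3 * (norm q * A)) * (norm q + A) * R1 ^ m"
    proof -
      obtain y where "y \<in> K" "x = R1 *\<^sub>R y" using x by blast
      then have "norm (g (p + x) - q) \<le> A * R1" using lip[OF _ R1] by simp
      then show ?thesis by (rule coord_approx_error[OF _ R1 A0])
    qed
    have "f_hat \<alpha> \<beta> f p m n N (\<lambda>l. p + x0 l) (p + x) $ i = \<omega> x * (mi_poly \<alpha> ?Rm b x + mi_poly \<alpha> ?Rm \<tau> x)"
      unfolding fh fock by (simp add: mi_poly_def b_def algebra_simps sum_subtractf sum_distrib_left)
    then have "f_hat \<alpha> \<beta> f p m n N (\<lambda>l. p + x0 l) (p + x) $ i - f (p + x) $ i
      = \<omega> x * (mi_poly \<alpha> ?Rm b x + (mi_poly \<alpha> ?Rm \<tau> x - G i m x)) + (coord_approx m q i (g (p + x)) - g (p + x) $ i)"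
      unfolding fg[OF xK] \<omega>G[symmetric] by (simp add: algebra_simps)
    also have "cmod \<dots> \<le> w * (exp (X\<^sup>2) * (w\<^sup>2 * D) * (sqrt (fact m / \<gamma>) * (R ^ n / sqrt \<Lambda>)) + D * R1 ^ m)
       + exp (3 * (norm q * A)) * (norm q + A) * R1 ^ m"
    proof (rule norm_triangle_le, rule add_mono[OF _ e3])
      show "cmod (\<omega> x * (mi_poly \<alpha> ?Rm b x + (mi_poly \<alpha> ?Rm \<tau> x - G i m x)))
        \<le> w * (exp (X\<^sup>2) * (w\<^sup>2 * D) * (sqrt (fact m / \<gamma>) * (R ^ n / sqrt \<Lambda>)) + D * R1 ^ m)"
        unfolding norm_mult using w0
        by (intro mult_mono \<omega>_bounds xK norm_triangle_le add_mono e1 e2) auto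
    qed
    also have "\<dots> = C1 * (sqrt (fact m / \<gamma>) * (R ^ n / sqrt \<Lambda>)) + C2 * R1 ^ m"
      by (simp add: C1_def C2_def algebra_simps)
    also have "\<dots> \<le> C * (sqrt (fact m / \<gamma>) * (R ^ n / sqrt \<Lambda>)) + C * R1 ^ m"
      using C1 C2 R R1 \<gamma> \<Lambda> unfolding C_def by (intro add_mono mult_right_mono) auto
    finally show ?thesis by (simp add: distrib_left)
  qed
  have "0 \<le> C" using C1 C2 by (simp add: C_def)
  then show thesis using that main by blast
qed

text \<open>
  The suprema of the gauge over the support of \<open>\<mu>\<close> and over \<open>K1\<close> lie in \<open>[0, 1]\<close>, and points of these sets are
  multiples of points of \<open>K0\<close> by these factors; it remains to add up the \<open>r\<close> coordinates.
\<close>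

theorem theorem5p1:
  fixes p :: "complex ^ 'd::{finite,linorder}"
    and f :: "complex ^ 'd::_ \<Rightarrow> complex ^ 'r::{finite,linorder}"
    and K0 K1 :: "(complex ^ 'd::_) set"
    and \<mu> :: "(complex ^ 'd::_) measure"
  assumes p_real: "\<forall>k. p $ k \<in> \<real>"
    and K0: "compact K0" "absolutely_convex K0" "0 \<in> interior K0"
    and f: "analytic_map_on f ((+) p ` K0)"
    and \<mu>: "sets \<mu> = sets borel" "prob_space \<mu>" "measure \<mu> K0 = 1" "msupport \<mu> \<subseteq> K0"
    and K1: "compact K1" "K1 \<subseteq> interior K0"
  shows "\<exists>C' :: real.
    \<forall>(\<alpha> :: nat \<Rightarrow> nat ^ 'd::_) (\<beta> :: nat \<Rightarrow> nat ^ 'r::_) (m :: nat) (n :: nat) (N :: nat)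
      (z0 :: nat \<Rightarrow> complex ^ 'd::_) (\<gamma> :: real).
      mi_numbering \<alpha> \<longrightarrow> mi_numbering \<beta> \<longrightarrow> m \<le> n \<longrightarrow> 1 \<le> N \<longrightarrow>
      (\<forall>i<N. z0 i \<in> msupport \<mu>) \<longrightarrow>
      invertible_mat (moment_matrix \<alpha> n \<mu>) \<longrightarrow>
      0 < \<gamma> \<longrightarrow> \<gamma> < 1 \<longrightarrow>
      mat_op_norm (1\<^sub>m (poly_dim TYPE('d) n)
        - mat_inv_sqrt (moment_matrix \<alpha> n \<mu>)
          * moment_matrix \<alpha> n (empirical_measure N z0)
          * mat_inv_sqrt (moment_matrix \<alpha> n \<mu>)) \<le> 1 - \<gamma> \<longrightarrow>
      (SUP z \<in> (+) p ` K1. ereal (norm (f_hat \<alpha> \<beta> f p m n N (\<lambda>i. p + z0 i) z - f z)))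
        \<le> ereal (C' *
            (sqrt (fact m / \<gamma>) *
               ((SUP x \<in> msupport \<mu>. gauge_norm K0 x) ^ n
                 / sqrt (min_eigenvalue (moment_matrix \<alpha> n \<mu>)))
             + (SUP z \<in> K1. gauge_norm K0 z) ^ m))"
proof -
  obtain C where C: "0 \<le> C" and err:
    "\<And>(\<alpha> :: nat \<Rightarrow> nat ^ 'd::_) (\<beta> :: nat \<Rightarrow> nat ^ 'r::_) m n N x0 \<Lambda> \<gamma> R R1 x i.
      mi_numbering \<alpha> \<Longrightarrow> mi_numbering \<beta> \<Longrightarrow> m \<le> n \<Longrightarrow> 1 \<le> N \<Longrightarrow> 0 < \<gamma> \<Longrightarrow> 0 < \<Lambda> \<Longrightarrow>
      0 \<le> R \<Longrightarrow> R \<le> 1 \<Longrightarrow> 0 \<le> R1 \<Longrightarrow> R1 \<le> 1 \<Longrightarrow>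
      (\<And>l. l < N \<Longrightarrow> \<exists>y\<in>K0. x0 l = R *\<^sub>R y) \<Longrightarrow> (\<exists>y\<in>K0. x = R1 *\<^sub>R y) \<Longrightarrow>
      (\<And>a. \<gamma> * \<Lambda> * (\<Sum>j<poly_dim TYPE('d) n. (cmod (a j))\<^sup>2)
        \<le> (\<Sum>l<N. (cmod (mi_poly \<alpha> (poly_dim TYPE('d) n) a (x0 l)))\<^sup>2) / real N) \<Longrightarrow>
      cmod (f_hat \<alpha> \<beta> f p m n N (\<lambda>l. p + x0 l) (p + x) $ i - f (p + x) $ i)
        \<le> C * (sqrt (fact m / \<gamma>) * (R ^ n / sqrt \<Lambda>) + R1 ^ m)"
    using coordinate_error[OF K0 f] by blast
  have sup: "gauge_norm K0 y \<le> (SUP x\<in>S. gauge_norm K0 x)" "(SUP x\<in>S. gauge_norm K0 x) \<le> 1"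
      "0 \<le> (SUP x\<in>S. gauge_norm K0 x)"
    if S: "S \<subseteq> K0" and y: "y \<in> S" for S y
  proof -
    have "bdd_above (gauge_norm K0 ` S)"
      by (rule bdd_aboveI2[of _ _ 1]) (use S gauge_norm_mem(2) in blast)
    then show le: "gauge_norm K0 y \<le> (SUP x\<in>S. gauge_norm K0 x)" using y by (intro cSUP_upper)
    show "(SUP x\<in>S. gauge_norm K0 x) \<le> 1"
      by (rule cSUP_least) (use y S gauge_norm_mem(2) in blast)+
    have "0 \<le> gauge_norm K0 y" using gauge_norm_mem(1) S y by blast
    then show "0 \<le> (SUP x\<in>S. gauge_norm K0 x)" using le by linarith
  qed
  have K1': "K1 \<subseteq> K0" using K1(2) interior_subset by blast
  show ?thesis
  proof (rule exI[of _ "real CARD('r) * C"], intro allI impI, rule SUP_least)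
    fix \<alpha> :: "nat \<Rightarrow> nat ^ 'd::_" and \<beta> :: "nat \<Rightarrow> nat ^ 'r::_" and m n N :: nat
      and z0 :: "nat \<Rightarrow> complex ^ 'd::_" and \<gamma> :: real and z :: "complex ^ 'd::_"
    let ?D = "moment_matrix \<alpha> n \<mu>"
    let ?R = "SUP x \<in> msupport \<mu>. gauge_norm K0 x" and ?R1 = "SUP z \<in> K1. gauge_norm K0 z"
    let ?B = "sqrt (fact m / \<gamma>) * (?R ^ n / sqrt (min_eigenvalue ?D)) + ?R1 ^ m"
    assume \<alpha>: "mi_numbering \<alpha>" and \<beta>: "mi_numbering \<beta>" and mn: "m \<le> n" and N: "1 \<le> N"
      and z0: "\<forall>i<N. z0 i \<in> msupport \<mu>" and inv: "invertible_mat ?D" and \<gamma>: "0 < \<gamma>" "\<gamma> < 1"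
      and op: "mat_op_norm (1\<^sub>m (poly_dim TYPE('d) n)
        - mat_inv_sqrt ?D * moment_matrix \<alpha> n (empirical_measure N z0) * mat_inv_sqrt ?D) \<le> 1 - \<gamma>"
      and z: "z \<in> (+) p ` K1"
    obtain x where x: "x \<in> K1" "z = p + x" using z by blast
    note low = empirical_norm_lower_bound[OF \<mu>(1-3) K0(1) N inv \<gamma>(1) op]
    have z0': "z0 l \<in> msupport \<mu>" if "l < N" for l using z0 that by blast
    have data: "\<exists>y\<in>K0. z0 l = ?R *\<^sub>R y" if "l < N" for l
      using gauge_norm_scale[OF K0 _ sup(1)[OF \<mu>(4) z0'[OF that]]] \<mu>(4) z0'[OF that] by blast
    have target: "\<exists>y\<in>K0. x = ?R1 *\<^sub>R y"
      using gauge_norm_scale[OF K0 _ sup(1)[OF K1' x(1)]] K1' x(1) by blast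
    have "0 < N" using N by simp
    note R = sup(2,3)[OF \<mu>(4) z0'[OF this]] and R1 = sup(2,3)[OF K1' x(1)]
    have coord: "cmod (f_hat \<alpha> \<beta> f p m n N (\<lambda>l. p + z0 l) z $ i - f z $ i) \<le> C * ?B" for i
      unfolding x(2)
      by (rule err[OF \<alpha> \<beta> mn N \<gamma>(1) low(1) R(2,1) R1(2,1) data target low(2)])
    have "norm (f_hat \<alpha> \<beta> f p m n N (\<lambda>l. p + z0 l) z - f z)
      \<le> (\<Sum>i\<in>UNIV. cmod ((f_hat \<alpha> \<beta> f p m n N (\<lambda>l. p + z0 l) z - f z) $ i))"
      unfolding norm_vec_def by (rule L2_set_le_sum) auto
    also have "\<dots> \<le> (\<Sum>i\<in>(UNIV :: 'r set). C * ?B)" using coord by (intro sum_mono) simp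
    also have "\<dots> = real CARD('r) * C * ?B" by simp
    finally show "ereal (norm (f_hat \<alpha> \<beta> f p m n N (\<lambda>i. p + z0 i) z - f z)) \<le> ereal (real CARD('r) * C * ?B)"
      by simp
  qed
qed

end
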